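(* Let $N\ge 2$, let the $N$ qubits be split into a subsystem $A$ of $N_A$ qubits and a subsystem $B$ of $N_B=N-N_A$ qubits, and suppose $t:=N_B-N_A\ge 0$. Let $\varepsilon\in(0,1)$ be arbitrary and let $|\psi_0\rangle$ be an arbitrary pure state of the $N$ qubits. If the number $n$ of gates in the random circuit $C_n$ satisfies $$n\ \ge\ \frac{9N(N-1)}{4}\Big[(3\ln 2)\,N+\ln \varepsilon^{-1}\Big],$$ then $$\mathbb{E}\big[E(\psi_n)\big]\ \ge\ N_A-\frac{2^{-t}+\varepsilon}{\ln 2},$$ and $$\mathbb{E}\Big[\max_{|\Psi\rangle\ \text{maximally entangled w.r.t. } A:B}|\langle\psi_n|\Psi\rangle|\Big]\ \ge\ 1-\sqrt{\frac{2^{-t}+\varepsilon}{2\ln 2}}.$$ Here the expectations are over the randomness of the circuit.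
   Context: Random circuit: $C_n=W_n\cdots W_1$, where the two-qubit gates $W_i$ are independent and identically distributed as follows. An ordered pair $(c,t)$ of distinct indices in $\{1,\dots,N\}$ is chosen uniformly at random (among the $N(N-1)$ such pairs); independently, single-qubit unitaries $U$ and $V$ are drawn from the Haar (uniform) measure on $U(2)$; then $W=\mathrm{CNOT}[c,t]\,U[c]\,V[t]$, where $U[c]$ acts as $U$ on qubit $c$ (identity elsewhere), $V[t]$ acts as $V$ on qubit $t$, and $\mathrm{CNOT}[c,t]$ is the controlled-NOT with control qubit $c$ and target qubit $t$. Set $|\psi_n\rangle=C_n|\psi_0\rangle$ and $\rho_{A,n}=\mathrm{Tr}_B(|\psi_n\rangle\langle\psi_n|)$. The entanglement is $E(\psi_n)=S(\rho_{A,n})=-\mathrm{Tr}(\rho_{A,n}\log_2\rho_{A,n})$. A pure state $|\Psi\rangle$ is maximally entangled with respect to the bipartition $A:B$ (with $N_A\le N_B$) if $\mathrm{Tr}_B|\Psi\rangle\langle\Psi|=I/2^{N_A}$. *)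

theory Defs
  imports "HOL-Probability.Probability" "Jordan_Normal_Form.Char_Poly"
begin

type_synonym mat2 = "complex^2^2"

definition adj2 :: "mat2 \<Rightarrow> mat2" where
  "adj2 U = (\<chi> i j. cnj (U $ j $ i))"

definition unitary2 :: "mat2 set" where
  "unitary2 = {U. U ** adj2 U = Finite_Cartesian_Product.mat 1}"

text \<open>Haar (uniform) probability measure on U(2): a probability measure on 2x2 complex
  matrices (Borel sets), concentrated on U(2), invariant under left multiplication by
  every element of U(2). This characterises the Haar measure uniquely.\<close>
definition haar_U2 :: "mat2 measure \<Rightarrow> bool" where
  "haar_U2 \<mu> \<longleftrightarrow> prob_space \<mu> \<and> sets \<mu> = sets borel \<and>
     (AE U in \<mu>. U \<in> unitary2) \<and>
     (\<forall>W\<in>unitary2. distr \<mu> borel (\<lambda>U. W ** U) = \<mu>)"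

text \<open>A state of N qubits is a function on basis indices x < 2^N; qubit q (q < N) is bit q of x.\<close>

definition setb :: "nat \<Rightarrow> nat \<Rightarrow> bool \<Rightarrow> nat" where
  "setb x q b = (if b then set_bit q x else unset_bit q x)"

definition idx2 :: "bool \<Rightarrow> 2" where
  "idx2 b = (if b then 1 else 0)"

definition apply1 :: "mat2 \<Rightarrow> nat \<Rightarrow> (nat \<Rightarrow> complex) \<Rightarrow> (nat \<Rightarrow> complex)" where
  "apply1 U q \<psi> = (\<lambda>x. \<Sum>b\<in>{False, True}. U $ idx2 (bit x q) $ idx2 b * \<psi> (setb x q b))"

definition cnot :: "nat \<Rightarrow> nat \<Rightarrow> (nat \<Rightarrow> complex) \<Rightarrow> (nat \<Rightarrow> complex)" where
  "cnot c t \<psi> = (\<lambda>x. \<psi> (if bit x c then flip_bit t x else x))"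

type_synonym gate = "(nat \<times> nat) \<times> (mat2 \<times> mat2)"

definition apply_gate :: "gate \<Rightarrow> (nat \<Rightarrow> complex) \<Rightarrow> (nat \<Rightarrow> complex)" where
  "apply_gate w \<psi> = (case w of ((c, t), (U, V)) \<Rightarrow> cnot c t (apply1 U c (apply1 V t \<psi>)))"

fun run_circuit :: "nat \<Rightarrow> (nat \<Rightarrow> gate) \<Rightarrow> (nat \<Rightarrow> complex) \<Rightarrow> (nat \<Rightarrow> complex)" where
  "run_circuit 0 g \<psi> = \<psi>"
| "run_circuit (Suc k) g \<psi> = apply_gate (g k) (run_circuit k g \<psi>)"

definition offdiag_pairs :: "nat \<Rightarrow> (nat \<times> nat) set" where
  "offdiag_pairs N = {(c, t). c < N \<and> t < N \<and> c \<noteq> t}"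

definition gate_measure :: "nat \<Rightarrow> mat2 measure \<Rightarrow> gate measure" where
  "gate_measure N \<mu> = uniform_count_measure (offdiag_pairs N) \<Otimes>\<^sub>M (\<mu> \<Otimes>\<^sub>M \<mu>)"

definition circuit_measure :: "nat \<Rightarrow> mat2 measure \<Rightarrow> nat \<Rightarrow> (nat \<Rightarrow> gate) measure" where
  "circuit_measure N \<mu> n = PiM {..<n} (\<lambda>_. gate_measure N \<mu>)"

definition is_pure_state :: "nat \<Rightarrow> (nat \<Rightarrow> complex) \<Rightarrow> bool" where
  "is_pure_state N \<psi> \<longleftrightarrow> (\<Sum>x<2^N. (cmod (\<psi> x))\<^sup>2) = 1"

definition inner_st :: "nat \<Rightarrow> (nat \<Rightarrow> complex) \<Rightarrow> (nat \<Rightarrow> complex) \<Rightarrow> complex" where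
  "inner_st N \<phi> \<psi> = (\<Sum>x<2^N. cnj (\<phi> x) * \<psi> x)"

text \<open>Basis index of N qubits built from an A-index a < 2^|A| and a B-index b < 2^|B|
  (B = complement of A in the N qubits); the i-th qubit of A (in increasing order)
  carries bit i of a, and similarly for B.\<close>
definition join_idx :: "nat \<Rightarrow> nat set \<Rightarrow> nat \<Rightarrow> nat \<Rightarrow> nat" where
  "join_idx N A a b =
     (let As = sorted_list_of_set A; Bs = sorted_list_of_set ({..<N} - A) in
      (\<Sum>i<length As. if bit a i then 2 ^ (As ! i) else 0) +
      (\<Sum>j<length Bs. if bit b j then 2 ^ (Bs ! j) else 0))"

definition reduced_dm :: "nat \<Rightarrow> nat set \<Rightarrow> (nat \<Rightarrow> complex) \<Rightarrow> complex mat" where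
  "reduced_dm N A \<psi> = Matrix.mat (2 ^ card A) (2 ^ card A)
     (\<lambda>(a, a'). \<Sum>b<2 ^ (N - card A). \<psi> (join_idx N A a b) * cnj (\<psi> (join_idx N A a' b)))"

definition eigvals :: "complex mat \<Rightarrow> complex list" where
  "eigvals M = (SOME as. char_poly M = (\<Prod>a\<leftarrow>as. [:- a, 1:]) \<and> length as = dim_row M)"

definition eta :: "real \<Rightarrow> real" where
  "eta x = (if x \<le> 0 then 0 else - x * log 2 x)"

definition vn_entropy :: "complex mat \<Rightarrow> real" where
  "vn_entropy M = (\<Sum>e\<leftarrow>eigvals M. eta (Re e))"

definition entanglement :: "nat \<Rightarrow> nat set \<Rightarrow> (nat \<Rightarrow> complex) \<Rightarrow> real" where
  "entanglement N A \<psi> = vn_entropy (reduced_dm N A \<psi>)"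

definition max_entangled :: "nat \<Rightarrow> nat set \<Rightarrow> (nat \<Rightarrow> complex) \<Rightarrow> bool" where
  "max_entangled N A \<Psi> \<longleftrightarrow> is_pure_state N \<Psi> \<and>
     reduced_dm N A \<Psi> = (1 / 2 ^ card A) \<cdot>\<^sub>m 1\<^sub>m (2 ^ card A)"

text \<open>max over maximally entangled Psi of |<psi|Psi>| (a maximum of a continuous function
  over a compact set, written as a supremum).\<close>
definition max_overlap :: "nat \<Rightarrow> nat set \<Rightarrow> (nat \<Rightarrow> complex) \<Rightarrow> real" where
  "max_overlap N A \<psi> = (SUP \<Psi>\<in>{\<Psi>. max_entangled N A \<Psi>}. cmod (inner_st N \<psi> \<Psi>))"

end

theory Submission
  imports Defs "Jordan_Normal_Form.Schur_Decomposition"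
begin

text \<open>
  Both quantities are controlled by the purity \<open>Tr \<rho>\<^sub>A\<^sup>2\<close>: with \<open>d = 2\<^bsup>|A|\<^esup>\<close>, the entropy is at least
  \<open>|A| - (d Tr \<rho>\<^sub>A\<^sup>2 - 1) / ln 2\<close>, and the largest overlap \<open>Tr (\<surd>\<rho>\<^sub>A) / \<surd>d\<close> is at least
  \<open>(3 - d Tr \<rho>\<^sub>A\<^sup>2) / 2\<close>, because \<open>2 x \<ge> 3 x\<^sup>2 - x\<^sup>4\<close> for \<open>x \<ge> 0\<close>. It remains to bound the expected purity.
  The gate average maps the vector of expected purities \<open>Tr \<rho>\<^sub>S\<^sup>2\<close> of all subsystems \<open>S\<close> linearly to itself.
  In the Pauli basis this map is a reversible Markov chain on the nonempty supports \<open>T\<close> with weights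
  \<open>3\<^bsup>|T|\<^esup>\<close>, whose stationary value gives \<open>d Tr \<rho>\<^sub>A\<^sup>2 \<le> 1 + 2\<^bsup>-t\<^esup>\<close>. The Efron-Stein inequality shows that one
  gate contracts the squared distance to the stationary value by the factor \<open>1 - 32 / (27 N (N - 1))\<close>.
\<close>

text \<open>Otherwise the simplifier splits every \<^term>\<open>\<Sum>x\<in>S. f x + g x\<close>.\<close>

declare class_semiring.finsum_addf [simp del]

section \<open>Spectral gap of the Pauli weight chain\<close>

text \<open>The L2 contraction reduces the whole vector of purities to one number, but the starting
  energy is exponential in N; the term linear in N in the number of gates pays for this. The
  hypothesis on n yields a decay by 256^(-N) * \<epsilon>^2, against an initial energy of at most 4
  * 4^N and a factor 4^|A| \<le> 2^N for returning from L2 to the single purity of A. The purity is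
  quadratic in the projector of the state, so the gate average is taken on two copies of the state
  and two of its conjugate, where the second moment of the Haar measure is the only input about
  U(2). The quantity Tr (\<surd>\<rho>) is reached without a matrix square root: it is the maximum
  of a linear functional over matrices with orthonormal rows, and the first-order conditions at a
  maximizer yield the polar decomposition. Entropy and overlap are defined through a choice of
  eigenvalues and an uncountable supremum, so their measurability and boundedness need arguments of
  their own before expectations can be compared.\<close>

lemma sum_Pow_insert:
  fixes g :: "'a set \<Rightarrow> 'b::comm_monoid_add"
  assumes "finite J" "q \<notin> J"
  shows "(\<Sum>X\<in>Pow (insert q J). g X) = (\<Sum>X\<in>Pow J. g X + g (insert q X))"
proof -
  have "inj_on (insert q) (Pow J)" using assms by (auto simp: inj_on_def)
  moreover have "Pow J \<inter> insert q ` Pow J = {}" using assms by auto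
  ultimately show ?thesis using assms
    by (simp add: Pow_insert sum.union_disjoint sum.reindex sum.distrib o_def)
qed

section \<open>Product weights on subsets and their variance inequality\<close>

abbreviation wt :: "nat set \<Rightarrow> real" where "wt T \<equiv> 3 ^ card T"

lemma sum_wt: "finite J \<Longrightarrow> (\<Sum>T\<in>Pow J. wt T) = 4 ^ card J"
proof (induction rule: finite_induct)
  case (insert q J)
  have "(\<Sum>T\<in>Pow (insert q J). wt T) = (\<Sum>X\<in>Pow J. 4 * wt X)"
    using insert by (subst sum_Pow_insert) (auto intro!: sum.cong simp: card_insert_if finite_subset)
  then show ?case using insert by (simp flip: sum_distrib_left)
qed simp

text \<open>Defines the Pauli weights as the Moebius inverse of the purities, so that no Pauli
  operator has to be introduced.\<close>

lemma moebius_inversion: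
  fixes q :: "nat set \<Rightarrow> real"
  assumes "finite S"
  shows "(\<Sum>T\<in>Pow S. (-1) ^ card T * (\<Sum>R\<in>Pow T. (-1) ^ card R * q R)) = q S"
  using inclusion_exclusion_symmetric[of "\<lambda>T. \<Sum>R\<in>Pow T. (-1) ^ card R * q R" q S] assms by simp

lemma wt_Cauchy_Schwarz:
  assumes "finite J" "Q \<subseteq> Pow J"
  shows "(\<Sum>T\<in>Q. wt T * f T)\<^sup>2 \<le> 4 ^ card J * (\<Sum>T\<in>Q. wt T * (f T)\<^sup>2)"
proof -
  have fin: "finite Q" using assms by (meson finite_Pow_iff finite_subset)
  have s: "wt T = sqrt (wt T) * sqrt (wt T)" for T by simp
  have "(\<Sum>T\<in>Q. wt T * f T)\<^sup>2 = (\<Sum>T\<in>Q. sqrt (wt T) * (sqrt (wt T) * f T))\<^sup>2"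
    by (subst s) (simp only: mult.assoc)
  also have "\<dots> \<le> (\<Sum>T\<in>Q. (sqrt (wt T))\<^sup>2) * (\<Sum>T\<in>Q. (sqrt (wt T) * f T)\<^sup>2)"
    by (rule Cauchy_Schwarz_ineq_sum)
  also have "\<dots> = (\<Sum>T\<in>Q. wt T) * (\<Sum>T\<in>Q. wt T * (f T)\<^sup>2)"
    by (simp add: power_mult_distrib)
  also have "\<dots> \<le> (\<Sum>T\<in>Pow J. wt T) * (\<Sum>T\<in>Q. wt T * (f T)\<^sup>2)"
    using assms by (intro mult_right_mono sum_mono2 sum_nonneg) auto
  finally show ?thesis using assms by (simp add: sum_wt)
qed

text \<open>Divided by 4^|J|, \<open>wt\<close> is the product measure in which each element is
  present with probability 3/4, and the variance is at most the sum of the one-coordinate variances.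
  Two points of weight 1 and 3 contribute exactly 3/4 times their squared difference, whence the
  constant. The induction conditions on \<open>q\<close>.\<close>

lemma Efron_Stein_wt:
  fixes f :: "nat set \<Rightarrow> real"
  assumes "finite J"
  shows "(\<Sum>T\<in>Pow J. wt T * (f T)\<^sup>2) - (\<Sum>T\<in>Pow J. wt T * f T)\<^sup>2 / 4 ^ card J
    \<le> 3/4 * (\<Sum>i\<in>J. \<Sum>S\<in>Pow (J - {i}). wt S * (f (insert i S) - f S)\<^sup>2)"
  using assms
proof (induction arbitrary: f rule: finite_induct)
  case (insert q J)
  define f1 where "f1 = (\<lambda>T. f (insert q T))"
  define s0 where "s0 = (\<Sum>T\<in>Pow J. wt T * f T)"
  define s1 where "s1 = (\<Sum>T\<in>Pow J. wt T * f1 T)"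
  define K where "K = (4::real) ^ card J"
  have K: "K > 0" by (simp add: K_def)
  have c: "wt (insert q T) = 3 * wt T" if "T \<in> Pow J" for T
    using that insert by (subst card_insert_disjoint) (auto intro: finite_subset)
  have e1: "(\<Sum>T\<in>Pow (insert q J). wt T * (f T)\<^sup>2)
      = (\<Sum>T\<in>Pow J. wt T * (f T)\<^sup>2) + 3 * (\<Sum>T\<in>Pow J. wt T * (f1 T)\<^sup>2)"
    using insert c by (subst sum_Pow_insert)
      (auto simp: f1_def sum.distrib sum_distrib_left mult.assoc intro!: sum.cong)
  have e2: "(\<Sum>T\<in>Pow (insert q J). wt T * f T) = s0 + 3 * s1"
    using insert c by (subst sum_Pow_insert)
      (auto simp: f1_def s0_def s1_def sum.distrib sum_distrib_left mult.assoc intro!: sum.cong)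
  have e3: "(\<Sum>S\<in>Pow (insert q J - {i}). wt S * (f (insert i S) - f S)\<^sup>2)
    = (\<Sum>S\<in>Pow (J - {i}). wt S * (f (insert i S) - f S)\<^sup>2)
      + 3 * (\<Sum>S\<in>Pow (J - {i}). wt S * (f1 (insert i S) - f1 S)\<^sup>2)" if i: "i \<in> J" for i
  proof -
    have eq: "insert q J - {i} = insert q (J - {i})" using i insert by auto
    have "(\<Sum>S\<in>Pow (insert q (J - {i})). wt S * (f (insert i S) - f S)\<^sup>2)
      = (\<Sum>S\<in>Pow (J - {i}). wt S * (f (insert i S) - f S)\<^sup>2 + wt (insert q S) * (f (insert i (insert q S)) - f (insert q S))\<^sup>2)"
      using insert i by (subst sum_Pow_insert) auto
    also have "\<dots> = (\<Sum>S\<in>Pow (J - {i}). wt S * (f (insert i S) - f S)\<^sup>2 + 3 * (wt S * (f1 (insert i S) - f1 S)\<^sup>2))"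
      by (intro sum.cong refl) (subst c, auto simp: f1_def insert_commute)
    finally show ?thesis by (simp add: eq sum.distrib sum_distrib_left)
  qed
  have "insert q J - {q} = J" using insert by auto
  then have e4: "(\<Sum>i\<in>insert q J. \<Sum>S\<in>Pow (insert q J - {i}). wt S * (f (insert i S) - f S)\<^sup>2)
    = (\<Sum>S\<in>Pow J. wt S * (f1 S - f S)\<^sup>2)
     + (\<Sum>i\<in>J. \<Sum>S\<in>Pow (J - {i}). wt S * (f (insert i S) - f S)\<^sup>2)
     + 3 * (\<Sum>i\<in>J. \<Sum>S\<in>Pow (J - {i}). wt S * (f1 (insert i S) - f1 S)\<^sup>2)"
    using insert by (simp add: e3 sum.distrib sum_distrib_left f1_def)
  have "s1 - s0 = (\<Sum>T\<in>Pow J. wt T * (f1 T - f T))"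
    by (simp add: s0_def s1_def algebra_simps sum_subtractf)
  then have "(s1 - s0)\<^sup>2 \<le> K * (\<Sum>S\<in>Pow J. wt S * (f1 S - f S)\<^sup>2)"
    using wt_Cauchy_Schwarz[OF insert(1) order.refl, of "\<lambda>T. f1 T - f T"] by (simp add: K_def)
  then have cs: "(s1 - s0)\<^sup>2 / K \<le> (\<Sum>S\<in>Pow J. wt S * (f1 S - f S)\<^sup>2)"
    using K by (simp add: field_simps)
  \<comment> \<open>Two-point variance for the weights 1 and 3: what couples the two halves is the
    squared difference of their sums, which \<open>cs\<close> bounds.\<close>
  have id: "(s0 + 3 * s1)\<^sup>2 / (4 * K) = s0\<^sup>2 / K + 3 * (s1\<^sup>2 / K) - 3/4 * ((s1 - s0)\<^sup>2 / K)"
    using K by (simp add: field_simps power2_eq_square)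
  have "card (insert q J) = Suc (card J)" using insert by simp
  then show ?case
    using insert.IH[of f] insert.IH[of f1] cs
    unfolding e1 e2 e4 by (simp add: id flip: s0_def s1_def K_def)
qed simp

text \<open>If \<open>h T\<close> is the mean of \<open>(Tr (\<sigma> |\<psi>\<rangle>\<langle>\<psi>|))\<^sup>2\<close> over the \<open>3\<^bsup>|T|\<^esup>\<close> Pauli strings \<open>\<sigma>\<close> with
  support \<open>T\<close>, this is its value after one gate. Haar rotations make the Paulis on \<open>c\<close> and \<open>t\<close> uniform, and
  CNOT sends 1 of the 3 strings supported on \<open>c\<close> to itself and 2 to full support, while of the 9 strings
  with full support it sends 2 to \<open>c\<close>, 2 to \<open>t\<close> and 5 to full support.\<close>

definition pair_step :: "nat \<Rightarrow> nat \<Rightarrow> (nat set \<Rightarrow> real) \<Rightarrow> nat set \<Rightarrow> real" where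
  "pair_step c t h T =
    (if c \<in> T \<and> t \<in> T then (2 * h (T - {t}) + 2 * h (T - {c}) + 5 * h T) / 9
     else if c \<in> T \<or> t \<in> T then (h T + 2 * h (insert c (insert t T))) / 3
     else h T)"

section \<open>Energy dissipated by one averaged gate\<close>

definition pair_mean :: "nat \<Rightarrow> (nat \<times> nat \<Rightarrow> real) \<Rightarrow> real" where
  "pair_mean N g = (\<Sum>p\<in>offdiag_pairs N. g p) / (real N * (real N - 1))"

lemma finite_offdiag_pairs [simp]: "finite (offdiag_pairs N)"
  by (rule finite_subset[of _ "{..<N} \<times> {..<N}"]) (auto simp: offdiag_pairs_def)

lemma sum_offdiag_pairs:
  "(\<Sum>p\<in>offdiag_pairs N. g p) = (\<Sum>t<N. \<Sum>c\<in>{..<N} - {t}. g (c, t))"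
proof -
  have "(\<Sum>t<N. \<Sum>c\<in>{..<N} - {t}. g (c, t)) = (\<Sum>(t,c)\<in>(SIGMA t:{..<N}. {..<N} - {t}). g (c, t))"
    by (rule sum.Sigma) auto
  also have "\<dots> = (\<Sum>p\<in>offdiag_pairs N. g p)"
    by (rule sum.reindex_bij_witness[of _ "\<lambda>(c,t). (t,c)" "\<lambda>(t,c). (c,t)"]) (auto simp: offdiag_pairs_def)
  finally show ?thesis by simp
qed

lemma sum_offdiag_pairs_swap:
  "(\<Sum>(c,t)\<in>offdiag_pairs N. g c t) = (\<Sum>(c,t)\<in>offdiag_pairs N. g t c)"
  by (rule sum.reindex_bij_witness[of _ "\<lambda>(c,t). (t,c)" "\<lambda>(c,t). (t,c)"]) (auto simp: offdiag_pairs_def)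

lemma card_offdiag_pairs: "N \<ge> 1 \<Longrightarrow> real (card (offdiag_pairs N)) = real N * (real N - 1)"
  using sum_offdiag_pairs[of "\<lambda>_. 1::real" N] by (simp add: of_nat_diff)

text \<open>The four extensions of a set R avoiding c and t form a block that
  \<open>pair_step\<close> maps to itself, with weights in the ratio 1 : 3 : 3 : 9. Claims about one
  gate thus become checks on four numbers.\<close>

lemma pair_sum_split:
  fixes g :: "nat set \<Rightarrow> 'b::comm_monoid_add"
  assumes "finite I" "c \<in> I" "t \<in> I" "c \<noteq> t"
  shows "(\<Sum>T\<in>Pow I. g T) = (\<Sum>R\<in>Pow (I - {c,t}).
     g R + g (insert c R) + g (insert t R) + g (insert c (insert t R)))"
proof -
  have I: "I = insert c (insert t (I - {c,t}))" using assms by auto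
  have "(\<Sum>T\<in>Pow I. g T) = (\<Sum>T\<in>Pow (insert t (I - {c,t})). g T + g (insert c T))"
    by (subst I, rule sum_Pow_insert) (use assms in auto)
  also have "\<dots> = (\<Sum>R\<in>Pow (I - {c,t}). g R + g (insert c R) + (g (insert t R) + g (insert c (insert t R))))"
    by (rule sum_Pow_insert) (use assms in auto)
  finally show ?thesis by (simp add: add.assoc)
qed

lemma pair_block:
  assumes "finite I" "c \<noteq> t" "R \<in> Pow (I - {c,t})"
  shows "wt (insert c R) = 3 * wt R" "wt (insert t R) = 3 * wt R"
    "wt (insert c (insert t R)) = 9 * wt R"
    "pair_step c t h R = h R"
    "pair_step c t h (insert c R) = (h (insert c R) + 2 * h (insert c (insert t R))) / 3"
    "pair_step c t h (insert t R) = (h (insert t R) + 2 * h (insert c (insert t R))) / 3"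
    "pair_step c t h (insert c (insert t R))
      = (2 * h (insert c R) + 2 * h (insert t R) + 5 * h (insert c (insert t R))) / 9"
proof -
  have f: "finite R" "c \<notin> R" "t \<notin> R" using assms by (auto intro: finite_subset)
  have d: "insert c (insert t R) - {t} = insert c R" "insert c (insert t R) - {c} = insert t R"
    using f assms by auto
  show "wt (insert c R) = 3 * wt R" "wt (insert t R) = 3 * wt R"
    "wt (insert c (insert t R)) = 9 * wt R"
    "pair_step c t h R = h R"
    "pair_step c t h (insert c R) = (h (insert c R) + 2 * h (insert c (insert t R))) / 3"
    "pair_step c t h (insert t R) = (h (insert t R) + 2 * h (insert c (insert t R))) / 3"
    "pair_step c t h (insert c (insert t R))
      = (2 * h (insert c R) + 2 * h (insert t R) + 5 * h (insert c (insert t R))) / 9"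
    using f assms(2) by (auto simp: pair_step_def d insert_commute)
qed

text \<open>On a block with values x, y on one-qubit extensions and z on the two-qubit one, the
  energy lost is exactly \<open>wt R / 9\<close> times 16 (z-x)^2 + 16 (z-y)^2 + 4 (x-y)^2. The last
  term is discarded, because only differences along the insertion of one qubit enter the Efron-Stein
  inequality.\<close>

lemma energy_pair_step:
  assumes "finite I" "c \<in> I" "t \<in> I" "c \<noteq> t"
  shows "(\<Sum>T\<in>Pow I. wt T * (pair_step c t f T)\<^sup>2) \<le> (\<Sum>T\<in>Pow I. wt T * (f T)\<^sup>2)
    - 16/9 * (\<Sum>R\<in>Pow (I - {c,t}). wt R * (f (insert c (insert t R)) - f (insert c R))\<^sup>2)
    - 16/9 * (\<Sum>R\<in>Pow (I - {t,c}). wt R * (f (insert t (insert c R)) - f (insert t R))\<^sup>2)"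
proof -
  let ?J = "I - {c,t}"
  have sw: "I - {t,c} = ?J" by auto
  have "(\<Sum>T\<in>Pow I. wt T * (pair_step c t f T)\<^sup>2) \<le> (\<Sum>R\<in>Pow ?J. wt R * (f R)\<^sup>2
     + wt (insert c R) * (f (insert c R))\<^sup>2 + wt (insert t R) * (f (insert t R))\<^sup>2
     + wt (insert c (insert t R)) * (f (insert c (insert t R)))\<^sup>2
     - 16/9 * (wt R * (f (insert c (insert t R)) - f (insert c R))\<^sup>2)
     - 16/9 * (wt R * (f (insert c (insert t R)) - f (insert t R))\<^sup>2))"
    unfolding pair_sum_split[OF assms]
  proof (rule sum_mono)
    fix R assume R: "R \<in> Pow ?J"
    define x where "x = f (insert c R)" define y where "y = f (insert t R)"
    define z where "z = f (insert c (insert t R))"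
    have "9 * (f R)\<^sup>2 + 3 * (x + 2*z)\<^sup>2 + 3 * (y + 2*z)\<^sup>2 + (2*x+2*y+5*z)\<^sup>2
       = 9 * (f R)\<^sup>2 + 27 * x\<^sup>2 + 27 * y\<^sup>2 + 81 * z\<^sup>2 - 16 * (z-x)\<^sup>2 - 16 * (z-y)\<^sup>2 - 4 * (x-y)\<^sup>2"
      by (simp add: power2_eq_square algebra_simps)
    then have "9 * (f R)\<^sup>2 + 3 * (x + 2*z)\<^sup>2 + 3 * (y + 2*z)\<^sup>2 + (2*x+2*y+5*z)\<^sup>2
       \<le> 9 * (f R)\<^sup>2 + 27 * x\<^sup>2 + 27 * y\<^sup>2 + 81 * z\<^sup>2 - 16 * (z-x)\<^sup>2 - 16 * (z-y)\<^sup>2"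
      by simp
    from mult_left_mono[OF this, of "wt R / 9"]
    show "wt R * (pair_step c t f R)\<^sup>2 + wt (insert c R) * (pair_step c t f (insert c R))\<^sup>2
       + wt (insert t R) * (pair_step c t f (insert t R))\<^sup>2
       + wt (insert c (insert t R)) * (pair_step c t f (insert c (insert t R)))\<^sup>2
       \<le> wt R * (f R)\<^sup>2 + wt (insert c R) * (f (insert c R))\<^sup>2 + wt (insert t R) * (f (insert t R))\<^sup>2
     + wt (insert c (insert t R)) * (f (insert c (insert t R)))\<^sup>2
     - 16/9 * (wt R * (f (insert c (insert t R)) - f (insert c R))\<^sup>2)
     - 16/9 * (wt R * (f (insert c (insert t R)) - f (insert t R))\<^sup>2)"
      unfolding pair_block[OF assms(1) assms(4) R] x_def[symmetric] y_def[symmetric] z_def[symmetric]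
      by (simp add: power_divide algebra_simps)
  qed
  also have "\<dots> = (\<Sum>T\<in>Pow I. wt T * (f T)\<^sup>2)
    - 16/9 * (\<Sum>R\<in>Pow ?J. wt R * (f (insert c (insert t R)) - f (insert c R))\<^sup>2)
    - 16/9 * (\<Sum>R\<in>Pow ?J. wt R * (f (insert c (insert t R)) - f (insert t R))\<^sup>2)"
    unfolding pair_sum_split[OF assms] by (simp only: sum_subtractf sum_distrib_left)
  finally show ?thesis by (simp only: sw insert_commute[of t c])
qed

text \<open>Double counting: S arises as \<open>insert c R\<close> once for each of its
  elements.\<close>

lemma sum_insert_Pow_Diff:
  fixes g :: "'a set \<Rightarrow> real"
  assumes "finite J"
  shows "(\<Sum>c\<in>J. \<Sum>R\<in>Pow (J - {c}). g (insert c R)) = (\<Sum>S\<in>Pow J. real (card S) * g S)"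
proof -
  have "(\<Sum>R\<in>Pow (J - {c}). g (insert c R)) = (\<Sum>S\<in>{S\<in>Pow J. c \<in> S}. g S)" if "c \<in> J" for c
    by (rule sum.reindex_bij_witness[of _ "\<lambda>S. S - {c}" "insert c"]) (use that in auto)
  then have "(\<Sum>c\<in>J. \<Sum>R\<in>Pow (J - {c}). g (insert c R)) = (\<Sum>c\<in>J. \<Sum>S\<in>{S\<in>Pow J. c \<in> S}. g S)"
    by simp
  also have "\<dots> = (\<Sum>S\<in>Pow J. \<Sum>c\<in>{c\<in>J. c \<in> S}. g S)"
    using assms by (intro sum.swap_restrict) auto
  also have "\<dots> = (\<Sum>S\<in>Pow J. real (card S) * g S)"
    by (intro sum.cong refl) (auto simp: Int_def intro!: arg_cong[where f=card])
  finally show ?thesis .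
qed

text \<open>The constant 32/27 is 2 * 16/9 divided by 3: both orders of a pair contribute, and
  \<open>wt (insert c R) = 3 * wt R\<close> costs the 3. The empty S is excluded because a qubit t
  can join a support only if some partner c already belongs to it.\<close>

lemma energy_pair_mean:
  assumes "N \<ge> 2"
  shows "pair_mean N (\<lambda>(c,t). \<Sum>T\<in>Pow {..<N}. wt T * (pair_step c t f T)\<^sup>2)
    \<le> (\<Sum>T\<in>Pow {..<N}. wt T * (f T)\<^sup>2)
     - 32 / (27 * (real N * (real N - 1))) *
        (\<Sum>t<N. \<Sum>S\<in>Pow ({..<N} - {t}) - {{}}. wt S * (f (insert t S) - f S)\<^sup>2)"
proof -
  let ?I = "{..<N}"
  define E where "E = (\<Sum>T\<in>Pow ?I. wt T * (f T)\<^sup>2)"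
  define G where "G = (\<lambda>c t. \<Sum>R\<in>Pow (?I - {c,t}). wt R * (f (insert c (insert t R)) - f (insert c R))\<^sup>2)"
  define D where "D = (\<Sum>t<N. \<Sum>S\<in>Pow (?I - {t}) - {{}}. wt S * (f (insert t S) - f S)\<^sup>2)"
  have pos: "real N * (real N - 1) > 0" using assms by simp
  have "(\<Sum>(c,t)\<in>offdiag_pairs N. \<Sum>T\<in>Pow ?I. wt T * (pair_step c t f T)\<^sup>2)
    \<le> (\<Sum>(c,t)\<in>offdiag_pairs N. E - 16/9 * G c t - 16/9 * G t c)"
  proof (rule sum_mono, clarify)
    fix c t assume "(c, t) \<in> offdiag_pairs N"
    then show "(\<Sum>T\<in>Pow ?I. wt T * (pair_step c t f T)\<^sup>2) \<le> E - 16/9 * G c t - 16/9 * G t c"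
      unfolding E_def G_def by (intro energy_pair_step) (auto simp: offdiag_pairs_def)
  qed
  also have "\<dots> = (real N * (real N - 1)) * E - 16/9 * (\<Sum>(c,t)\<in>offdiag_pairs N. G c t)
     - 16/9 * (\<Sum>(c,t)\<in>offdiag_pairs N. G t c)"
    using assms by (simp add: case_prod_unfold sum_subtractf sum_distrib_left flip: card_offdiag_pairs)
  also have "\<dots> = (real N * (real N - 1)) * E - 32/9 * (\<Sum>(c,t)\<in>offdiag_pairs N. G c t)"
    using sum_offdiag_pairs_swap[of G N] by simp
  finally have 1: "(\<Sum>(c,t)\<in>offdiag_pairs N. \<Sum>T\<in>Pow ?I. wt T * (pair_step c t f T)\<^sup>2)
    \<le> (real N * (real N - 1)) * E - 32/9 * (\<Sum>(c,t)\<in>offdiag_pairs N. G c t)" .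
  have "D \<le> (\<Sum>t<N. 3 * (\<Sum>c\<in>?I - {t}. G c t))"
    unfolding D_def
  proof (rule sum_mono)
    fix t assume "t \<in> ?I"
    let ?J = "?I - {t}"
    let ?g = "\<lambda>S. wt S * (f (insert t S) - f S)\<^sup>2"
    \<comment> \<open>A nonempty S is reached through each of its elements c; keeping one of these
      \<open>card S\<close> ways is the loss in this estimate.\<close>
    have "(\<Sum>S\<in>Pow ?J - {{}}. ?g S) \<le> (\<Sum>S\<in>Pow ?J - {{}}. real (card S) * ?g S)"
    proof (rule sum_mono)
      fix S assume "S \<in> Pow ?J - {{}}"
      then have "card S \<noteq> 0" using finite_subset[of S ?J] by auto
      then have "1 \<le> real (card S)" by simp
      then show "?g S \<le> real (card S) * ?g S" using mult_right_mono[of 1 "real (card S)" "?g S"] by simp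
    qed
    also have "\<dots> \<le> (\<Sum>S\<in>Pow ?J. real (card S) * ?g S)"
      by (intro sum_mono2) auto
    also have "\<dots> = (\<Sum>c\<in>?J. \<Sum>R\<in>Pow (?J - {c}). ?g (insert c R))"
      by (rule sum_insert_Pow_Diff[symmetric]) simp
    also have "\<dots> = (\<Sum>c\<in>?J. 3 * G c t)"
    proof (rule sum.cong[OF refl])
      fix c assume c: "c \<in> ?J"
      have eq: "?J - {c} = ?I - {c,t}" by auto
      show "(\<Sum>R\<in>Pow (?J - {c}). ?g (insert c R)) = 3 * G c t"
        unfolding G_def sum_distrib_left eq
      proof (rule sum.cong[OF refl])
        fix R assume "R \<in> Pow (?I - {c,t})"
        then show "?g (insert c R) = 3 * (wt R * (f (insert c (insert t R)) - f (insert c R))\<^sup>2)"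
          using c pair_block(1)[of ?I c t R] by (simp add: insert_commute)
      qed
    qed
    finally show "(\<Sum>S\<in>Pow ?J - {{}}. ?g S) \<le> 3 * (\<Sum>c\<in>?J. G c t)"
      by (simp add: sum_distrib_left)
  qed
  also have "\<dots> = 3 * (\<Sum>(c,t)\<in>offdiag_pairs N. G c t)"
    by (simp add: sum_offdiag_pairs[of "\<lambda>(c,t). G c t"] sum_distrib_left)
  finally have 2: "D \<le> 3 * (\<Sum>(c,t)\<in>offdiag_pairs N. G c t)" .
  have "(\<Sum>(c,t)\<in>offdiag_pairs N. \<Sum>T\<in>Pow ?I. wt T * (pair_step c t f T)\<^sup>2)
    \<le> (real N * (real N - 1)) * E - 32/27 * D"
    using 1 2 by linarith
  moreover have "X / K \<le> E - 32 / (27 * K) * D" if "X \<le> K * E - 32/27 * D" "K > 0" for X K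
    using that by (simp add: field_simps)
  ultimately show ?thesis
    unfolding pair_mean_def E_def[symmetric] D_def[symmetric] using pos by blast
qed

text \<open>The chain never reaches the empty set. Its value may therefore be chosen freely: with the mean over the
  singletons, the boundary terms of the Efron-Stein inequality are absorbed by the remaining ones.\<close>

lemma Poincare_wt:
  fixes f :: "nat set \<Rightarrow> real"
  assumes "N \<ge> 2" and f0: "f {} = 0" and mean: "(\<Sum>T\<in>Pow {..<N}. wt T * f T) = 0"
  shows "(\<Sum>T\<in>Pow {..<N}. wt T * (f T)\<^sup>2)
    \<le> (\<Sum>t<N. \<Sum>S\<in>Pow ({..<N} - {t}) - {{}}. wt S * (f (insert t S) - f S)\<^sup>2)" (is "_ \<le> ?D")
proof -
  let ?I = "{..<N}"
  define x where "x = (\<Sum>i<N. f {i}) / real N"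
  define f' where "f' = f({} := x)"
  define G where "G = (\<Sum>i<N. \<Sum>j\<in>?I - {i}. (f {i,j} - f {j})\<^sup>2)"
  have N: "real N > 0" using assms by simp
  have sp: "(\<Sum>T\<in>Pow J. g T) = g {} + (\<Sum>T\<in>Pow J - {{}}. g T)" if "finite J" for g :: "nat set \<Rightarrow> real" and J
    using that by (subst sum.remove[of _ "{}"]) auto
  have e1: "(\<Sum>T\<in>Pow ?I. wt T * (f' T)\<^sup>2) = (\<Sum>T\<in>Pow ?I. wt T * (f T)\<^sup>2) + x\<^sup>2"
    by (subst (1 2) sp) (auto simp: f'_def f0)
  have e2: "(\<Sum>T\<in>Pow ?I. wt T * f' T) = x"
    using mean by (subst (asm) sp, simp, subst sp) (auto simp: f'_def f0)
  have e3: "(\<Sum>t<N. \<Sum>S\<in>Pow (?I - {t}). wt S * (f' (insert t S) - f' S)\<^sup>2) = ?D + (\<Sum>i<N. (f {i} - x)\<^sup>2)"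
    by (subst sp) (auto simp: f'_def sum.distrib)
  have "x\<^sup>2 / 4 ^ N \<le> x\<^sup>2" by (simp add: divide_le_eq mult_le_cancel_left1)
  then have es: "(\<Sum>T\<in>Pow ?I. wt T * (f T)\<^sup>2) \<le> 3/4 * (?D + (\<Sum>i<N. (f {i} - x)\<^sup>2))"
    using Efron_Stein_wt[of ?I f'] unfolding e1 e2 e3 by simp
  have s1: "(\<Sum>i<N. f {i}) = real N * x" using N by (simp add: x_def)
  have "(\<Sum>i<N. \<Sum>j<N. (f {i} - f {j})\<^sup>2)
     = (\<Sum>i<N. \<Sum>j<N. (f {i})\<^sup>2 + (f {j})\<^sup>2 - 2 * f {i} * f {j})"
    by (simp add: power2_eq_square algebra_simps)
  also have "\<dots> = 2 * real N * (\<Sum>i<N. (f {i})\<^sup>2) - 2 * (real N * x)\<^sup>2"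
    by (simp add: sum.distrib sum_subtractf s1 power2_eq_square flip: sum_distrib_left sum_distrib_right)
  also have "\<dots> = 2 * real N * (\<Sum>i<N. (f {i} - x)\<^sup>2)"
  proof -
    have "(\<Sum>i<N. (f {i} - x)\<^sup>2) = (\<Sum>i<N. (f {i})\<^sup>2 + x\<^sup>2 - 2 * x * f {i})"
      by (simp add: power2_eq_square algebra_simps)
    also have "\<dots> = (\<Sum>i<N. (f {i})\<^sup>2) - real N * x\<^sup>2"
      by (simp add: sum.distrib sum_subtractf s1 power2_eq_square flip: sum_distrib_left)
    finally have v1: "(\<Sum>i<N. (f {i} - x)\<^sup>2) = (\<Sum>i<N. (f {i})\<^sup>2) - real N * x\<^sup>2" .
    show ?thesis unfolding v1 by (simp add: power2_eq_square algebra_simps)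
  qed
  finally have v: "2 * real N * (\<Sum>i<N. (f {i} - x)\<^sup>2) = (\<Sum>i<N. \<Sum>j<N. (f {i} - f {j})\<^sup>2)" by simp
  also have "\<dots> = (\<Sum>i<N. \<Sum>j\<in>?I - {i}. (f {i} - f {j})\<^sup>2)"
    by (intro sum.cong refl sum.mono_neutral_right) auto
  \<comment> \<open>Two singletons are compared through the doubleton into which both can
    grow.\<close>
  also have "\<dots> \<le> (\<Sum>i<N. \<Sum>j\<in>?I - {i}. 2 * (f {i,j} - f {j})\<^sup>2 + 2 * (f {j,i} - f {i})\<^sup>2)"
  proof (intro sum_mono)
    fix i j
    have *: "(a - b)\<^sup>2 \<le> 2 * (c - b)\<^sup>2 + 2 * (c - a)\<^sup>2" for a b c :: real
    proof -
      have "2 * (c - b)\<^sup>2 + 2 * (c - a)\<^sup>2 - (a - b)\<^sup>2 = (2 * c - a - b)\<^sup>2"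
        by (simp add: power2_eq_square algebra_simps)
      then show ?thesis using zero_le_power2[of "2 * c - a - b"] by linarith
    qed
    show "(f {i} - f {j})\<^sup>2 \<le> 2 * (f {i,j} - f {j})\<^sup>2 + 2 * (f {j,i} - f {i})\<^sup>2"
      using *[of "f {i}" "f {j}" "f {i,j}"] by (simp add: insert_commute)
  qed
  also have "\<dots> = 2 * G + 2 * (\<Sum>i<N. \<Sum>j\<in>?I - {i}. (f {j,i} - f {i})\<^sup>2)"
    by (simp add: G_def sum.distrib sum_distrib_left)
  also have "(\<Sum>i<N. \<Sum>j\<in>?I - {i}. (f {j,i} - f {i})\<^sup>2) = G"
    using sum_offdiag_pairs_swap[of "\<lambda>i j. (f {i,j} - f {i})\<^sup>2" N]
    unfolding G_def by (simp add: sum_offdiag_pairs insert_commute)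
  finally have v: "2 * real N * (\<Sum>i<N. (f {i} - x)\<^sup>2) \<le> 4 * G" by simp
  have G0: "(\<Sum>i<N. (f {i} - x)\<^sup>2) \<ge> 0" by (intro sum_nonneg) auto
  \<comment> \<open>Here N \<ge> 2 turns the factor 2 N into the 4 that matches 4 * G.\<close>
  have "4 * (\<Sum>i<N. (f {i} - x)\<^sup>2) \<le> 2 * real N * (\<Sum>i<N. (f {i} - x)\<^sup>2)"
    using assms G0 by (intro mult_right_mono) auto
  with v have vG: "(\<Sum>i<N. (f {i} - x)\<^sup>2) \<le> G" by linarith
  have "3 * G \<le> ?D"
    unfolding G_def sum_distrib_left
  proof (intro sum_mono)
    fix i assume "i \<in> ?I"
    have "(\<Sum>j\<in>?I - {i}. 3 * (f {i,j} - f {j})\<^sup>2)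
        = (\<Sum>S\<in>(\<lambda>j. {j}) ` (?I - {i}). wt S * (f (insert i S) - f S)\<^sup>2)"
      by (subst sum.reindex) auto
    also have "\<dots> \<le> (\<Sum>S\<in>Pow (?I - {i}) - {{}}. wt S * (f (insert i S) - f S)\<^sup>2)"
      by (intro sum_mono2) auto
    finally show "(\<Sum>j\<in>?I - {i}. 3 * (f {i,j} - f {j})\<^sup>2)
      \<le> (\<Sum>S\<in>Pow (?I - {i}) - {{}}. wt S * (f (insert i S) - f S)\<^sup>2)" .
  qed
  \<comment> \<open>The constants close exactly: 3/4 * (D + D/3) = D.\<close>
  moreover have "E \<le> D" if "E \<le> 3/4 * (D + v)" "v \<le> G" "3 * G \<le> D" for E D v :: real
    using that by (simp add: field_simps)
  ultimately show ?thesis using es vG by blast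
qed

text \<open>\<^const>\<open>pair_step\<close> in terms of \<open>q S = 2\<^bsup>|S|\<^esup> Tr \<rho>\<^sub>S\<^sup>2 = (\<Sum>T\<subseteq>S. 3\<^bsup>|T|\<^esup> h T)\<close>.\<close>

definition pair_q :: "nat \<Rightarrow> nat \<Rightarrow> (nat set \<Rightarrow> real) \<Rightarrow> nat set \<Rightarrow> real" where
  "pair_q c t q S =
    (if c \<in> S \<and> t \<notin> S then 8/9 * q (S - {c}) + 1/9 * q S - 2/9 * q (insert t (S - {c})) + 2/9 * q (insert t S)
     else if t \<in> S \<and> c \<notin> S then 8/9 * q (S - {t}) + 1/9 * q S - 2/9 * q (insert c (S - {t})) + 2/9 * q (insert c S)
     else q S)"

lemma pair_step_commute: "pair_step c t h = pair_step t c h"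
  by (rule ext) (auto simp: pair_step_def insert_commute)

text \<open>A gate inside S or disjoint from S must leave the purity fixed; for S containing both
  qubits this is the stationarity of \<open>wt\<close> on each block. If the gate crosses the
  boundary of S, growth of the support brings in \<open>insert t S\<close>, and the term with
  \<open>insert t (S - {c})\<close> removes the supports containing t but not c.\<close>

lemma sum_pair_step:
  assumes "finite S" "c \<noteq> t"
  shows "(\<Sum>T\<in>Pow S. wt T * pair_step c t h T) = pair_q c t (\<lambda>S. \<Sum>T\<in>Pow S. wt T * h T) S"
proof -
  have one: "(\<Sum>T\<in>Pow S. wt T * pair_step c t h T)
    = 8/9 * (\<Sum>T\<in>Pow (S - {c}). wt T * h T) + 1/9 * (\<Sum>T\<in>Pow S. wt T * h T)
      - 2/9 * (\<Sum>T\<in>Pow (insert t (S - {c})). wt T * h T) + 2/9 * (\<Sum>T\<in>Pow (insert t S). wt T * h T)"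
    if c: "c \<in> S" and t: "t \<notin> S" and ct: "c \<noteq> t" for c t
  proof -
    define R where "R = S - {c}"
    have S: "S = insert c R" "c \<notin> R" "t \<notin> R" "finite R" using that assms by (auto simp: R_def)
    have b: "T \<in> Pow (insert c (insert t R) - {c,t})" if "T \<in> Pow R" for T
      using that S by auto
    have c1: "(\<Sum>T\<in>Pow S. g T) = (\<Sum>T\<in>Pow R. g T + g (insert c T))" for g :: "nat set \<Rightarrow> real"
      unfolding S by (rule sum_Pow_insert) (use S in auto)
    have c2: "(\<Sum>T\<in>Pow (insert t R). g T) = (\<Sum>T\<in>Pow R. g T + g (insert t T))" for g :: "nat set \<Rightarrow> real"
      by (rule sum_Pow_insert) (use S in auto)
    have "insert t S - {c,t} = R" using S ct by auto
    then have c3: "(\<Sum>T\<in>Pow (insert t S). g T)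
      = (\<Sum>T\<in>Pow R. g T + g (insert c T) + g (insert t T) + g (insert c (insert t T)))" for g :: "nat set \<Rightarrow> real"
      using pair_sum_split[of "insert t S" c t g] S ct by simp
    show ?thesis unfolding R_def[symmetric] c1 c2 c3
      unfolding sum_distrib_left sum.distrib[symmetric] sum_subtractf[symmetric]
    proof (rule sum.cong[OF refl])
      fix T assume T: "T \<in> Pow R"
      note pb = pair_block[OF finite.insertI[OF finite.insertI[OF S(4)]] ct b[OF T]]
      show "wt T * pair_step c t h T + wt (insert c T) * pair_step c t h (insert c T) =
        8/9 * (wt T * h T) + 1/9 * (wt T * h T + wt (insert c T) * h (insert c T))
        - 2/9 * (wt T * h T + wt (insert t T) * h (insert t T))
        + 2/9 * (wt T * h T + wt (insert c T) * h (insert c T) + wt (insert t T) * h (insert t T)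
          + wt (insert c (insert t T)) * h (insert c (insert t T)))"
        unfolding pb by (simp add: algebra_simps)
    qed
  qed
  consider "c \<in> S \<and> t \<notin> S" | "t \<in> S \<and> c \<notin> S" | "c \<in> S \<and> t \<in> S" | "c \<notin> S \<and> t \<notin> S" by blast
  then show ?thesis
  proof cases
    case 1 then show ?thesis using one[of c t] assms by (simp add: pair_q_def)
  next
    case 2 then show ?thesis using one[of t c] assms
      by (simp add: pair_q_def pair_step_commute[of c t])
  next
    case 3
    have "(\<Sum>T\<in>Pow S. wt T * pair_step c t h T) = (\<Sum>T\<in>Pow S. wt T * h T)"
      unfolding pair_sum_split[OF assms(1) conjunct1[OF 3] conjunct2[OF 3] assms(2)]
    proof (rule sum.cong[OF refl])
      fix R assume "R \<in> Pow (S - {c,t})"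
      note pb = pair_block[OF assms this]
      show "wt R * pair_step c t h R + wt (insert c R) * pair_step c t h (insert c R)
          + wt (insert t R) * pair_step c t h (insert t R)
          + wt (insert c (insert t R)) * pair_step c t h (insert c (insert t R))
        = wt R * h R + wt (insert c R) * h (insert c R) + wt (insert t R) * h (insert t R)
          + wt (insert c (insert t R)) * h (insert c (insert t R))"
        unfolding pb by (simp add: field_simps)
    qed
    then show ?thesis using 3 by (simp add: pair_q_def)
  next
    case 4
    then have "pair_step c t h T = h T" if "T \<in> Pow S" for T using that by (auto simp: pair_step_def)
    then show ?thesis using 4 by (simp add: pair_q_def)
  qed
qed

section \<open>Iterating the contraction down to the purity of A\<close>

lemma pair_mean_cong:
  assumes "\<And>c t. c < N \<Longrightarrow> t < N \<Longrightarrow> c \<noteq> t \<Longrightarrow> f (c, t) = g (c, t)"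
  shows "pair_mean N f = pair_mean N g"
  unfolding pair_mean_def
  by (rule arg_cong[where f="\<lambda>x. x / _"], rule sum.cong) (auto simp: offdiag_pairs_def assms)

lemma pair_mean_const: "N \<ge> 2 \<Longrightarrow> pair_mean N (\<lambda>_. a) = a"
  by (simp add: pair_mean_def card_offdiag_pairs)

lemma pair_mean_square_le:
  assumes "N \<ge> 2"
  shows "(pair_mean N g)\<^sup>2 \<le> pair_mean N (\<lambda>p. (g p)\<^sup>2)"
proof -
  have K: "real N * (real N - 1) > 0" using assms by simp
  have "(\<Sum>p\<in>offdiag_pairs N. g p)\<^sup>2 \<le> (\<Sum>p\<in>offdiag_pairs N. (g p)\<^sup>2) * real (card (offdiag_pairs N))"
    using Cauchy_Schwarz_ineq_sum[of g "\<lambda>_. 1" "offdiag_pairs N"] by simp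
  moreover have "s / L\<^sup>2 \<le> t / L" if "s \<le> t * L" "L > 0" for s t L :: real
    using that by (simp add: field_simps power2_eq_square)
  ultimately show ?thesis
    using K card_offdiag_pairs[of N] assms unfolding pair_mean_def power_divide by simp
qed

lemma pair_mean_sum:
  "pair_mean N (\<lambda>p. \<Sum>x\<in>X. g p x) = (\<Sum>x\<in>X. pair_mean N (\<lambda>p. g p x))"
  unfolding pair_mean_def by (subst sum.swap) (simp add: sum_divide_distrib)

lemma pair_mean_cmult: "pair_mean N (\<lambda>p. a * g p) = a * pair_mean N g"
  by (simp add: pair_mean_def sum_distrib_left)

text \<open>Jensen moves the square inside the average over pairs, \<open>energy_pair_mean\<close>
  gives the loss, and \<open>Poincare_wt\<close> bounds it below by a fixed fraction r of the
  energy. Passing from 1 - r to exp (- r) makes the bound iterate to an exponential in the number of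
  gates.\<close>

lemma energy_step:
  assumes "N \<ge> 2" and f0: "f {} = 0" and mean: "(\<Sum>T\<in>Pow {..<N}. wt T * f T) = 0"
    and f': "\<And>T. T \<subseteq> {..<N} \<Longrightarrow> f' T = pair_mean N (\<lambda>(c,t). pair_step c t f T)"
  shows "(\<Sum>T\<in>Pow {..<N}. wt T * (f' T)\<^sup>2)
    \<le> exp (- 32 / (27 * (real N * (real N - 1)))) * (\<Sum>T\<in>Pow {..<N}. wt T * (f T)\<^sup>2)"
proof -
  define r where "r = 32 / (27 * (real N * (real N - 1)))"
  define E where "E = (\<Sum>T\<in>Pow {..<N}. wt T * (f T)\<^sup>2)"
  define D where "D = (\<Sum>t<N. \<Sum>S\<in>Pow ({..<N} - {t}) - {{}}. wt S * (f (insert t S) - f S)\<^sup>2)"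
  have E: "E \<ge> 0" unfolding E_def by (intro sum_nonneg) auto
  have r: "r \<ge> 0" using assms by (simp add: r_def)
  have "(\<Sum>T\<in>Pow {..<N}. wt T * (f' T)\<^sup>2)
    \<le> (\<Sum>T\<in>Pow {..<N}. wt T * pair_mean N (\<lambda>p. (case p of (c,t) \<Rightarrow> pair_step c t f T)\<^sup>2))"
    using assms by (intro sum_mono mult_left_mono) (simp_all add: f' pair_mean_square_le)
  also have "\<dots> = pair_mean N (\<lambda>(c,t). \<Sum>T\<in>Pow {..<N}. wt T * (pair_step c t f T)\<^sup>2)"
    by (simp add: pair_mean_sum pair_mean_cmult case_prod_unfold)
  also have "\<dots> \<le> E - r * D"
    unfolding E_def r_def D_def by (rule energy_pair_mean) fact
  also have "\<dots> \<le> E - r * E"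
    using Poincare_wt[OF assms(1) f0 mean] r unfolding E_def D_def by (simp add: mult_left_mono)
  also have "\<dots> = (1 - r) * E" by (simp add: algebra_simps)
  also have "\<dots> \<le> exp (- r) * E"
    using exp_ge_add_one_self[of "- r"] E by (intro mult_right_mono) auto
  finally show ?thesis by (simp add: E_def r_def)
qed

lemma mean_purity_bound:
  fixes q :: "nat \<Rightarrow> nat set \<Rightarrow> real"
  assumes N: "N \<ge> 2" and A: "A \<subseteq> {..<N}" "card A \<le> N - card A" and e: "0 < e" "e < 1"
    and q0: "\<And>S. S \<subseteq> {..<N} \<Longrightarrow> \<bar>q 0 S\<bar> \<le> 2 ^ card S"
    and q_empty: "q 0 {} = 1" and q_full: "q 0 {..<N} = 2 ^ N"
    and q_step: "\<And>k S. S \<subseteq> {..<N} \<Longrightarrow> q (Suc k) S = pair_mean N (\<lambda>(c,t). pair_q c t (q k) S)"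
    and n: "real n \<ge> 9 * real N * (real N - 1) / 4 * ((3 * ln 2) * real N + ln (1 / e))"
  shows "q n A \<le> 1 + 2 powr (- (real (N - card A) - real (card A))) + e"
proof -
  let ?I = "{..<N}"
  \<comment> \<open>Only the initial weights are read off the purities; later ones follow
    \<open>pair_step\<close>, and \<open>qh\<close> shows that they stay the Moebius inverse of
    \<open>q k\<close>.\<close>
  define h where "h = rec_nat (\<lambda>T. (-1) ^ card T / wt T * (\<Sum>R\<in>Pow T. (-1) ^ card R * q 0 R))
     (\<lambda>_ h T. pair_mean N (\<lambda>(c,t). pair_step c t h T))"
  have h0: "h 0 T = (-1) ^ card T / wt T * (\<Sum>R\<in>Pow T. (-1) ^ card R * q 0 R)" for T
    by (simp add: h_def)
  have hS: "h (Suc k) T = pair_mean N (\<lambda>(c,t). pair_step c t (h k) T)" for k T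
    by (simp add: h_def)
  have fin: "finite S" if "S \<subseteq> ?I" for S using that finite_subset by blast
  have qh: "q k S = (\<Sum>T\<in>Pow S. wt T * h k T)" if S: "S \<subseteq> ?I" for k S
    using S
  proof (induction k arbitrary: S)
    case 0
    then show ?case using moebius_inversion[OF fin[OF 0], of "q 0"] by (simp add: h0)
  next
    case (Suc k)
    have "(\<Sum>T\<in>Pow S. wt T * h (Suc k) T)
       = pair_mean N (\<lambda>p. \<Sum>T\<in>Pow S. wt T * (case p of (c,t) \<Rightarrow> pair_step c t (h k) T))"
      by (simp add: hS pair_mean_sum pair_mean_cmult)
    also have "\<dots> = pair_mean N (\<lambda>(c,t). pair_q c t (q k) S)"
    proof (rule pair_mean_cong)
      fix c t assume ct: "c < N" "t < N" "c \<noteq> t"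
      have "pair_q c t (\<lambda>S. \<Sum>T\<in>Pow S. wt T * h k T) S = pair_q c t (q k) S"
      proof -
        have sub: "S - {c} \<subseteq> ?I" "S - {t} \<subseteq> ?I" "insert t (S - {c}) \<subseteq> ?I" "insert c (S - {t}) \<subseteq> ?I"
          "insert t S \<subseteq> ?I" "insert c S \<subseteq> ?I" using Suc.prems ct by auto
        show ?thesis unfolding pair_q_def by (simp add: Suc.IH[OF Suc.prems] sub[THEN Suc.IH])
      qed
      then show "(\<Sum>T\<in>Pow S. wt T * (case (c,t) of (c,t) \<Rightarrow> pair_step c t (h k) T))
        = (case (c,t) of (c,t) \<Rightarrow> pair_q c t (q k) S)"
        using sum_pair_step[OF fin[OF Suc.prems] ct(3), of "h k"] by simp
    qed
    finally show ?case using q_step[OF Suc.prems] by simp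
  qed
  have h_empty: "h k {} = 1" for k
  proof (induction k)
    case 0 then show ?case by (simp add: h0 q_empty)
  next
    case (Suc k)
    then show ?case using N by (simp add: hS pair_step_def pair_mean_const case_prod_unfold)
  qed
  have full: "q k ?I = 2 ^ N" for k
  proof (induction k)
    case (Suc k)
    have "q (Suc k) ?I = pair_mean N (\<lambda>_. q k ?I)"
      unfolding q_step[OF order.refl] by (rule pair_mean_cong) (auto simp: pair_q_def)
    then show ?case using N Suc by (simp add: pair_mean_const)
  qed (fact q_full)
  \<comment> \<open>The constant value on nonempty supports that is compatible with the conserved
    total, 1 + \<kappa> * (4^N - 1) = 2^N; it is the value of a Haar random state.\<close>
  define \<kappa> where "\<kappa> = 1 / ((2::real) ^ N + 1)"
  have \<kappa>: "0 \<le> \<kappa>" "\<kappa> \<le> 1" "\<kappa> \<le> 1 / 2 ^ N" 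
    by (auto simp: \<kappa>_def divide_le_eq le_divide_eq add_pos_pos intro!: frac_le)
  \<comment> \<open>The empty support is a class of its own with conserved value 1, so the deviation
    there is set to 0, as \<open>Poincare_wt\<close> asks.\<close>
  define f where "f = (\<lambda>k T. if T = {} then 0 else h k T - \<kappa>)"
  have hf: "h k T = (if T = {} then 1 - \<kappa> else 0) + \<kappa> + f k T" for k T
    by (simp add: f_def h_empty)
  have sum_h: "(\<Sum>T\<in>Pow S. wt T * h k T) = 1 + \<kappa> * (4 ^ card S - 1) + (\<Sum>T\<in>Pow S. wt T * f k T)"
    if "S \<subseteq> ?I" for S k
  proof -
    have "(\<Sum>T\<in>Pow S. wt T * h k T)
       = (\<Sum>T\<in>Pow S. (if T = {} then 1 - \<kappa> else 0) + \<kappa> * wt T + wt T * f k T)"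
      by (intro sum.cong refl) (auto simp: hf algebra_simps)
    also have "\<dots> = (\<Sum>T\<in>Pow S. if T = {} then 1 - \<kappa> else 0) + \<kappa> * (\<Sum>T\<in>Pow S. wt T) + (\<Sum>T\<in>Pow S. wt T * f k T)"
      by (simp add: sum.distrib sum_distrib_left)
    also have "(\<Sum>T\<in>Pow S. if T = {} then 1 - \<kappa> else 0) = 1 - \<kappa>"
      using fin[OF that] by (subst sum.delta) auto
    also have "(\<Sum>T\<in>Pow S. wt T) = 4 ^ card S" using fin[OF that] by (rule sum_wt)
    finally show ?thesis by (simp add: algebra_simps)
  qed
  have "(2::real) ^ N = 1 + \<kappa> * (4 ^ N - 1)"
  proof -
    have "(4::real) ^ N = 2 ^ N * 2 ^ N" by (simp flip: power_mult_distrib)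
    then have "(4::real) ^ N - 1 = (2 ^ N + 1) * (2 ^ N - 1)" by (simp add: algebra_simps)
    moreover have "(2::real) ^ N + 1 \<noteq> 0" using zero_less_power[of "2::real" N] by linarith
    ultimately show ?thesis unfolding \<kappa>_def by simp
  qed
  then have mean: "(\<Sum>T\<in>Pow ?I. wt T * f k T) = 0" for k
    using sum_h[of ?I k] qh[of ?I k] full[of k] by simp
  define r where "r = 32 / (27 * (real N * (real N - 1)))"
  define E where "E = (\<lambda>k. \<Sum>T\<in>Pow ?I. wt T * (f k T)\<^sup>2)"
  have "f (Suc k) T = pair_mean N (\<lambda>(c,t). pair_step c t (f k) T)" if "T \<subseteq> ?I" for k T
  proof (cases "T = {}")
    case True
    then show ?thesis by (simp add: f_def pair_step_def pair_mean_def case_prod_unfold)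
  next
    case False
    have "pair_mean N (\<lambda>(c,t). pair_step c t (f k) T)
      = pair_mean N (\<lambda>p. (case p of (c,t) \<Rightarrow> pair_step c t (h k) T) - \<kappa>)"
    proof (rule pair_mean_cong)
      fix c t :: nat assume "c \<noteq> t"
      then have "T - {c} \<noteq> {}" "T - {t} \<noteq> {}" if "c \<in> T" "t \<in> T" using that by auto
      then show "(case (c,t) of (c,t) \<Rightarrow> pair_step c t (f k) T)
         = (case (c,t) of (c,t) \<Rightarrow> pair_step c t (h k) T) - \<kappa>"
        using False by (simp add: pair_step_def f_def field_simps)
    qed
    also have "\<dots> = h (Suc k) T - \<kappa>"
      using pair_mean_const[OF N, of \<kappa>] by (simp add: pair_mean_def hS sum_subtractf diff_divide_distrib)
    finally show ?thesis using False by (simp add: f_def)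
  qed
  then have Estep: "E (Suc k) \<le> exp (- r) * E k" for k
    unfolding E_def r_def using energy_step[OF N _ mean, of k "f (Suc k)"] by (simp add: f_def)
  have Ek: "E k \<le> exp (- r * real k) * E 0" for k
  proof (induction k)
    case (Suc k)
    have "E (Suc k) \<le> exp (- r) * (exp (- r * real k) * E 0)"
      by (rule order.trans[OF Estep]) (use Suc in simp)
    also have "\<dots> = exp (- r * real (Suc k)) * E 0"
      by (simp add: algebra_simps flip: exp_add)
    finally show ?case .
  qed simp
  \<comment> \<open>Expected for a mean of squared Pauli expectations, but obtained from the purity
    bounds alone: the sum of 2^|R| over R \<subseteq> T is 3^|T|, which the division by
    \<open>wt T\<close> cancels.\<close>
  have h0_bound: "\<bar>h 0 T\<bar> \<le> 1" if T: "T \<subseteq> ?I" for T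
  proof -
    have s2: "(\<Sum>R\<in>Pow J. (2::real) ^ card R) = 3 ^ card J" if "finite J" for J :: "nat set"
      using that
    proof (induction rule: finite_induct)
      case (insert q J)
      have "(\<Sum>R\<in>Pow (insert q J). (2::real) ^ card R) = (\<Sum>R\<in>Pow J. 3 * 2 ^ card R)"
        using insert by (subst sum_Pow_insert) (auto intro!: sum.cong simp: card_insert_if finite_subset)
      then show ?case using insert by (simp flip: sum_distrib_left)
    qed simp
    have "\<bar>\<Sum>R\<in>Pow T. (-1) ^ card R * q 0 R\<bar> \<le> (\<Sum>R\<in>Pow T. \<bar>(-1) ^ card R * q 0 R\<bar>)" by (rule sum_abs)
    also have "\<dots> \<le> (\<Sum>R\<in>Pow T. 2 ^ card R)"
      using q0 T by (intro sum_mono) (auto simp: abs_mult power_abs)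
    also have "\<dots> = wt T" using s2 fin[OF T] by simp
    finally show ?thesis by (simp add: h0 abs_mult power_abs)
  qed
  have E0: "E 0 \<le> 4 * 4 ^ N"
  proof -
    have "E 0 \<le> (\<Sum>T\<in>Pow ?I. wt T * 4)" unfolding E_def
    proof (intro sum_mono mult_left_mono)
      fix T assume "T \<in> Pow ?I"
      then have "\<bar>f 0 T\<bar> \<le> 2" using h0_bound[of T] \<kappa> by (auto simp: f_def)
      then have "\<bar>f 0 T\<bar>\<^sup>2 \<le> 2\<^sup>2" by (intro power_mono) auto
      then show "(f 0 T)\<^sup>2 \<le> 4" by simp
    qed simp
    then show ?thesis by (simp add: sum_wt flip: sum_distrib_right)
  qed
  \<comment> \<open>Rate times gate number gives the factor 32/27 * 9/4 = 8/3, so the exponent is at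
    least 8 ln 2 * N + 8/3 * L; lowering 8/3 to 2 produces e^2.\<close>
  have rn: "exp (- r * real n) \<le> e\<^sup>2 * (1 / 256) ^ N"
  proof -
    define L where "L = ln (1 / e)"
    have L: "L \<ge> 0" unfolding L_def using e by (intro ln_ge_zero) simp
    have K: "real N * (real N - 1) > 0" using N by simp
    have "8/3 * (3 * ln 2 * real N + L) = r * (9 * real N * (real N - 1) / 4 * ((3 * ln 2) * real N + L))"
    proof -
      have "8/3 * Y = 32 / (27 * M) * (9 * M / 4 * Y)" if "M > 0" for M Y :: real
        using that by (simp add: field_simps)
      from this[OF K, of "3 * ln 2 * real N + L"] show ?thesis unfolding r_def by (simp only: mult.assoc)
    qed
    also have "\<dots> \<le> r * real n" using n K by (intro mult_left_mono) (auto simp: L_def r_def)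
    finally have "- r * real n \<le> - (8 * ln 2 * real N + 2 * L)" using L by simp
    then have "exp (- r * real n) \<le> exp (- (8 * ln 2 * real N + 2 * L))" by simp
    also have "\<dots> = exp (- 2 * L) * exp (real N * (- 8 * ln 2))"
      by (simp add: algebra_simps flip: exp_add)
    also have "exp (- 2 * L) = e\<^sup>2"
      using e by (simp add: L_def ln_div exp_double power2_eq_square flip: exp_add)
    also have "exp (real N * (- 8 * ln 2)) = (exp (- 8 * ln (2::real))) ^ N"
      by (rule exp_of_nat_mult)
    also have "exp (- 8 * ln (2::real)) = 1 / 256"
      using exp_of_nat_mult[of 8 "ln (2::real)"] by (simp add: exp_minus field_simps)
    finally show ?thesis .
  qed
  \<comment> \<open>A holds at most half of the qubits, so Cauchy-Schwarz costs 4^|A| \<le> 2^N. The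
    remaining base is 2 * 4 / 256 = 1/32, and 4 / 32^N \<le> 1.\<close>
  have EA: "4 ^ card A * (\<Sum>T\<in>Pow A. wt T * (f n T)\<^sup>2) \<le> e\<^sup>2"
  proof -
    have "2 * card A \<le> N" using A N by auto
    then have "(2::real) ^ (2 * card A) \<le> 2 ^ N" by (intro power_increasing) auto
    then have 4: "(4::real) ^ card A \<le> 2 ^ N" by (simp add: power_mult)
    have "(\<Sum>T\<in>Pow A. wt T * (f n T)\<^sup>2) \<le> E n"
      unfolding E_def using A by (intro sum_mono2) auto
    also have "\<dots> \<le> (e\<^sup>2 * (1 / 256) ^ N) * (4 * 4 ^ N)"
      by (rule order.trans[OF Ek]) (intro mult_mono rn E0, auto simp: E_def intro!: sum_nonneg)
    finally have "4 ^ card A * (\<Sum>T\<in>Pow A. wt T * (f n T)\<^sup>2) \<le> 2 ^ N * ((e\<^sup>2 * (1 / 256) ^ N) * (4 * 4 ^ N))"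
      using 4 by (intro mult_mono sum_nonneg) auto
    also have "\<dots> = e\<^sup>2 * (4 * (2 * (1 / 256) * 4) ^ N)" by (simp only: power_mult_distrib mult_ac)
    also have "\<dots> \<le> e\<^sup>2 * 1"
    proof (rule mult_left_mono)
      have "(1/32::real) ^ N \<le> (1/32) ^ 2" using N by (intro power_decreasing) auto
      then show "4 * (2 * (1 / 256) * 4) ^ N \<le> (1::real)" by (simp add: power2_eq_square)
    qed simp
    finally show ?thesis by simp
  qed
  have "(\<Sum>T\<in>Pow A. wt T * f n T)\<^sup>2 \<le> e\<^sup>2"
    using wt_Cauchy_Schwarz[OF fin[OF A(1)] order.refl, of "f n"] EA by linarith
  then have fA: "(\<Sum>T\<in>Pow A. wt T * f n T) \<le> e" using e by (rule_tac power2_le_imp_le) auto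
  \<comment> \<open>The stationary excess over 1 is at most 4^|A| / 2^N, which is 2^(-t).\<close>
  have "\<kappa> * (4 ^ card A - 1) \<le> 1 / 2 ^ N * 4 ^ card A"
    using \<kappa> by (intro mult_mono) auto
  also have "\<dots> = 2 powr (- (real (N - card A) - real (card A)))"
  proof -
    have "card A \<le> N" using card_mono[OF _ A(1)] by simp
    then have "- (real (N - card A) - real (card A)) = real (2 * card A) - real N" by (simp add: of_nat_diff)
    then show ?thesis by (simp only: powr_diff powr_realpow) (simp add: power_mult)
  qed
  finally show ?thesis using sum_h[OF A(1), of n] qh[OF A(1), of n] fA by linarith
qed

section \<open>Second moments of the Haar measure on U(2)\<close>

abbreviation entry :: "mat2 \<Rightarrow> 2 \<Rightarrow> 2 \<Rightarrow> complex" where "entry U i j \<equiv> U $ i $ j"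

lemma two_eq_zero_2: "(2::2) = 0"
  using exhaust_2[of 0] zero_neq_one[where ?'a = 2] by metis

lemma sum_UNIV_bool: "(\<Sum>b\<in>UNIV. f b) = f False + f True"
  by (simp add: UNIV_bool)

lemma sum_UNIV_2: "(\<Sum>i\<in>UNIV. f i) = f (0::2) + f 1"
  using sum_2[of f] by (simp add: add.commute two_eq_zero_2)

lemma cases_2: "(i::2) = 0 \<or> i = 1"
  using exhaust_2[of i] by (auto simp: two_eq_zero_2)

lemma sum_product4:
  fixes f :: "'a \<Rightarrow> 'e::comm_semiring_0"
  shows "(\<Sum>i\<in>A. f i) * (\<Sum>j\<in>B. g j) * (\<Sum>k\<in>C. h k) * (\<Sum>l\<in>D. m l)
    = (\<Sum>i\<in>A. \<Sum>j\<in>B. \<Sum>k\<in>C. \<Sum>l\<in>D. f i * g j * h k * m l)"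
proof -
  have "(\<Sum>i\<in>A. f i) * (\<Sum>j\<in>B. g j) * (\<Sum>k\<in>C. h k) * (\<Sum>l\<in>D. m l)
    = (\<Sum>i\<in>A. f i * (\<Sum>j\<in>B. g j * (\<Sum>k\<in>C. h k * (\<Sum>l\<in>D. m l))))"
    by (simp only: sum_distrib_right mult.assoc)
  then show ?thesis by (simp only: sum_distrib_left mult.assoc)
qed

lemma unitary2_iff: "U \<in> unitary2 \<longleftrightarrow> (\<forall>i j. (\<Sum>m\<in>UNIV. entry U i m * cnj (entry U j m)) = (if i = j then 1 else 0))"
  by (simp add: unitary2_def adj2_def matrix_matrix_mult_def vec_eq_iff fun_eq_iff Finite_Cartesian_Product.mat_def)

lemma unitary2_columns:
  assumes "U \<in> unitary2"
  shows "(\<Sum>m\<in>UNIV. entry U m a * cnj (entry U m b)) = (if a = b then 1 else 0)"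
proof -
  have "adj2 U ** U = Finite_Cartesian_Product.mat 1"
    using assms matrix_left_right_inverse unfolding unitary2_def by blast
  then have "(\<Sum>m\<in>UNIV. cnj (entry U m b) * entry U m a) = (if b = a then 1 else 0)"
    by (simp add: adj2_def matrix_matrix_mult_def vec_eq_iff fun_eq_iff Finite_Cartesian_Product.mat_def)
  then show ?thesis by (cases "a = b") (simp_all add: mult.commute)
qed

lemma unitary2_entry_le: 
  assumes "U \<in> unitary2"
  shows "cmod (entry U i j) \<le> 1"
proof -
  have "(\<Sum>m\<in>UNIV. entry U i m * cnj (entry U i m)) = 1" using assms by (simp add: unitary2_iff)
  then have "complex_of_real (\<Sum>m\<in>UNIV. (cmod (entry U i m))\<^sup>2) = complex_of_real 1"
    by (simp add: complex_norm_square[symmetric])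
  then have "(\<Sum>m\<in>UNIV. (cmod (entry U i m))\<^sup>2) = 1" by (simp only: of_real_eq_iff)
  moreover have "(cmod (entry U i j))\<^sup>2 \<le> (\<Sum>m\<in>UNIV. (cmod (entry U i m))\<^sup>2)"
    by (rule member_le_sum) auto
  ultimately show ?thesis by (simp add: power2_le_imp_le)
qed

lemma all_2: "(\<forall>i::2. P i) \<longleftrightarrow> P 0 \<and> P 1"
  using cases_2 by metis

definition mat2_of :: "complex \<Rightarrow> complex \<Rightarrow> complex \<Rightarrow> complex \<Rightarrow> mat2" where
  "mat2_of p q r s = (\<chi> i j. if i = 0 then (if j = 0 then p else q) else (if j = 0 then r else s))"

lemma mat2_of_unitary:
  "mat2_of 1 0 0 \<i> \<in> unitary2" "mat2_of 0 1 1 0 \<in> unitary2"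
  "mat2_of (1 / sqrt 2) (1 / sqrt 2) (1 / sqrt 2) (- 1 / sqrt 2) \<in> unitary2"
  unfolding unitary2_iff mat2_of_def all_2 by (simp_all add: sum_UNIV_2 flip: of_real_mult)

lemma haar_measurable_entry [measurable]:
  "(\<lambda>U. entry U i j) \<in> borel_measurable (borel :: mat2 measure)"
  by (intro borel_measurable_continuous_onI continuous_intros)

lemma borel_measurable_cnj [measurable (raw)]:
  "f \<in> borel_measurable M \<Longrightarrow> (\<lambda>x. cnj (f x)) \<in> borel_measurable M"
  by (rule measurable_compose[where N=borel]) (auto intro!: borel_measurable_continuous_onI continuous_intros)

lemma idx2_eq_iff: "idx2 a = idx2 b \<longleftrightarrow> a = b"
  by (auto simp: idx2_def)

text \<open>The Haar average of U \<otimes> U \<otimes> conj U \<otimes> conj U applied to G. It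
  sees only the contractions of G with the identity and with the swap; 2/6 and -1/6 are the values
  of the Weingarten function of U(2).\<close>

definition twirl :: "(bool \<Rightarrow> bool \<Rightarrow> bool \<Rightarrow> bool \<Rightarrow> complex) \<Rightarrow> bool \<Rightarrow> bool \<Rightarrow> bool \<Rightarrow> bool \<Rightarrow> complex" where
  "twirl G i j k l =
    (if i = k \<and> j = l then (2 * (\<Sum>a\<in>UNIV. \<Sum>b\<in>UNIV. G a b a b) - (\<Sum>a\<in>UNIV. \<Sum>b\<in>UNIV. G a b b a)) / 6 else 0) +
    (if i = l \<and> j = k then (2 * (\<Sum>a\<in>UNIV. \<Sum>b\<in>UNIV. G a b b a) - (\<Sum>a\<in>UNIV. \<Sum>b\<in>UNIV. G a b a b)) / 6 else 0)"

context
  fixes \<mu> :: "mat2 measure"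
  assumes haar: "haar_U2 \<mu>"
begin

lemma haar_prob_space: "prob_space \<mu>" and haar_sets [measurable_cong]: "sets \<mu> = sets borel"
  and haar_AE: "AE U in \<mu>. U \<in> unitary2"
  using haar by (auto simp: haar_U2_def)

lemma haar_integrable:
  "integrable \<mu> (\<lambda>U. entry U i a * entry U j b * cnj (entry U k c) * cnj (entry U l d))"
proof -
  interpret prob_space \<mu> by (rule haar_prob_space)
  have "AE U in \<mu>. norm (entry U i a * entry U j b * cnj (entry U k c) * cnj (entry U l d)) \<le> 1"
    using haar_AE
  proof eventually_elim
    case (elim U)
    then show ?case using unitary2_entry_le[OF elim]
      by (auto simp: norm_mult intro!: mult_le_one)
  qed
  then show ?thesis by (rule integrable_const_bound) measurable
qed

text \<open>Invariance under \<open>diag(1, i)\<close>, the bit flip and the Hadamard matrix already determines the second moments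
  up to two constants; these follow from the orthonormality of the columns.\<close>

lemma haar_second_moment:
  "(\<integral>U. entry U i a * entry U j b * cnj (entry U k c) * cnj (entry U l d) \<partial>\<mu>) =
    (if i = k \<and> j = l then (2 * of_bool (a = c \<and> b = d) - of_bool (a = d \<and> b = c)) / 6 else 0) +
    (if i = l \<and> j = k then (2 * of_bool (a = d \<and> b = c) - of_bool (a = c \<and> b = d)) / 6 else 0)"
proof -
  interpret prob_space \<mu> by (rule haar_prob_space)
  define M where "M = (\<lambda>(U::mat2) i j k l. entry U i a * entry U j b * cnj (entry U k c) * cnj (entry U l d))"
  define T where "T = (\<lambda>i j k l. \<integral>U. M U i j k l \<partial>\<mu>)"
  have int: "integrable \<mu> (\<lambda>U. M U i j k l)" for i j k l
    unfolding M_def by (rule haar_integrable)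
  have inv: "T i j k l = (\<Sum>i'\<in>UNIV. \<Sum>j'\<in>UNIV. \<Sum>k'\<in>UNIV. \<Sum>l'\<in>UNIV.
      entry W i i' * entry W j j' * cnj (entry W k k') * cnj (entry W l l') * T i' j' k' l')"
    if W: "W \<in> unitary2" for W :: mat2 and i j k l
  proof -
    have "T i j k l = (\<integral>U. M U i j k l \<partial>distr \<mu> borel (\<lambda>U. W ** U))"
      using haar W by (simp add: T_def haar_U2_def)
    also have "\<dots> = (\<integral>U. M (W ** U) i j k l \<partial>\<mu>)"
    proof (rule integral_distr)
      have "(\<lambda>U. W ** U) \<in> borel_measurable borel"
        unfolding matrix_matrix_mult_def
        by (intro borel_measurable_continuous_onI continuous_intros)
      then show "(\<lambda>U. W ** U) \<in> \<mu> \<rightarrow>\<^sub>M borel" by measurable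
      show "(\<lambda>U. M U i j k l) \<in> borel_measurable borel" unfolding M_def by measurable
    qed
    also have "\<dots> = (\<integral>U. (\<Sum>i'\<in>UNIV. \<Sum>j'\<in>UNIV. \<Sum>k'\<in>UNIV. \<Sum>l'\<in>UNIV.
      entry W i i' * entry W j j' * cnj (entry W k k') * cnj (entry W l l') * M U i' j' k' l') \<partial>\<mu>)"
      unfolding M_def matrix_matrix_mult_def
      by (intro Bochner_Integration.integral_cong refl)
        (simp only: vec_lambda_beta cnj_sum complex_cnj_mult sum_product4, intro sum.cong refl, simp only: mult_ac)
    also have "\<dots> = (\<Sum>i'\<in>UNIV. \<Sum>j'\<in>UNIV. \<Sum>k'\<in>UNIV. \<Sum>l'\<in>UNIV.
      entry W i i' * entry W j j' * cnj (entry W k k') * cnj (entry W l l') * T i' j' k' l')"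
      unfolding T_def by (simp add: int)
    finally show ?thesis .
  qed
  \<comment> \<open>\<open>mat2_of 1 0 0 \<i>\<close> multiplies \<open>T i j k l\<close> by
    \<i>^(i+j-k-l), so every component whose phase differs from 1 vanishes. Six of the sixteen
    survive.\<close>
  have self: "x = 0" if "x = e * x" "e \<noteq> 1" for x e :: complex
    using that by auto
  have "T 0 0 0 1 = (- \<i>) * T 0 0 0 1"
    by (rule trans[OF inv[OF mat2_of_unitary(1)]]) (simp add: mat2_of_def sum_UNIV_2)
  then have z0: "T 0 0 0 1 = 0" by (rule self) (simp add: complex_eq_iff)
  have "T 0 0 1 0 = (- \<i>) * T 0 0 1 0"
    by (rule trans[OF inv[OF mat2_of_unitary(1)]]) (simp add: mat2_of_def sum_UNIV_2)
  then have z1: "T 0 0 1 0 = 0" by (rule self) (simp add: complex_eq_iff)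
  have "T 0 1 0 0 = (\<i>) * T 0 1 0 0"
    by (rule trans[OF inv[OF mat2_of_unitary(1)]]) (simp add: mat2_of_def sum_UNIV_2)
  then have z2: "T 0 1 0 0 = 0" by (rule self) (simp add: complex_eq_iff)
  have "T 1 0 0 0 = (\<i>) * T 1 0 0 0"
    by (rule trans[OF inv[OF mat2_of_unitary(1)]]) (simp add: mat2_of_def sum_UNIV_2)
  then have z3: "T 1 0 0 0 = 0" by (rule self) (simp add: complex_eq_iff)
  have "T 0 0 1 1 = (- 1) * T 0 0 1 1"
    by (rule trans[OF inv[OF mat2_of_unitary(1)]]) (simp add: mat2_of_def sum_UNIV_2)
  then have z4: "T 0 0 1 1 = 0" by (rule self) (simp add: complex_eq_iff)
  have "T 1 1 0 0 = (- 1) * T 1 1 0 0"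
    by (rule trans[OF inv[OF mat2_of_unitary(1)]]) (simp add: mat2_of_def sum_UNIV_2)
  then have z5: "T 1 1 0 0 = 0" by (rule self) (simp add: complex_eq_iff)
  have "T 1 1 1 0 = (\<i>) * T 1 1 1 0"
    by (rule trans[OF inv[OF mat2_of_unitary(1)]]) (simp add: mat2_of_def sum_UNIV_2)
  then have z6: "T 1 1 1 0 = 0" by (rule self) (simp add: complex_eq_iff)
  have "T 1 1 0 1 = (\<i>) * T 1 1 0 1"
    by (rule trans[OF inv[OF mat2_of_unitary(1)]]) (simp add: mat2_of_def sum_UNIV_2)
  then have z7: "T 1 1 0 1 = 0" by (rule self) (simp add: complex_eq_iff)
  have "T 1 0 1 1 = (- \<i>) * T 1 0 1 1"
    by (rule trans[OF inv[OF mat2_of_unitary(1)]]) (simp add: mat2_of_def sum_UNIV_2)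
  then have z8: "T 1 0 1 1 = 0" by (rule self) (simp add: complex_eq_iff)
  have "T 0 1 1 1 = (- \<i>) * T 0 1 1 1"
    by (rule trans[OF inv[OF mat2_of_unitary(1)]]) (simp add: mat2_of_def sum_UNIV_2)
  then have z9: "T 0 1 1 1 = 0" by (rule self) (simp add: complex_eq_iff)
  note z = z0 z1 z2 z3 z4 z5 z6 z7 z8 z9
  \<comment> \<open>The bit flip pairs the six survivors into three unknowns, and the Hadamard
    matrix adds the linear relation \<open>h\<close> between them.\<close>
  have f0: "T 1 1 1 1 = T 0 0 0 0"
    by (rule trans[OF inv[OF mat2_of_unitary(2)]]) (simp add: mat2_of_def sum_UNIV_2)
  have f1: "T 1 0 1 0 = T 0 1 0 1"
    by (rule trans[OF inv[OF mat2_of_unitary(2)]]) (simp add: mat2_of_def sum_UNIV_2)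
  have f2: "T 1 0 0 1 = T 0 1 1 0"
    by (rule trans[OF inv[OF mat2_of_unitary(2)]]) (simp add: mat2_of_def sum_UNIV_2)
  note f = f0 f1 f2
  have r: "(1 / complex_of_real (sqrt 2)) * (1 / complex_of_real (sqrt 2)) * (1 / complex_of_real (sqrt 2)) * (1 / complex_of_real (sqrt 2)) = 1/4"
    by (simp flip: of_real_mult)
  have "T 0 0 0 0 = (1 / complex_of_real (sqrt 2)) * (1 / complex_of_real (sqrt 2)) * (1 / complex_of_real (sqrt 2)) * (1 / complex_of_real (sqrt 2))
      * (2 * T 0 0 0 0 + 2 * T 0 1 0 1 + 2 * T 0 1 1 0)"
    by (subst inv[OF mat2_of_unitary(3)]) (simp add: mat2_of_def sum_UNIV_2 z f algebra_simps add_divide_distrib)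
  then have "T 0 0 0 0 = 1/4 * (2 * T 0 0 0 0 + 2 * T 0 1 0 1 + 2 * T 0 1 1 0)" by (simp only: r)
  then have h: "T 0 0 0 0 = T 0 1 0 1 + T 0 1 1 0" by (simp add: complex_eq_iff)
  \<comment> \<open>Contracting the row indices in the two possible ways turns column orthonormality
    into two equations for the two remaining constants.\<close>
  have "(\<Sum>i\<in>UNIV. \<Sum>j\<in>UNIV. T i j i j) = (\<integral>U. (\<Sum>i\<in>UNIV. \<Sum>j\<in>UNIV. M U i j i j) \<partial>\<mu>)"
    unfolding T_def by (simp add: int)
  also have "\<dots> = (\<integral>U. of_bool (a = c \<and> b = d) \<partial>\<mu>)"
  proof (rule integral_cong_AE)
    show "AE U in \<mu>. (\<Sum>i\<in>UNIV. \<Sum>j\<in>UNIV. M U i j i j) = of_bool (a = c \<and> b = d)"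
      using haar_AE
    proof eventually_elim
      case (elim U)
      have "(\<Sum>i\<in>UNIV. \<Sum>j\<in>UNIV. M U i j i j)
        = (\<Sum>m\<in>UNIV. entry U m a * cnj (entry U m c)) * (\<Sum>m\<in>UNIV. entry U m b * cnj (entry U m d))"
        by (simp add: M_def sum_UNIV_2 algebra_simps)
      then show ?case by (simp add: unitary2_columns[OF elim])
    qed
  qed (simp_all add: M_def)
  finally have s1: "(\<Sum>i\<in>UNIV. \<Sum>j\<in>UNIV. T i j i j) = of_bool (a = c \<and> b = d)" by (simp add: prob_space)
  have "(\<Sum>i\<in>UNIV. \<Sum>j\<in>UNIV. T i j j i) = (\<integral>U. (\<Sum>i\<in>UNIV. \<Sum>j\<in>UNIV. M U i j j i) \<partial>\<mu>)"
    unfolding T_def by (simp add: int)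
  also have "\<dots> = (\<integral>U. of_bool (a = d \<and> b = c) \<partial>\<mu>)"
  proof (rule integral_cong_AE)
    show "AE U in \<mu>. (\<Sum>i\<in>UNIV. \<Sum>j\<in>UNIV. M U i j j i) = of_bool (a = d \<and> b = c)"
      using haar_AE
    proof eventually_elim
      case (elim U)
      have "(\<Sum>i\<in>UNIV. \<Sum>j\<in>UNIV. M U i j j i)
        = (\<Sum>m\<in>UNIV. entry U m a * cnj (entry U m d)) * (\<Sum>m\<in>UNIV. entry U m b * cnj (entry U m c))"
        by (simp add: M_def sum_UNIV_2 algebra_simps)
      then show ?case by (simp add: unitary2_columns[OF elim])
    qed
  qed (simp_all add: M_def)
  finally have s2: "(\<Sum>i\<in>UNIV. \<Sum>j\<in>UNIV. T i j j i) = of_bool (a = d \<and> b = c)" by (simp add: prob_space)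
  define D1 D2 :: complex where "D1 = of_bool (a = c \<and> b = d)" and "D2 = of_bool (a = d \<and> b = c)"
  have "4 * T 0 1 0 1 + 2 * T 0 1 1 0 = D1" "2 * T 0 1 0 1 + 4 * T 0 1 1 0 = D2"
    using s1 s2 by (simp_all add: sum_UNIV_2 f h D1_def D2_def algebra_simps)
  then have uv: "T 0 1 0 1 = (2 * D1 - D2) / 6" "T 0 1 1 0 = (2 * D2 - D1) / 6"
    by (auto simp: complex_eq_iff)
  have "T i j k l = (if i = k \<and> j = l then (2 * D1 - D2) / 6 else 0) + (if i = l \<and> j = k then (2 * D2 - D1) / 6 else 0)"
    using cases_2[of i] cases_2[of j] cases_2[of k] cases_2[of l]
    by (elim disjE) (simp_all add: z f h uv)
  then show ?thesis unfolding T_def M_def D1_def D2_def .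
qed

lemma haar_twirl:
  "(\<integral>U. (\<Sum>a\<in>UNIV. \<Sum>b\<in>UNIV. \<Sum>c\<in>UNIV. \<Sum>d\<in>UNIV.
      entry U (idx2 i) (idx2 a) * entry U (idx2 j) (idx2 b) * cnj (entry U (idx2 k) (idx2 c)) * cnj (entry U (idx2 l) (idx2 d))
        * G a b c d) \<partial>\<mu>) = twirl G i j k l"
proof -
  define F where "F = (\<lambda>a b c d U. entry U (idx2 i) (idx2 a) * entry U (idx2 j) (idx2 b) * cnj (entry U (idx2 k) (idx2 c)) * cnj (entry U (idx2 l) (idx2 d)))"
  have int: "integrable \<mu> (F a b c d)" for a b c d
    unfolding F_def by (rule haar_integrable)
  define \<alpha> \<beta> :: complex where "\<alpha> = 2/6 * of_bool (i = k \<and> j = l) - 1/6 * of_bool (i = l \<and> j = k)"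
    and "\<beta> = 2/6 * of_bool (i = l \<and> j = k) - 1/6 * of_bool (i = k \<and> j = l)"
  have comb: "(if P then (2 * x - y) / 6 else 0) + (if Q then (2 * y - x) / 6 else 0)
      = (2/6 * of_bool P - 1/6 * of_bool Q) * x + (2/6 * of_bool Q - 1/6 * of_bool P) * y" for P Q and x y :: complex
    by (cases P; cases Q) (simp_all add: field_simps)
  have F: "integral\<^sup>L \<mu> (F a b c d) = \<alpha> * of_bool (a = c \<and> b = d) + \<beta> * of_bool (a = d \<and> b = c)" for a b c d
    unfolding F_def \<alpha>_def \<beta>_def haar_second_moment idx2_eq_iff by (rule comb)
  have "(\<integral>U. (\<Sum>a\<in>UNIV. \<Sum>b\<in>UNIV. \<Sum>c\<in>UNIV. \<Sum>d\<in>UNIV. F a b c d U * G a b c d) \<partial>\<mu>)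
    = (\<Sum>a\<in>UNIV. \<Sum>b\<in>UNIV. \<Sum>c\<in>UNIV. \<Sum>d\<in>UNIV. integral\<^sup>L \<mu> (F a b c d) * G a b c d)"
    by (simp add: int)
  also have "\<dots> = \<alpha> * (\<Sum>a\<in>UNIV. \<Sum>b\<in>UNIV. G a b a b) + \<beta> * (\<Sum>a\<in>UNIV. \<Sum>b\<in>UNIV. G a b b a)"
    unfolding F sum_UNIV_bool by (simp add: algebra_simps)
  also have "\<dots> = twirl G i j k l"
    unfolding twirl_def \<alpha>_def \<beta>_def by (rule comb[symmetric])
  finally show ?thesis by (simp add: F_def)
qed

end

section \<open>Gate average of the purity\<close>

definition ins :: "nat \<Rightarrow> bool \<Rightarrow> nat set \<Rightarrow> nat set" where
  "ins q b X = (if b then insert q X else X - {q})"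

definition cflip :: "nat \<Rightarrow> nat \<Rightarrow> nat set \<Rightarrow> nat set" where
  "cflip c t X = (if c \<in> X then ins t (t \<notin> X) X else X)"

text \<open>Applied in both orders, this exchanges the qubits of S between two copies: the swap
  whose expectation in two copies of the state is the purity.\<close>

definition mix :: "nat set \<Rightarrow> nat set \<Rightarrow> nat set \<Rightarrow> nat set" where
  "mix S X Y = (X - S) \<union> (Y \<inter> S)"

type_synonym tensor = "nat set \<Rightarrow> nat set \<Rightarrow> nat set \<Rightarrow> nat set \<Rightarrow> complex"

definition twirl_at :: "nat \<Rightarrow> tensor \<Rightarrow> tensor" where
  "twirl_at q K X Y Z W = twirl (\<lambda>a b c d. K (ins q a X) (ins q b Y) (ins q c Z) (ins q d W))
     (q \<in> X) (q \<in> Y) (q \<in> Z) (q \<in> W)"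

text \<open>CNOT permutes the basis, so it merely relabels the arguments; it stands outermost
  because it acts last.\<close>

definition gate_avg :: "nat \<Rightarrow> nat \<Rightarrow> tensor \<Rightarrow> tensor" where
  "gate_avg c t K X Y Z W = twirl_at c (twirl_at t K) (cflip c t X) (cflip c t Y) (cflip c t Z) (cflip c t W)"

text \<open>For \<open>K = \<psi> \<otimes> \<psi> \<otimes> cnj \<psi> \<otimes> cnj \<psi>\<close> with amplitudes indexed by the set of qubits in state 1, this is
  \<open>Tr \<rho>\<^sub>S\<^sup>2\<close>.\<close>

definition purity :: "nat \<Rightarrow> nat set \<Rightarrow> tensor \<Rightarrow> complex" where
  "purity N S K = (\<Sum>X\<in>Pow {..<N}. \<Sum>Y\<in>Pow {..<N}. K X Y (mix S X Y) (mix S Y X))"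

text \<open>Eight Boolean arguments: the bits at \<open>c\<close> and \<open>t\<close> in each of the four tensor factors.\<close>

type_synonym block = "bool \<Rightarrow> bool \<Rightarrow> bool \<Rightarrow> bool \<Rightarrow> bool \<Rightarrow> bool \<Rightarrow> bool \<Rightarrow> bool \<Rightarrow> complex"

definition block_purity :: "bool \<Rightarrow> bool \<Rightarrow> block \<Rightarrow> complex" where
  "block_purity s u G = (\<Sum>x\<in>UNIV. \<Sum>y\<in>UNIV. \<Sum>x'\<in>UNIV. \<Sum>y'\<in>UNIV.
     G x y x' y' (if s then x' else x) (if u then y' else y) (if s then x else x') (if u then y else y'))"

definition twirl2 :: "block \<Rightarrow> block" where
  "twirl2 G x y x' y' x1 y1 x2 y2 =
    twirl (\<lambda>a b c d. twirl (\<lambda>a' b' c' d'. G a a' b b' c c' d d') y y' y1 y2) x x' x1 x2"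

text \<open>Two independent twirls leave the identity or the swap pairing on each qubit, so a block
  enters only through its four block purities, with the tensor square of the coefficients 2/6 and
  -1/6.\<close>

lemma tw2_expand:
  "twirl2 G x y x' y' x1 y1 x2 y2 =
     of_bool (x = x1 \<and> x' = x2) * (of_bool (y = y1 \<and> y' = y2) * (4 * block_purity False False G - 2 * block_purity False True G - 2 * block_purity True False G + block_purity True True G) / 36
       + of_bool (y = y2 \<and> y' = y1) * (4 * block_purity False True G - 2 * block_purity False False G - 2 * block_purity True True G + block_purity True False G) / 36)
   + of_bool (x = x2 \<and> x' = x1) * (of_bool (y = y1 \<and> y' = y2) * (4 * block_purity True False G - 2 * block_purity True True G - 2 * block_purity False False G + block_purity False True G) / 36
       + of_bool (y = y2 \<and> y' = y1) * (4 * block_purity True True G - 2 * block_purity True False G - 2 * block_purity False True G + block_purity False False G) / 36)"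
proof -
  define A1 where "A1 = (\<lambda>a b c d. \<Sum>a'\<in>UNIV. \<Sum>b'\<in>UNIV. G a a' b b' c a' d b')"
  define A2 where "A2 = (\<lambda>a b c d. \<Sum>a'\<in>UNIV. \<Sum>b'\<in>UNIV. G a a' b b' c b' d a')"
  have if6: "(if P then x / 6 else 0) = of_bool P * x / 6" for P and x :: complex by simp
  have tw': "twirl H i j k l = of_bool (i = k \<and> j = l) * (2 * (\<Sum>a\<in>UNIV. \<Sum>b\<in>UNIV. H a b a b) - (\<Sum>a\<in>UNIV. \<Sum>b\<in>UNIV. H a b b a)) / 6
    + of_bool (i = l \<and> j = k) * (2 * (\<Sum>a\<in>UNIV. \<Sum>b\<in>UNIV. H a b b a) - (\<Sum>a\<in>UNIV. \<Sum>b\<in>UNIV. H a b a b)) / 6" for H i j k l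
    unfolding twirl_def if6 ..
  define p1 p2 q1 q2 :: complex where "p1 = of_bool (x = x1 \<and> x' = x2)" and "p2 = of_bool (x = x2 \<and> x' = x1)"
    and "q1 = of_bool (y = y1 \<and> y' = y2)" and "q2 = of_bool (y = y2 \<and> y' = y1)"
  have l: "block_purity False False G = (\<Sum>a\<in>UNIV. \<Sum>b\<in>UNIV. A1 a b a b)" "block_purity False True G = (\<Sum>a\<in>UNIV. \<Sum>b\<in>UNIV. A2 a b a b)"
    "block_purity True False G = (\<Sum>a\<in>UNIV. \<Sum>b\<in>UNIV. A1 a b b a)" "block_purity True True G = (\<Sum>a\<in>UNIV. \<Sum>b\<in>UNIV. A2 a b b a)"
    by (simp_all add: block_purity_def A1_def A2_def sum_UNIV_bool algebra_simps)
  have "twirl2 G x y x' y' x1 y1 x2 y2 = twirl (\<lambda>a b c d. q1 * (2 * A1 a b c d - A2 a b c d) / 6 + q2 * (2 * A2 a b c d - A1 a b c d) / 6) x x' x1 x2"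
    unfolding twirl2_def tw'[of _ y] A1_def A2_def q1_def q2_def ..
  also have "\<dots> = p1 * (q1 * (4 * block_purity False False G - 2 * block_purity False True G - 2 * block_purity True False G + block_purity True True G) / 36
       + q2 * (4 * block_purity False True G - 2 * block_purity False False G - 2 * block_purity True True G + block_purity True False G) / 36)
   + p2 * (q1 * (4 * block_purity True False G - 2 * block_purity True True G - 2 * block_purity False False G + block_purity False True G) / 36
       + q2 * (4 * block_purity True True G - 2 * block_purity True False G - 2 * block_purity False True G + block_purity False False G) / 36)"
    unfolding tw' p1_def[symmetric] p2_def[symmetric] l
    by (simp add: sum.distrib sum_subtractf flip: sum_distrib_left sum_divide_distrib) (simp add: field_simps)
  finally show ?thesis unfolding p1_def p2_def q1_def q2_def .
qed

text \<open>The update of \<open>pair_q\<close> before rescaling by 2^|S|, which turns 4/9 into 8/9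
  for a removed and into 2/9 for an added qubit.\<close>

definition loc_avg :: "bool \<Rightarrow> bool \<Rightarrow> (bool \<Rightarrow> bool \<Rightarrow> complex) \<Rightarrow> complex" where
  "loc_avg s u L = (if s = u then L s u else 4/9 * L False False + 1/9 * L s u - 2/9 * L u s + 4/9 * L True True)"

lemma loc_cnot_tw2:
  "block_purity s u (\<lambda>x y x' y' x1 y1 x2 y2. twirl2 G x (x \<noteq> y) x' (x' \<noteq> y') x1 (x1 \<noteq> y1) x2 (x2 \<noteq> y2))
    = loc_avg s u (\<lambda>s u. block_purity s u G)"
proof -
  define k1 k2 k3 k4 where "k1 = (4 * block_purity False False G - 2 * block_purity False True G - 2 * block_purity True False G + block_purity True True G) / 36"
    and "k2 = (4 * block_purity False True G - 2 * block_purity False False G - 2 * block_purity True True G + block_purity True False G) / 36"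
    and "k3 = (4 * block_purity True False G - 2 * block_purity True True G - 2 * block_purity False False G + block_purity False True G) / 36"
    and "k4 = (4 * block_purity True True G - 2 * block_purity True False G - 2 * block_purity False True G + block_purity False False G) / 36"
  have t: "twirl2 G x y x' y' x1 y1 x2 y2 =
     of_bool (x = x1 \<and> x' = x2) * (of_bool (y = y1 \<and> y' = y2) * k1 + of_bool (y = y2 \<and> y' = y1) * k2)
   + of_bool (x = x2 \<and> x' = x1) * (of_bool (y = y1 \<and> y' = y2) * k3 + of_bool (y = y2 \<and> y' = y1) * k4)"
    for x y x' y' x1 y1 x2 y2
    unfolding tw2_expand k1_def k2_def k3_def k4_def by (simp only: times_divide_eq_right)
  \<comment> \<open>The integers count the bit quadruples x, y, x', y' that satisfy both the pairing
    left by the twirl, seen through CNOT, and the contraction prescribed by s and u.\<close>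
  have "block_purity s u (\<lambda>x y x' y' x1 y1 x2 y2. twirl2 G x (x \<noteq> y) x' (x' \<noteq> y') x1 (x1 \<noteq> y1) x2 (x2 \<noteq> y2))
    = (if s = u then (if s then 4 * k1 + 8 * k2 + 8 * k3 + 16 * k4 else 16 * k1 + 8 * k2 + 8 * k3 + 4 * k4)
       else (if s then 8 * k1 + 4 * k2 + 8 * k3 + 8 * k4 else 8 * k1 + 8 * k2 + 4 * k3 + 8 * k4))"
    unfolding block_purity_def t sum_UNIV_bool by (cases s; cases u) simp_all
  also have "\<dots> = loc_avg s u (\<lambda>s u. block_purity s u G)"
    unfolding k1_def k2_def k3_def k4_def loc_avg_def by (cases s; cases u) (simp_all add: field_simps)
  finally show ?thesis .
qed

section \<open>Splitting off the two qubits of a gate\<close>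

definition block_set :: "nat \<Rightarrow> nat \<Rightarrow> nat set \<Rightarrow> bool \<Rightarrow> bool \<Rightarrow> nat set" where
  "block_set c t X x y = ins c x (ins t y X)"

lemma ins_simps:
  "ins q a (ins q b X) = ins q a X"
  "q \<noteq> r \<Longrightarrow> ins q a (ins r b X) = ins r b (ins q a X)"
  "q \<in> ins q a X \<longleftrightarrow> a" "q \<noteq> r \<Longrightarrow> q \<in> ins r a X \<longleftrightarrow> q \<in> X"
  by (auto simp: ins_def)

lemma blk_simps:
  assumes "c \<noteq> t"
  shows "c \<in> block_set c t X x y \<longleftrightarrow> x" "t \<in> block_set c t X x y \<longleftrightarrow> y"
    "ins c a (block_set c t X x y) = block_set c t X a y" "ins t a (block_set c t X x y) = block_set c t X x a"
    "cflip c t (block_set c t X x y) = block_set c t X x (x \<noteq> y)"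
  using assms by (auto simp: block_set_def cflip_def ins_def)

lemma mix_blk:
  assumes "c \<noteq> t"
  shows "mix S (block_set c t X x y) (block_set c t Y x' y')
    = block_set c t (mix S X Y) (if c \<in> S then x' else x) (if t \<in> S then y' else y)"
  using assms by (auto simp: block_set_def ins_def mix_def)

lemma sum_Pow_blk:
  assumes "c < N" "t < N" "c \<noteq> t"
  shows "(\<Sum>X\<in>Pow {..<N}. g X :: complex) = (\<Sum>X\<in>Pow ({..<N} - {c,t}). \<Sum>x\<in>UNIV. \<Sum>y\<in>UNIV. g (block_set c t X x y))"
proof -
  have "(\<Sum>X\<in>Pow {..<N}. g X) = (\<Sum>R\<in>Pow ({..<N} - {c,t}).
     g R + g (insert c R) + g (insert t R) + g (insert c (insert t R)))"
    using assms by (intro pair_sum_split) auto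
  also have "\<dots> = (\<Sum>X\<in>Pow ({..<N} - {c,t}). \<Sum>x\<in>UNIV. \<Sum>y\<in>UNIV. g (block_set c t X x y))"
  proof (rule sum.cong[OF refl])
    fix X assume "X \<in> Pow ({..<N} - {c,t})"
    then have "block_set c t X False False = X" "block_set c t X True False = insert c X"
      "block_set c t X False True = insert t X" "block_set c t X True True = insert c (insert t X)"
      using assms by (auto simp: block_set_def ins_def)
    then show "g X + g (insert c X) + g (insert t X) + g (insert c (insert t X))
      = (\<Sum>x\<in>UNIV. \<Sum>y\<in>UNIV. g (block_set c t X x y))"
      by (simp add: sum_UNIV_bool)
  qed
  finally show ?thesis .
qed

text \<open>With the other qubits frozen, S acts on them only through \<open>S - {c,t}\<close>. All
  subsets that agree off c and t therefore share the same blocks and differ only in the two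
  flags.\<close>

lemma pur_blk:
  assumes "c < N" "t < N" "c \<noteq> t"
  shows "purity N S K = (\<Sum>X\<in>Pow ({..<N} - {c,t}). \<Sum>Y\<in>Pow ({..<N} - {c,t}).
    block_purity (c \<in> S) (t \<in> S) (\<lambda>x y x' y' x1 y1 x2 y2. K (block_set c t X x y) (block_set c t Y x' y')
       (block_set c t (mix (S - {c,t}) X Y) x1 y1) (block_set c t (mix (S - {c,t}) Y X) x2 y2)))"
proof -
  have m: "mix (S - {c,t}) X Y = mix S X Y" if "X \<in> Pow ({..<N} - {c,t})" "Y \<in> Pow ({..<N} - {c,t})" for X Y
    using that by (auto simp: mix_def)
  have "purity N S K = (\<Sum>X\<in>Pow ({..<N} - {c,t}). \<Sum>x\<in>UNIV. \<Sum>y\<in>UNIV. \<Sum>Y\<in>Pow ({..<N} - {c,t}). \<Sum>x'\<in>UNIV. \<Sum>y'\<in>UNIV.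
     K (block_set c t X x y) (block_set c t Y x' y') (mix S (block_set c t X x y) (block_set c t Y x' y')) (mix S (block_set c t Y x' y') (block_set c t X x y)))"
    unfolding purity_def sum_Pow_blk[OF assms] ..
  also have "\<dots> = (\<Sum>X\<in>Pow ({..<N} - {c,t}). \<Sum>Y\<in>Pow ({..<N} - {c,t}). \<Sum>x\<in>UNIV. \<Sum>y\<in>UNIV. \<Sum>x'\<in>UNIV. \<Sum>y'\<in>UNIV.
     K (block_set c t X x y) (block_set c t Y x' y') (mix S (block_set c t X x y) (block_set c t Y x' y')) (mix S (block_set c t Y x' y') (block_set c t X x y)))"
    by (simp add: sum_UNIV_bool sum.distrib)
  also have "\<dots> = (\<Sum>X\<in>Pow ({..<N} - {c,t}). \<Sum>Y\<in>Pow ({..<N} - {c,t}).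
    block_purity (c \<in> S) (t \<in> S) (\<lambda>x y x' y' x1 y1 x2 y2. K (block_set c t X x y) (block_set c t Y x' y')
       (block_set c t (mix (S - {c,t}) X Y) x1 y1) (block_set c t (mix (S - {c,t}) Y X) x2 y2)))"
    unfolding block_purity_def mix_blk[OF assms(3)] by (intro sum.cong refl) (simp_all add: m)
  finally show ?thesis .
qed

lemma pur_gate_avg:
  assumes "c < N" "t < N" "c \<noteq> t"
  shows "purity N S (gate_avg c t K) = loc_avg (c \<in> S) (t \<in> S) (\<lambda>s u. purity N (ins c s (ins t u S)) K)"
proof -
  let ?J = "Pow ({..<N} - {c,t})"
  define G where "G = (\<lambda>X Y x y x' y' x1 y1 x2 y2. K (block_set c t X x y) (block_set c t Y x' y')
       (block_set c t (mix (S - {c,t}) X Y) x1 y1) (block_set c t (mix (S - {c,t}) Y X) x2 y2))"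
  have R: "ins c s (ins t u S) - {c,t} = S - {c,t}" for s u by (auto simp: ins_def)
  have P: "purity N (ins c s (ins t u S)) K = (\<Sum>X\<in>?J. \<Sum>Y\<in>?J. block_purity s u (G X Y))" for s u
    unfolding pur_blk[OF assms] G_def R using assms(3) by (simp add: ins_simps)
  have "purity N S (gate_avg c t K) = (\<Sum>X\<in>?J. \<Sum>Y\<in>?J. block_purity (c \<in> S) (t \<in> S)
     (\<lambda>x y x' y' x1 y1 x2 y2. twirl2 (G X Y) x (x \<noteq> y) x' (x' \<noteq> y') x1 (x1 \<noteq> y1) x2 (x2 \<noteq> y2)))"
    unfolding pur_blk[OF assms] gate_avg_def twirl_at_def twirl2_def G_def blk_simps[OF assms(3)] ..
  also have "\<dots> = loc_avg (c \<in> S) (t \<in> S) (\<lambda>s u. purity N (ins c s (ins t u S)) K)"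
    unfolding loc_cnot_tw2 P unfolding loc_avg_def
    by (simp add: sum.distrib sum_subtractf sum_distrib_left)
  finally show ?thesis .
qed

lemma pur_gate_avg_pair_q:
  assumes "c < N" "t < N" "c \<noteq> t" "S \<subseteq> {..<N}"
  shows "2 ^ card S * Re (purity N S (gate_avg c t K)) = pair_q c t (\<lambda>S. 2 ^ card S * Re (purity N S K)) S"
proof -
  have fin: "finite S" using assms(4) finite_subset by blast
  have one: "ins c True (ins t False S) = S" "ins c False (ins t False S) = S - {c}"
    "ins c False (ins t True S) = insert t (S - {c})" "ins c True (ins t True S) = insert t S"
    "card S = Suc (card (S - {c}))" "card (insert t (S - {c})) = Suc (card (S - {c}))"
    "card (insert t S) = Suc (Suc (card (S - {c})))"
    if "c \<in> S" "t \<notin> S" "c \<noteq> t" for c t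
    using that fin card_Suc_Diff1[OF fin that(1)] by (auto simp: ins_def)
  consider "c \<in> S \<and> t \<notin> S" | "t \<in> S \<and> c \<notin> S" | "(c \<in> S) = (t \<in> S)" by blast
  then show ?thesis
  proof cases
    case 1
    note o = one[OF conjunct1[OF 1] conjunct2[OF 1] assms(3)]
    have "pair_q c t (\<lambda>S. 2 ^ card S * Re (purity N S K)) S
       = 2 ^ card S * (4/9 * Re (purity N (S - {c}) K) + 1/9 * Re (purity N S K)
          - 2/9 * Re (purity N (insert t (S - {c})) K) + 4/9 * Re (purity N (insert t S) K))"
      unfolding pair_q_def o(5-7) using 1 by (simp only: if_True simp_thms power_Suc) (simp add: field_simps)
    then show ?thesis using 1 by (simp add: pur_gate_avg[OF assms(1-3)] loc_avg_def o(1-4))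
  next
    case 2
    note o = one[OF conjunct1[OF 2] conjunct2[OF 2] assms(3)[symmetric]]
    have sw: "ins c s (ins t u S) = ins t u (ins c s S)" for s u using assms(3) by (rule ins_simps(2))
    have "pair_q c t (\<lambda>S. 2 ^ card S * Re (purity N S K)) S
       = 2 ^ card S * (4/9 * Re (purity N (S - {t}) K) + 1/9 * Re (purity N S K)
          - 2/9 * Re (purity N (insert c (S - {t})) K) + 4/9 * Re (purity N (insert c S) K))"
      unfolding pair_q_def o(5-7) using 2 by (simp only: if_True if_False simp_thms power_Suc) (simp add: field_simps)
    then show ?thesis using 2 by (simp add: pur_gate_avg[OF assms(1-3)] loc_avg_def sw o(1-4))
  next
    case 3
    have "ins c (t \<in> S) (ins t (t \<in> S) S) = S" using 3 by (auto simp: ins_def)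
    then show ?thesis using 3 by (auto simp: pur_gate_avg[OF assms(1-3)] loc_avg_def pair_q_def)
  qed
qed

section \<open>States indexed by sets\<close>

text \<open>Sets of qubits as indices let sums over basis states use the power set lemmas of the
  Markov chain, and turn bit operations into insertion and removal.\<close>

definition set_amp :: "(nat \<Rightarrow> complex) \<Rightarrow> nat set \<Rightarrow> complex" where
  "set_amp \<psi> X = \<psi> (set_encode X)"

definition quad :: "(nat set \<Rightarrow> complex) \<Rightarrow> tensor" where
  "quad \<phi> X Y Z W = \<phi> X * \<phi> Y * cnj (\<phi> Z) * cnj (\<phi> W)"

lemma bit_set_encode: "finite X \<Longrightarrow> bit (set_encode X) q \<longleftrightarrow> q \<in> X"
  using set_encode_inverse[of X] by (auto simp: set_decode_def bit_iff_odd)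

lemma set_encode_eqI:
  assumes "finite X" "\<And>q. bit x q \<longleftrightarrow> q \<in> X"
  shows "x = set_encode X"
  by (rule bit_eqI) (use assms in \<open>simp add: bit_set_encode\<close>)

lemma setb_set_encode: "finite X \<Longrightarrow> setb (set_encode X) q b = set_encode (ins q b X)"
  by (rule set_encode_eqI)
    (auto simp: setb_def ins_def bit_set_bit_iff bit_unset_bit_iff bit_set_encode)

lemma sts_apply1:
  "finite X \<Longrightarrow> set_amp (apply1 U q \<psi>) X = (\<Sum>b\<in>UNIV. entry U (idx2 (q \<in> X)) (idx2 b) * set_amp \<psi> (ins q b X))"
  by (simp add: set_amp_def apply1_def bit_set_encode setb_set_encode sum_UNIV_bool)

lemma sts_cnot:
  assumes "finite X" "c \<noteq> t"
  shows "set_amp (cnot c t \<psi>) X = set_amp \<psi> (cflip c t X)"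
proof -
  have "flip_bit t (set_encode X) = set_encode (ins t (t \<notin> X) X)"
    by (rule set_encode_eqI) (use assms in \<open>auto simp: ins_def bit_flip_bit_iff bit_set_encode\<close>)
  then show ?thesis using assms by (simp add: set_amp_def cnot_def bit_set_encode cflip_def)
qed

lemma bij_betw_set_encode: "bij_betw set_encode (Pow {..<N}) {..<2 ^ N}"
proof (rule bij_betw_byWitness[where f' = set_decode])
  show "\<forall>X\<in>Pow {..<N}. set_decode (set_encode X) = X"
    by (auto intro!: set_encode_inverse finite_subset[OF _ finite_lessThan])
  show "\<forall>x\<in>{..<2 ^ N}. set_encode (set_decode x) = x" by simp
  show "set_encode ` Pow {..<N} \<subseteq> {..<2 ^ N}"
  proof
    fix x assume "x \<in> set_encode ` Pow {..<N}"
    then obtain X where X: "X \<subseteq> {..<N}" "x = set_encode X" by auto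
    then have "finite X" using finite_subset by blast
    then have "take_bit N x = x" using X
      by (intro bit_eqI) (auto simp: bit_take_bit_iff bit_set_encode)
    then show "x \<in> {..<2 ^ N}" by (simp add: take_bit_nat_eq_self_iff)
  qed
  show "set_decode ` {..<2 ^ N} \<subseteq> Pow {..<N}"
  proof safe
    fix x :: nat and q assume "x < 2 ^ N" "q \<in> set_decode x"
    then have "bit (take_bit N x) q" by (simp add: take_bit_nat_eq_self bit_iff_odd set_decode_def)
    then show "q < N" by (simp add: bit_take_bit_iff)
  qed
qed

definition pure_set :: "nat \<Rightarrow> (nat set \<Rightarrow> complex) \<Rightarrow> bool" where
  "pure_set N \<phi> \<longleftrightarrow> (\<Sum>X\<in>Pow {..<N}. (cmod (\<phi> X))\<^sup>2) = 1"

lemma is_pure_state_sts: "is_pure_state N \<psi> \<longleftrightarrow> pure_set N (set_amp \<psi>)"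
  unfolding is_pure_state_def pure_set_def set_amp_def
  using sum.reindex_bij_betw[OF bij_betw_set_encode, of "\<lambda>x. (cmod (\<psi> x))\<^sup>2" N] by simp

lemma unitary2_norm:
  assumes "U \<in> unitary2"
  shows "(cmod (entry U 0 0 * a + entry U 0 1 * b))\<^sup>2 + (cmod (entry U 1 0 * a + entry U 1 1 * b))\<^sup>2
    = (cmod a)\<^sup>2 + (cmod b)\<^sup>2"
proof -
  have c: "entry U 0 j * cnj (entry U 0 k) + entry U 1 j * cnj (entry U 1 k) = (if j = k then 1 else 0)" for j k
    using unitary2_columns[OF assms, of j k] by (simp add: sum_UNIV_2)
  have "complex_of_real ((cmod (entry U 0 0 * a + entry U 0 1 * b))\<^sup>2 + (cmod (entry U 1 0 * a + entry U 1 1 * b))\<^sup>2)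
    = (entry U 0 0 * cnj (entry U 0 0) + entry U 1 0 * cnj (entry U 1 0)) * (a * cnj a)
     + (entry U 0 1 * cnj (entry U 0 1) + entry U 1 1 * cnj (entry U 1 1)) * (b * cnj b)
     + (entry U 0 0 * cnj (entry U 0 1) + entry U 1 0 * cnj (entry U 1 1)) * (a * cnj b)
     + (entry U 0 1 * cnj (entry U 0 0) + entry U 1 1 * cnj (entry U 1 0)) * (b * cnj a)"
    by (simp only: of_real_add complex_norm_square complex_cnj_add complex_cnj_mult) (simp add: algebra_simps)
  also have "\<dots> = complex_of_real ((cmod a)\<^sup>2 + (cmod b)\<^sup>2)"
    unfolding c by (simp only: of_real_add complex_norm_square) simp
  finally show ?thesis by (simp only: of_real_eq_iff)
qed

lemma pure_apply1:
  assumes "U \<in> unitary2" "q < N" "is_pure_state N \<psi>"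
  shows "is_pure_state N (apply1 U q \<psi>)"
proof -
  have I: "{..<N} = insert q ({..<N} - {q})" using assms by auto
  have s: "(\<Sum>X\<in>Pow {..<N}. g X :: real) = (\<Sum>X\<in>Pow ({..<N} - {q}). g X + g (insert q X))" for g
    by (subst I, rule sum_Pow_insert) auto
  have "(\<Sum>X\<in>Pow {..<N}. (cmod (set_amp (apply1 U q \<psi>) X))\<^sup>2) = (\<Sum>X\<in>Pow {..<N}. (cmod (set_amp \<psi> X))\<^sup>2)"
    unfolding s
  proof (rule sum.cong[OF refl])
    fix X assume X: "X \<in> Pow ({..<N} - {q})"
    then have f: "finite X" "q \<notin> X" using finite_subset[of X "{..<N}"] by auto
    have i: "ins q False X = X" "ins q True X = insert q X" "ins q False (insert q X) = X" "ins q True (insert q X) = insert q X"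
      using f by (auto simp: ins_def)
    have ix: "idx2 False = 0" "idx2 True = 1" by (auto simp: idx2_def)
    show "(cmod (set_amp (apply1 U q \<psi>) X))\<^sup>2 + (cmod (set_amp (apply1 U q \<psi>) (insert q X)))\<^sup>2
       = (cmod (set_amp \<psi> X))\<^sup>2 + (cmod (set_amp \<psi> (insert q X)))\<^sup>2"
      using unitary2_norm[OF assms(1), of "set_amp \<psi> X" "set_amp \<psi> (insert q X)"] f
      by (simp add: sts_apply1 sum_UNIV_bool i ix)
  qed
  then show ?thesis using assms(3) by (simp add: is_pure_state_sts pure_set_def)
qed

lemma cflip_involution: "c \<noteq> t \<Longrightarrow> cflip c t (cflip c t X) = X"
  by (auto simp: cflip_def ins_def)

lemma cflip_subset: "t < N \<Longrightarrow> X \<subseteq> {..<N} \<Longrightarrow> cflip c t X \<subseteq> {..<N}"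
  by (auto simp: cflip_def ins_def)

lemma ins_subset: "q < N \<Longrightarrow> X \<subseteq> {..<N} \<Longrightarrow> ins q b X \<subseteq> {..<N}"
  by (auto simp: ins_def)

lemma pure_cnot:
  assumes "c \<noteq> t" "t < N" "is_pure_state N \<psi>"
  shows "is_pure_state N (cnot c t \<psi>)"
proof -
  have "(\<Sum>X\<in>Pow {..<N}. (cmod (set_amp (cnot c t \<psi>) X))\<^sup>2) = (\<Sum>X\<in>Pow {..<N}. (cmod (set_amp \<psi> X))\<^sup>2)"
    by (rule sum.reindex_bij_witness[of _ "cflip c t" "cflip c t"])
      (use assms cflip_subset[OF assms(2)] in \<open>auto simp: cflip_involution sts_cnot finite_subset[OF _ finite_lessThan]\<close>)
  then show ?thesis using assms(3) by (simp add: is_pure_state_sts pure_set_def)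
qed

text \<open>The measure lives on all complex matrices, so unitarity, and with it the normalization
  of the state, holds only almost surely; this is the event for one gate.\<close>

definition good_gate :: "nat \<Rightarrow> gate \<Rightarrow> bool" where
  "good_gate N w \<longleftrightarrow> fst w \<in> offdiag_pairs N \<and> fst (snd w) \<in> unitary2 \<and> snd (snd w) \<in> unitary2"

lemma pure_apply_gate:
  assumes "good_gate N w" "is_pure_state N \<psi>"
  shows "is_pure_state N (apply_gate w \<psi>)"
  using assms
  by (auto simp: good_gate_def offdiag_pairs_def apply_gate_def split: prod.splits
      intro!: pure_cnot pure_apply1)

lemma pure_run_circuit:
  assumes "is_pure_state N \<psi>" "\<And>k. k < n \<Longrightarrow> good_gate N (g k)"
  shows "is_pure_state N (run_circuit n g \<psi>)"
  using assms(2) by (induction n) (auto simp: assms(1) intro!: pure_apply_gate)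

section \<open>Bounds and linearity for the fourfold tensor\<close>

lemma pure_entry_le:
  assumes "pure_set N \<phi>" "X \<subseteq> {..<N}"
  shows "cmod (\<phi> X) \<le> 1"
proof -
  have "(cmod (\<phi> X))\<^sup>2 \<le> (\<Sum>X\<in>Pow {..<N}. (cmod (\<phi> X))\<^sup>2)"
    by (rule member_le_sum) (use assms in auto)
  then show ?thesis using assms by (simp add: pure_set_def power2_le_imp_le)
qed

lemma norm_ten_le:
  assumes "pure_set N \<phi>" "X \<subseteq> {..<N}" "Y \<subseteq> {..<N}" "Z \<subseteq> {..<N}" "W \<subseteq> {..<N}"
  shows "norm (quad \<phi> X Y Z W) \<le> 1"
  using assms by (auto simp: quad_def norm_mult intro!: mult_le_one pure_entry_le)

lemma ten_apply1:
  assumes "finite X" "finite Y" "finite Z" "finite W"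
  shows "quad (set_amp (apply1 U q \<psi>)) X Y Z W = (\<Sum>a\<in>UNIV. \<Sum>b\<in>UNIV. \<Sum>c\<in>UNIV. \<Sum>d\<in>UNIV.
     entry U (idx2 (q \<in> X)) (idx2 a) * entry U (idx2 (q \<in> Y)) (idx2 b)
      * cnj (entry U (idx2 (q \<in> Z)) (idx2 c)) * cnj (entry U (idx2 (q \<in> W)) (idx2 d))
      * quad (set_amp \<psi>) (ins q a X) (ins q b Y) (ins q c Z) (ins q d W))"
  unfolding quad_def sts_apply1[OF assms(1)] sts_apply1[OF assms(2)] sts_apply1[OF assms(3)] sts_apply1[OF assms(4)]
  by (simp only: cnj_sum complex_cnj_mult sum_product4, intro sum.cong refl, simp only: mult_ac)

lemma tw_integral:
  assumes "\<And>a b c d. integrable M (\<lambda>v. G v a b c d)"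
  shows "(\<integral>v. twirl (G v) i j k l \<partial>M) = twirl (\<lambda>a b c d. \<integral>v. G v a b c d \<partial>M) i j k l"
    and "integrable M (\<lambda>v. twirl (G v) i j k l)"
proof -
  define A where "A = (\<lambda>v. \<Sum>a\<in>UNIV. \<Sum>b\<in>UNIV. G v a b a b)"
  define B where "B = (\<lambda>v. \<Sum>a\<in>UNIV. \<Sum>b\<in>UNIV. G v a b b a)"
  have AB: "integrable M A" "integrable M B" unfolding A_def B_def by (auto simp: assms)
  have sA: "(\<Sum>a\<in>UNIV. \<Sum>b\<in>UNIV. \<integral>v. G v a b a b \<partial>M) = integral\<^sup>L M A"
   and sB: "(\<Sum>a\<in>UNIV. \<Sum>b\<in>UNIV. \<integral>v. G v a b b a \<partial>M) = integral\<^sup>L M B"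
    unfolding A_def B_def by (simp_all add: assms)
  have t: "twirl (G v) i j k l = (if i = k \<and> j = l then (2 * A v - B v) / 6 else 0) + (if i = l \<and> j = k then (2 * B v - A v) / 6 else 0)" for v
    unfolding twirl_def A_def B_def ..
  have I: "(\<integral>v. (if P then (2 * A v - B v) / 6 else 0) + (if Q then (2 * B v - A v) / 6 else 0) \<partial>M)
    = (if P then (2 * integral\<^sup>L M A - integral\<^sup>L M B) / 6 else 0) + (if Q then (2 * integral\<^sup>L M B - integral\<^sup>L M A) / 6 else 0)"
    and J: "integrable M (\<lambda>v. (if P then (2 * A v - B v) / 6 else 0) + (if Q then (2 * B v - A v) / 6 else 0))" for P Q
    by (cases P; cases Q; simp add: AB)+
  show "(\<integral>v. twirl (G v) i j k l \<partial>M) = twirl (\<lambda>a b c d. \<integral>v. G v a b c d \<partial>M) i j k l"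
    unfolding t unfolding twirl_def sA sB by (rule I)
  show "integrable M (\<lambda>v. twirl (G v) i j k l)"
    unfolding t by (rule J)
qed

lemma twq_integral:
  assumes "q < N" "X \<subseteq> {..<N}" "Y \<subseteq> {..<N}" "Z \<subseteq> {..<N}" "W \<subseteq> {..<N}"
    "\<And>X Y Z W. X \<subseteq> {..<N} \<Longrightarrow> Y \<subseteq> {..<N} \<Longrightarrow> Z \<subseteq> {..<N} \<Longrightarrow> W \<subseteq> {..<N} \<Longrightarrow> integrable M (\<lambda>v. K v X Y Z W)"
  shows "(\<integral>v. twirl_at q (K v) X Y Z W \<partial>M) = twirl_at q (\<lambda>X Y Z W. \<integral>v. K v X Y Z W \<partial>M) X Y Z W"
    and "integrable M (\<lambda>v. twirl_at q (K v) X Y Z W)"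
  unfolding twirl_at_def
  by (rule tw_integral; intro assms ins_subset; fact)+

text \<open>\<open>gate_avg\<close> is a fixed linear map, so it commutes with the expectation over
  the preceding gates; the recursion for the expected tensor rests on this.\<close>

lemma gate_avg_integral:
  assumes "c < N" "t < N" "X \<subseteq> {..<N}" "Y \<subseteq> {..<N}" "Z \<subseteq> {..<N}" "W \<subseteq> {..<N}"
    "\<And>X Y Z W. X \<subseteq> {..<N} \<Longrightarrow> Y \<subseteq> {..<N} \<Longrightarrow> Z \<subseteq> {..<N} \<Longrightarrow> W \<subseteq> {..<N} \<Longrightarrow> integrable M (\<lambda>v. K v X Y Z W)"
  shows "(\<integral>v. gate_avg c t (K v) X Y Z W \<partial>M) = gate_avg c t (\<lambda>X Y Z W. \<integral>v. K v X Y Z W \<partial>M) X Y Z W"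
    and "integrable M (\<lambda>v. gate_avg c t (K v) X Y Z W)"
proof -
  note sub = assms(3-6)[THEN cflip_subset[OF assms(2), of _ c]]
  have i: "integrable M (\<lambda>v. twirl_at t (K v) X Y Z W)" if "X \<subseteq> {..<N}" "Y \<subseteq> {..<N}" "Z \<subseteq> {..<N}" "W \<subseteq> {..<N}" for X Y Z W
    using that by (intro twq_integral(2)[OF assms(2)] assms) auto
  have e: "(\<integral>v. twirl_at t (K v) X Y Z W \<partial>M) = twirl_at t (\<lambda>X Y Z W. \<integral>v. K v X Y Z W \<partial>M) X Y Z W"
    if "X \<subseteq> {..<N}" "Y \<subseteq> {..<N}" "Z \<subseteq> {..<N}" "W \<subseteq> {..<N}" for X Y Z W
    using that by (intro twq_integral(1)[OF assms(2)] assms) auto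
  have "(\<integral>v. gate_avg c t (K v) X Y Z W \<partial>M)
    = twirl_at c (\<lambda>X Y Z W. \<integral>v. twirl_at t (K v) X Y Z W \<partial>M) (cflip c t X) (cflip c t Y) (cflip c t Z) (cflip c t W)"
    unfolding gate_avg_def by (rule twq_integral(1)[OF assms(1) sub]) (rule i)
  also have "\<dots> = gate_avg c t (\<lambda>X Y Z W. \<integral>v. K v X Y Z W \<partial>M) X Y Z W"
    unfolding gate_avg_def twirl_at_def[of c] using sub assms(1) by (simp add: e ins_subset)
  finally show "(\<integral>v. gate_avg c t (K v) X Y Z W \<partial>M) = gate_avg c t (\<lambda>X Y Z W. \<integral>v. K v X Y Z W \<partial>M) X Y Z W" .
  show "integrable M (\<lambda>v. gate_avg c t (K v) X Y Z W)"
    unfolding gate_avg_def by (rule twq_integral(2)[OF assms(1) sub]) (rule i)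
qed

section \<open>The random circuit\<close>

lemma unitary2_borel [measurable]: "unitary2 \<in> sets borel"
proof -
  have "closed unitary2"
  proof -
    have "unitary2 = {U. \<forall>i j. (\<Sum>m\<in>UNIV. entry U i m * cnj (entry U j m)) = (if i = j then 1 else 0)}"
      using unitary2_iff by blast
    also have "closed \<dots>" by (intro closed_Collect_all closed_Collect_eq continuous_intros)
    finally show ?thesis .
  qed
  then show ?thesis by (rule borel_closed)
qed

lemma measurable_apply1:
  assumes [measurable]: "U \<in> borel_measurable M" "\<And>x. (\<lambda>\<omega>. \<psi> \<omega> x) \<in> borel_measurable M"
  shows "(\<lambda>\<omega>. apply1 (U \<omega>) q (\<psi> \<omega>) x) \<in> borel_measurable M"
  unfolding apply1_def by measurable

lemma measurable_ten:
  assumes "\<And>x. (\<lambda>\<omega>. \<psi> \<omega> x) \<in> borel_measurable M"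
  shows "(\<lambda>\<omega>. quad (set_amp (\<psi> \<omega>)) X Y Z W) \<in> borel_measurable M"
  unfolding quad_def set_amp_def using assms by measurable

lemma ten_cnot:
  assumes "c \<noteq> t" "X \<subseteq> {..<N}" "Y \<subseteq> {..<N}" "Z \<subseteq> {..<N}" "W \<subseteq> {..<N}"
  shows "quad (set_amp (cnot c t \<psi>)) X Y Z W = quad (set_amp \<psi>) (cflip c t X) (cflip c t Y) (cflip c t Z) (cflip c t W)"
  using assms finite_subset[OF _ finite_lessThan] by (simp add: quad_def sts_cnot)

lemma run_circuit_upd: "m \<le> k \<Longrightarrow> run_circuit m (x(k := y)) \<psi> = run_circuit m x \<psi>"
  by (induction m) auto

lemma pur_cong:
  assumes "\<And>X Y Z W. X \<subseteq> {..<N} \<Longrightarrow> Y \<subseteq> {..<N} \<Longrightarrow> Z \<subseteq> {..<N} \<Longrightarrow> W \<subseteq> {..<N} \<Longrightarrow> K X Y Z W = K' X Y Z W"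
  shows "purity N S K = purity N S K'"
  unfolding purity_def by (intro sum.cong refl assms) (auto simp: mix_def)

lemma sum_pure_square:
  assumes "pure_set N \<phi>"
  shows "(\<Sum>X\<in>Pow {..<N}. \<Sum>Y\<in>Pow {..<N}. (cmod (\<phi> X))\<^sup>2 * (cmod (\<phi> Y))\<^sup>2) = 1"
  using assms by (simp add: pure_set_def flip: sum_product)

text \<open>Arithmetic-geometric mean on each summand; both resulting products have the same total,
  because exchanging the qubits of S between X and Y is an involution on pairs.\<close>

lemma norm_pur_le:
  assumes "pure_set N \<phi>"
  shows "norm (purity N S (quad \<phi>)) \<le> 1"
proof -
  let ?P = "Pow {..<N} \<times> Pow {..<N}"
  have "norm (purity N S (quad \<phi>)) \<le> (\<Sum>X\<in>Pow {..<N}. \<Sum>Y\<in>Pow {..<N}. norm (quad \<phi> X Y (mix S X Y) (mix S Y X)))"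
    unfolding purity_def by (rule order.trans[OF norm_sum]) (intro sum_mono norm_sum)
  also have "\<dots> \<le> (\<Sum>X\<in>Pow {..<N}. \<Sum>Y\<in>Pow {..<N}.
     ((cmod (\<phi> X))\<^sup>2 * (cmod (\<phi> Y))\<^sup>2 + (cmod (\<phi> (mix S X Y)))\<^sup>2 * (cmod (\<phi> (mix S Y X)))\<^sup>2) / 2)"
  proof (intro sum_mono)
    fix X Y
    have "a * b \<le> (a\<^sup>2 + b\<^sup>2) / 2" for a b :: real
      using zero_le_power2[of "a - b"] by (simp add: power2_eq_square algebra_simps)
    from this[of "cmod (\<phi> X) * cmod (\<phi> Y)" "cmod (\<phi> (mix S X Y)) * cmod (\<phi> (mix S Y X))"]
    show "norm (quad \<phi> X Y (mix S X Y) (mix S Y X))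
      \<le> ((cmod (\<phi> X))\<^sup>2 * (cmod (\<phi> Y))\<^sup>2 + (cmod (\<phi> (mix S X Y)))\<^sup>2 * (cmod (\<phi> (mix S Y X)))\<^sup>2) / 2"
      by (simp add: quad_def norm_mult power_mult_distrib mult.assoc)
  qed
  also have "\<dots> = ((\<Sum>X\<in>Pow {..<N}. \<Sum>Y\<in>Pow {..<N}. (cmod (\<phi> X))\<^sup>2 * (cmod (\<phi> Y))\<^sup>2)
      + (\<Sum>X\<in>Pow {..<N}. \<Sum>Y\<in>Pow {..<N}. (cmod (\<phi> (mix S X Y)))\<^sup>2 * (cmod (\<phi> (mix S Y X)))\<^sup>2)) / 2"
    by (simp add: sum.distrib flip: sum_divide_distrib)
  also have "(\<Sum>X\<in>Pow {..<N}. \<Sum>Y\<in>Pow {..<N}. (cmod (\<phi> (mix S X Y)))\<^sup>2 * (cmod (\<phi> (mix S Y X)))\<^sup>2)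
      = (\<Sum>X\<in>Pow {..<N}. \<Sum>Y\<in>Pow {..<N}. (cmod (\<phi> X))\<^sup>2 * (cmod (\<phi> Y))\<^sup>2)"
    unfolding sum.cartesian_product
  proof (rule sum.reindex_bij_witness[of _ "\<lambda>(X,Y). (mix S X Y, mix S Y X)" "\<lambda>(X,Y). (mix S X Y, mix S Y X)"])
    fix p assume "p \<in> ?P"
    then show "(case (case p of (X,Y) \<Rightarrow> (mix S X Y, mix S Y X)) of (X,Y) \<Rightarrow> (mix S X Y, mix S Y X)) = p"
      "(case p of (X,Y) \<Rightarrow> (mix S X Y, mix S Y X)) \<in> ?P"
      by (auto simp: mix_def)
  qed (auto simp: mix_def)
  finally show ?thesis by (simp add: sum_pure_square[OF assms])
qed

context
  fixes \<mu> :: "mat2 measure" and N :: nat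
  assumes haar: "haar_U2 \<mu>" and N: "N \<ge> 2"
begin

interpretation mu: prob_space \<mu> by (rule haar_prob_space[OF haar])

lemmas mu_sets [measurable_cong] = haar_sets[OF haar]

lemma offdiag_nonempty: "offdiag_pairs N \<noteq> {}"
proof -
  have "(0, 1) \<in> offdiag_pairs N" using N by (simp add: offdiag_pairs_def)
  then show ?thesis by blast
qed

interpretation uc: prob_space "uniform_count_measure (offdiag_pairs N)"
  by (rule prob_space_uniform_count_measure) (simp_all add: offdiag_nonempty)

interpretation mm: pair_prob_space \<mu> \<mu> ..

interpretation gm: pair_prob_space "uniform_count_measure (offdiag_pairs N)" "\<mu> \<Otimes>\<^sub>M \<mu>" ..

interpretation gate: prob_space "gate_measure N \<mu>"
  unfolding gate_measure_def by (rule gm.prob_space_axioms)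

interpretation circ: product_prob_space "\<lambda>_::nat. gate_measure N \<mu>" "{..<n}" for n ..

lemma prob_space_circuit: "prob_space (circuit_measure N \<mu> n)"
  unfolding circuit_measure_def by (rule circ.prob_space_axioms)

lemma measurable_to_borel: "f \<in> M \<rightarrow>\<^sub>M \<mu> \<Longrightarrow> f \<in> borel_measurable M"
  using measurable_cong_sets[OF refl mu_sets, of M] by simp

lemma measurable_to_count_space:
  "p \<in> M \<rightarrow>\<^sub>M uniform_count_measure (offdiag_pairs N) \<Longrightarrow> p \<in> M \<rightarrow>\<^sub>M count_space (offdiag_pairs N)"
  using measurable_cong_sets[OF refl sets_uniform_count_measure_count_space, of M "offdiag_pairs N"] by simp

lemma AE_unitary_pair: "AE y in \<mu> \<Otimes>\<^sub>M \<mu>. fst y \<in> unitary2 \<and> snd y \<in> unitary2"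
proof (rule mm.AE_pair_measure)
  let ?M = "\<mu> \<Otimes>\<^sub>M \<mu>"
  have "{x \<in> space ?M. fst x \<in> unitary2 \<and> snd x \<in> unitary2}
    = (fst -` unitary2 \<inter> space ?M) \<inter> (snd -` unitary2 \<inter> space ?M)" by auto
  also have "\<dots> \<in> sets ?M"
    by (intro sets.Int measurable_sets[OF measurable_to_borel unitary2_borel]) auto
  finally show "{x \<in> space ?M. fst x \<in> unitary2 \<and> snd x \<in> unitary2} \<in> sets ?M" .
  show "AE x in \<mu>. AE y in \<mu>. fst (x, y) \<in> unitary2 \<and> snd (x, y) \<in> unitary2"
    using haar_AE[OF haar] by (auto elim!: eventually_mono)
qed

text \<open>The pair of qubits ranges over a finite set, so it suffices to treat each fixed pair,
  where only the matrices and the state vary.\<close>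

lemma measurable_apply_gate:
  assumes p: "p \<in> M \<rightarrow>\<^sub>M uniform_count_measure (offdiag_pairs N)"
    and [measurable]: "U \<in> borel_measurable M" "V \<in> borel_measurable M"
    "\<And>x. (\<lambda>\<omega>. \<psi> \<omega> x) \<in> borel_measurable M"
  shows "(\<lambda>\<omega>. apply_gate (p \<omega>, (U \<omega>, V \<omega>)) (\<psi> \<omega>) x) \<in> borel_measurable M"
proof (rule measurable_compose_countable'[where I="offdiag_pairs N" and g = p
      and f = "\<lambda>i \<omega>. apply_gate (i, (U \<omega>, V \<omega>)) (\<psi> \<omega>) x"])
  show "(\<lambda>\<omega>. apply_gate (i, (U \<omega>, V \<omega>)) (\<psi> \<omega>) x) \<in> borel_measurable M" for i
    unfolding apply_gate_def cnot_def
    by (cases i) (auto intro!: measurable_apply1)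
  show "p \<in> M \<rightarrow>\<^sub>M count_space (offdiag_pairs N)"
    using p by (rule measurable_to_count_space)
qed (simp add: countable_finite)

lemma measurable_run_circuit:
  "k \<le> n \<Longrightarrow> (\<lambda>g. run_circuit k g \<psi> x) \<in> borel_measurable (circuit_measure N \<mu> n)"
proof (induction k arbitrary: x)
  case (Suc k)
  have g: "(\<lambda>g. g k) \<in> circuit_measure N \<mu> n \<rightarrow>\<^sub>M uniform_count_measure (offdiag_pairs N) \<Otimes>\<^sub>M (\<mu> \<Otimes>\<^sub>M \<mu>)"
    using Suc.prems unfolding circuit_measure_def gate_measure_def[symmetric]
    by (intro measurable_component_singleton) auto
  note gg = measurable_compose[OF g]
  have "(\<lambda>g. apply_gate (fst (g k), (fst (snd (g k)), snd (snd (g k)))) (run_circuit k g \<psi>) x)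
     \<in> borel_measurable (circuit_measure N \<mu> n)"
  proof (rule measurable_apply_gate)
    show "(\<lambda>g. fst (g k)) \<in> circuit_measure N \<mu> n \<rightarrow>\<^sub>M uniform_count_measure (offdiag_pairs N)"
      by (rule gg) measurable
    show "(\<lambda>g. fst (snd (g k))) \<in> borel_measurable (circuit_measure N \<mu> n)"
      by (rule measurable_to_borel, rule gg) measurable
    show "(\<lambda>g. snd (snd (g k))) \<in> borel_measurable (circuit_measure N \<mu> n)"
      by (rule measurable_to_borel, rule gg) measurable
  qed (use Suc in auto)
  then show ?case by simp
qed simp

lemma AE_good_gate: "AE w in gate_measure N \<mu>. good_gate N w"
proof -
  have "AE p in uniform_count_measure (offdiag_pairs N). AE y in \<mu> \<Otimes>\<^sub>M \<mu>. good_gate N (p, y)"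
  proof (rule AE_I2)
    fix p assume "p \<in> space (uniform_count_measure (offdiag_pairs N))"
    then have p: "p \<in> offdiag_pairs N" by (simp add: space_uniform_count_measure)
    from AE_unitary_pair show "AE y in \<mu> \<Otimes>\<^sub>M \<mu>. good_gate N (p, y)" using p by (simp add: good_gate_def)
  qed
  then show ?thesis unfolding gate_measure_def
  proof (rule gm.AE_pair_measure[rotated])
    let ?M = "uniform_count_measure (offdiag_pairs N) \<Otimes>\<^sub>M (\<mu> \<Otimes>\<^sub>M \<mu>)"
    have "{x \<in> space ?M. good_gate N x}
      = ((\<lambda>w. fst (snd w)) -` unitary2 \<inter> space ?M) \<inter> ((\<lambda>w. snd (snd w)) -` unitary2 \<inter> space ?M)"
      by (auto simp: good_gate_def space_pair_measure space_uniform_count_measure)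
    also have "\<dots> \<in> sets ?M"
      by (intro sets.Int measurable_sets[OF measurable_to_borel unitary2_borel]) measurable
    finally show "{x \<in> space ?M. good_gate N x} \<in> sets ?M" .
  qed
qed

lemma AE_good_circuit: "AE g in circuit_measure N \<mu> n. \<forall>k<n. good_gate N (g k)"
proof -
  have "AE g in circuit_measure N \<mu> n. good_gate N (g k)" if "k < n" for k
    unfolding circuit_measure_def
    by (rule AE_PiM_component) (use that AE_good_gate gate.prob_space_axioms in auto)
  then show ?thesis by (simp add: AE_all_countable)
qed

lemma AE_pure_circuit:
  "is_pure_state N \<psi> \<Longrightarrow> AE g in circuit_measure N \<mu> n. is_pure_state N (run_circuit n g \<psi>)"
  using AE_good_circuit[of n] by eventually_elim (auto intro: pure_run_circuit)

lemma integrable_ten_circuit: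
  assumes "is_pure_state N \<psi>" "X \<subseteq> {..<N}" "Y \<subseteq> {..<N}" "Z \<subseteq> {..<N}" "W \<subseteq> {..<N}"
  shows "integrable (circuit_measure N \<mu> n) (\<lambda>g. quad (set_amp (run_circuit n g \<psi>)) X Y Z W)"
proof -
  interpret c: prob_space "circuit_measure N \<mu> n"
    by (rule prob_space_circuit)
  have "AE g in circuit_measure N \<mu> n. norm (quad (set_amp (run_circuit n g \<psi>)) X Y Z W) \<le> 1"
    using AE_pure_circuit[OF assms(1), of n]
    by eventually_elim (auto simp: is_pure_state_sts intro!: norm_ten_le[OF _ assms(2-5)])
  then show ?thesis
    by (rule c.integrable_const_bound) (intro measurable_ten measurable_run_circuit order.refl)
qed

section \<open>Integrating out the last gate\<close>

lemma integral_ten_apply1: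
  assumes "X \<subseteq> {..<N}" "Y \<subseteq> {..<N}" "Z \<subseteq> {..<N}" "W \<subseteq> {..<N}"
  shows "(\<integral>U. quad (set_amp (apply1 U q \<psi>)) X Y Z W \<partial>\<mu>) = twirl_at q (quad (set_amp \<psi>)) X Y Z W"
  unfolding twirl_at_def ten_apply1[OF assms[THEN finite_subset[OF _ finite_lessThan]]]
  by (rule haar_twirl[OF haar])

lemma integral_ten_gate_fixed:
  assumes ct: "c < N" "t < N" "c \<noteq> t" and pure: "is_pure_state N \<psi>"
    and sub: "X \<subseteq> {..<N}" "Y \<subseteq> {..<N}" "Z \<subseteq> {..<N}" "W \<subseteq> {..<N}"
  shows "(\<integral>y. quad (set_amp (apply_gate ((c, t), y) \<psi>)) X Y Z W \<partial>(\<mu> \<Otimes>\<^sub>M \<mu>)) = gate_avg c t (quad (set_amp \<psi>)) X Y Z W"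
proof -
  note sub' = sub[THEN cflip_subset[OF ct(2), of _ c]]
  let ?f = "\<lambda>U V. quad (set_amp (cnot c t (apply1 U c (apply1 V t \<psi>)))) X Y Z W"
  have "integrable (\<mu> \<Otimes>\<^sub>M \<mu>) (case_prod ?f)"
  proof (rule mm.integrable_const_bound)
    from AE_unitary_pair show "AE y in \<mu> \<Otimes>\<^sub>M \<mu>. norm (case_prod ?f y) \<le> 1"
    proof eventually_elim
      case (elim y)
      then have "is_pure_state N (cnot c t (apply1 (fst y) c (apply1 (snd y) t \<psi>)))"
        using ct pure by (intro pure_cnot pure_apply1) auto
      then show ?case using norm_ten_le[OF _ sub] by (simp add: is_pure_state_sts case_prod_unfold)
    qed
    show "case_prod ?f \<in> borel_measurable (\<mu> \<Otimes>\<^sub>M \<mu>)"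
      unfolding case_prod_unfold cnot_def
      by (intro measurable_ten measurable_apply1 measurable_to_borel) measurable
  qed
  \<comment> \<open>Fubini with U innermost: U acts after V, so the state already rotated by V is
    constant while U is averaged.\<close>
  then have "(\<integral>y. case_prod ?f y \<partial>(\<mu> \<Otimes>\<^sub>M \<mu>)) = (\<integral>V. (\<integral>U. ?f U V \<partial>\<mu>) \<partial>\<mu>)"
    by (rule mm.integral_snd[symmetric])
  also have "\<dots> = (\<integral>V. twirl_at c (quad (set_amp (apply1 V t \<psi>))) (cflip c t X) (cflip c t Y) (cflip c t Z) (cflip c t W) \<partial>\<mu>)"
    unfolding ten_cnot[OF ct(3) sub] integral_ten_apply1[OF sub'] ..
  also have "\<dots> = twirl_at c (\<lambda>X Y Z W. \<integral>V. quad (set_amp (apply1 V t \<psi>)) X Y Z W \<partial>\<mu>) (cflip c t X) (cflip c t Y) (cflip c t Z) (cflip c t W)"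
  proof (rule twq_integral(1)[OF ct(1) sub'])
    fix X Y Z W assume s: "X \<subseteq> {..<N}" "Y \<subseteq> {..<N}" "Z \<subseteq> {..<N}" "W \<subseteq> {..<N}"
    show "integrable \<mu> (\<lambda>V. quad (set_amp (apply1 V t \<psi>)) X Y Z W)"
    proof (rule mu.integrable_const_bound)
      show "AE V in \<mu>. norm (quad (set_amp (apply1 V t \<psi>)) X Y Z W) \<le> 1"
        using haar_AE[OF haar]
        by eventually_elim (use pure_apply1[OF _ ct(2) pure] norm_ten_le[OF _ s] in \<open>auto simp: is_pure_state_sts\<close>)
      show "(\<lambda>V. quad (set_amp (apply1 V t \<psi>)) X Y Z W) \<in> borel_measurable \<mu>"
        by (intro measurable_ten measurable_apply1 measurable_to_borel) measurable
    qed
  qed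
  also have "\<dots> = gate_avg c t (quad (set_amp \<psi>)) X Y Z W"
    unfolding gate_avg_def twirl_at_def[of c]
    using sub' ct(1) by (simp add: integral_ten_apply1 ins_subset)
  finally show ?thesis by (simp add: apply_gate_def case_prod_unfold)
qed

lemma integral_ten_gate:
  assumes pure: "is_pure_state N \<psi>"
    and sub: "X \<subseteq> {..<N}" "Y \<subseteq> {..<N}" "Z \<subseteq> {..<N}" "W \<subseteq> {..<N}"
  shows "(\<integral>w. quad (set_amp (apply_gate w \<psi>)) X Y Z W \<partial>gate_measure N \<mu>)
    = (\<Sum>(c,t)\<in>offdiag_pairs N. gate_avg c t (quad (set_amp \<psi>)) X Y Z W) / of_real (real N * (real N - 1))"
proof -
  have int: "integrable (gate_measure N \<mu>) (\<lambda>w. quad (set_amp (apply_gate w \<psi>)) X Y Z W)"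
  proof (rule gate.integrable_const_bound)
    show "AE w in gate_measure N \<mu>. norm (quad (set_amp (apply_gate w \<psi>)) X Y Z W) \<le> 1"
      using AE_good_gate
      by eventually_elim (use pure_apply_gate[OF _ pure] norm_ten_le[OF _ sub] in \<open>auto simp: is_pure_state_sts\<close>)
    have "(\<lambda>w. quad (set_amp (apply_gate (fst w, (fst (snd w), snd (snd w))) \<psi>)) X Y Z W) \<in> borel_measurable (gate_measure N \<mu>)"
      unfolding gate_measure_def
      by (intro measurable_ten measurable_apply_gate measurable_to_borel) measurable
    then show "(\<lambda>w. quad (set_amp (apply_gate w \<psi>)) X Y Z W) \<in> borel_measurable (gate_measure N \<mu>)" by simp
  qed
  have "(\<integral>w. quad (set_amp (apply_gate w \<psi>)) X Y Z W \<partial>gate_measure N \<mu>)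
    = (\<integral>p. (\<integral>y. quad (set_amp (apply_gate (p, y) \<psi>)) X Y Z W \<partial>(\<mu> \<Otimes>\<^sub>M \<mu>)) \<partial>uniform_count_measure (offdiag_pairs N))"
    using gm.integral_fst'[OF int[unfolded gate_measure_def]] by (simp add: gate_measure_def)
  also have "\<dots> = (\<Sum>p\<in>offdiag_pairs N. (1 / real (card (offdiag_pairs N))) *\<^sub>R (\<integral>y. quad (set_amp (apply_gate (p, y) \<psi>)) X Y Z W \<partial>(\<mu> \<Otimes>\<^sub>M \<mu>)))"
    unfolding uniform_count_measure_def by (rule lebesgue_integral_point_measure_finite) auto
  also have "\<dots> = (\<Sum>(c,t)\<in>offdiag_pairs N. (1 / (real N * (real N - 1))) *\<^sub>R gate_avg c t (quad (set_amp \<psi>)) X Y Z W)"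
  proof (rule sum.cong[OF refl], clarify)
    fix c t assume "(c, t) \<in> offdiag_pairs N"
    moreover have "real (card (offdiag_pairs N)) = real N * (real N - 1)"
      using N by (intro card_offdiag_pairs) simp
    ultimately show "(1 / real (card (offdiag_pairs N))) *\<^sub>R (\<integral>y. quad (set_amp (apply_gate ((c, t), y) \<psi>)) X Y Z W \<partial>(\<mu> \<Otimes>\<^sub>M \<mu>))
      = (1 / (real N * (real N - 1))) *\<^sub>R gate_avg c t (quad (set_amp \<psi>)) X Y Z W"
      using integral_ten_gate_fixed[OF _ _ _ pure sub, of c t] by (simp add: offdiag_pairs_def)
  qed
  also have "\<dots> = (1 / (real N * (real N - 1))) *\<^sub>R (\<Sum>(c,t)\<in>offdiag_pairs N. gate_avg c t (quad (set_amp \<psi>)) X Y Z W)"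
    by (simp add: scaleR_sum_right case_prod_unfold)
  finally show ?thesis by (simp add: scaleR_conv_of_real)
qed

text \<open>The purity is linear in \<open>quad\<close>, so the expectation can be taken on the
  whole tensor, where one random gate acts linearly.\<close>

definition mean_ten :: "(nat \<Rightarrow> complex) \<Rightarrow> nat \<Rightarrow> tensor" where
  "mean_ten \<psi> n X Y Z W = (\<integral>g. quad (set_amp (run_circuit n g \<psi>)) X Y Z W \<partial>circuit_measure N \<mu> n)"

lemma mean_ten_Suc:
  assumes pure: "is_pure_state N \<psi>"
    and sub: "X \<subseteq> {..<N}" "Y \<subseteq> {..<N}" "Z \<subseteq> {..<N}" "W \<subseteq> {..<N}"
  shows "mean_ten \<psi> (Suc n) X Y Z W
    = (\<Sum>(c,t)\<in>offdiag_pairs N. gate_avg c t (mean_ten \<psi> n) X Y Z W) / of_real (real N * (real N - 1))"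
proof -
  have I: "(\<integral>g. gate_avg c t (quad (set_amp (run_circuit n g \<psi>))) X Y Z W \<partial>circuit_measure N \<mu> n) = gate_avg c t (mean_ten \<psi> n) X Y Z W"
    "integrable (circuit_measure N \<mu> n) (\<lambda>g. gate_avg c t (quad (set_amp (run_circuit n g \<psi>))) X Y Z W)"
    if "(c, t) \<in> offdiag_pairs N" for c t
    unfolding mean_ten_def[abs_def]
    by (rule gate_avg_integral[OF _ _ sub integrable_ten_circuit[OF pure]]; use that in \<open>simp add: offdiag_pairs_def\<close>)+
  have int: "integrable (Pi\<^sub>M (insert n {..<n}) (\<lambda>_. gate_measure N \<mu>)) (\<lambda>g. quad (set_amp (run_circuit (Suc n) g \<psi>)) X Y Z W)"
    using integrable_ten_circuit[OF pure sub, of "Suc n"] unfolding circuit_measure_def lessThan_Suc .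
  \<comment> \<open>Coordinate n holds the gate applied last and is integrated innermost; the state
    after the first n gates does not read it.\<close>
  have "mean_ten \<psi> (Suc n) X Y Z W
     = (\<integral>g. (\<integral>w. quad (set_amp (run_circuit (Suc n) (g(n := w)) \<psi>)) X Y Z W \<partial>gate_measure N \<mu>) \<partial>circuit_measure N \<mu> n)"
    unfolding mean_ten_def circuit_measure_def lessThan_Suc
    by (rule circ.product_integral_insert[OF _ _ int]) auto
  also have "\<dots> = (\<integral>g. (\<integral>w. quad (set_amp (apply_gate w (run_circuit n g \<psi>))) X Y Z W \<partial>gate_measure N \<mu>) \<partial>circuit_measure N \<mu> n)"
    by (simp add: run_circuit_upd)
  also have "\<dots> = (\<integral>g. (\<Sum>(c,t)\<in>offdiag_pairs N. gate_avg c t (quad (set_amp (run_circuit n g \<psi>))) X Y Z W) / of_real (real N * (real N - 1)) \<partial>circuit_measure N \<mu> n)"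
  proof (rule integral_cong_AE)
    show "AE g in circuit_measure N \<mu> n. (\<integral>w. quad (set_amp (apply_gate w (run_circuit n g \<psi>))) X Y Z W \<partial>gate_measure N \<mu>)
      = (\<Sum>(c,t)\<in>offdiag_pairs N. gate_avg c t (quad (set_amp (run_circuit n g \<psi>))) X Y Z W) / of_real (real N * (real N - 1))"
      using AE_pure_circuit[OF pure, of n] by eventually_elim (rule integral_ten_gate[OF _ sub])
    have [measurable]: "(\<lambda>y. run_circuit n (fst y) \<psi> x) \<in> borel_measurable (circuit_measure N \<mu> n \<Otimes>\<^sub>M gate_measure N \<mu>)" for x
      by (rule measurable_compose[OF measurable_fst measurable_run_circuit]) simp
    have "(\<lambda>y. quad (set_amp (apply_gate (fst (snd y), (fst (snd (snd y)), snd (snd (snd y)))) (run_circuit n (fst y) \<psi>))) X Y Z W)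
       \<in> borel_measurable (circuit_measure N \<mu> n \<Otimes>\<^sub>M gate_measure N \<mu>)"
    proof (intro measurable_ten measurable_apply_gate)
      show "(\<lambda>y. fst (snd y)) \<in> circuit_measure N \<mu> n \<Otimes>\<^sub>M gate_measure N \<mu> \<rightarrow>\<^sub>M uniform_count_measure (offdiag_pairs N)"
        unfolding gate_measure_def by measurable
      show "(\<lambda>y. fst (snd (snd y))) \<in> borel_measurable (circuit_measure N \<mu> n \<Otimes>\<^sub>M gate_measure N \<mu>)"
        unfolding gate_measure_def by (rule measurable_to_borel) measurable
      show "(\<lambda>y. snd (snd (snd y))) \<in> borel_measurable (circuit_measure N \<mu> n \<Otimes>\<^sub>M gate_measure N \<mu>)"
        unfolding gate_measure_def by (rule measurable_to_borel) measurable
    qed measurable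
    then show "(\<lambda>g. \<integral>w. quad (set_amp (apply_gate w (run_circuit n g \<psi>))) X Y Z W \<partial>gate_measure N \<mu>)
       \<in> borel_measurable (circuit_measure N \<mu> n)"
      by (intro gate.borel_measurable_lebesgue_integral) (simp add: case_prod_unfold)
    show "(\<lambda>g. (\<Sum>(c,t)\<in>offdiag_pairs N. gate_avg c t (quad (set_amp (run_circuit n g \<psi>))) X Y Z W) / of_real (real N * (real N - 1)))
       \<in> borel_measurable (circuit_measure N \<mu> n)"
      using I(2) by (intro borel_measurable_divide borel_measurable_sum) (auto dest!: borel_measurable_integrable)
  qed
  also have "\<dots> = (\<Sum>(c,t)\<in>offdiag_pairs N. \<integral>g. gate_avg c t (quad (set_amp (run_circuit n g \<psi>))) X Y Z W \<partial>circuit_measure N \<mu> n) / of_real (real N * (real N - 1))"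
  proof -
    have "(\<integral>g. (\<Sum>p\<in>offdiag_pairs N. case p of (c,t) \<Rightarrow> gate_avg c t (quad (set_amp (run_circuit n g \<psi>))) X Y Z W) \<partial>circuit_measure N \<mu> n)
      = (\<Sum>p\<in>offdiag_pairs N. \<integral>g. (case p of (c,t) \<Rightarrow> gate_avg c t (quad (set_amp (run_circuit n g \<psi>))) X Y Z W) \<partial>circuit_measure N \<mu> n)"
      by (rule Bochner_Integration.integral_sum) (use I(2) in auto)
    then show ?thesis by (simp add: case_prod_unfold)
  qed
  also have "\<dots> = (\<Sum>(c,t)\<in>offdiag_pairs N. gate_avg c t (mean_ten \<psi> n) X Y Z W) / of_real (real N * (real N - 1))"
    by (intro arg_cong[where f="\<lambda>x. x / _"] sum.cong refl) (use I(1) in auto)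
  finally show ?thesis .
qed


lemma Re_pur_mean_ten_Suc:
  assumes "is_pure_state N \<psi>"
  shows "Re (purity N S (mean_ten \<psi> (Suc n))) = pair_mean N (\<lambda>(c,t). Re (purity N S (gate_avg c t (mean_ten \<psi> n))))"
proof -
  let ?r = "complex_of_real (real N * (real N - 1))"
  have "purity N S (mean_ten \<psi> (Suc n)) = purity N S (\<lambda>X Y Z W.
      (\<Sum>(c,t)\<in>offdiag_pairs N. gate_avg c t (mean_ten \<psi> n) X Y Z W) / ?r)"
    by (rule pur_cong) (rule mean_ten_Suc[OF assms])
  also have "\<dots> = (\<Sum>X\<in>Pow {..<N}. \<Sum>Y\<in>Pow {..<N}. \<Sum>p\<in>offdiag_pairs N.
      (case p of (c,t) \<Rightarrow> gate_avg c t (mean_ten \<psi> n) X Y (mix S X Y) (mix S Y X))) / ?r"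
    by (simp add: purity_def sum_divide_distrib)
  also have "(\<Sum>X\<in>Pow {..<N}. \<Sum>Y\<in>Pow {..<N}. \<Sum>p\<in>offdiag_pairs N.
      (case p of (c,t) \<Rightarrow> gate_avg c t (mean_ten \<psi> n) X Y (mix S X Y) (mix S Y X)))
    = (\<Sum>X\<in>Pow {..<N}. \<Sum>p\<in>offdiag_pairs N. \<Sum>Y\<in>Pow {..<N}.
      (case p of (c,t) \<Rightarrow> gate_avg c t (mean_ten \<psi> n) X Y (mix S X Y) (mix S Y X)))"
    by (rule sum.cong[OF refl], rule sum.swap)
  also have "\<dots> = (\<Sum>p\<in>offdiag_pairs N. \<Sum>X\<in>Pow {..<N}. \<Sum>Y\<in>Pow {..<N}.
      (case p of (c,t) \<Rightarrow> gate_avg c t (mean_ten \<psi> n) X Y (mix S X Y) (mix S Y X)))"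
    by (rule sum.swap)
  also have "\<dots> = (\<Sum>(c,t)\<in>offdiag_pairs N. purity N S (gate_avg c t (mean_ten \<psi> n)))"
    by (simp add: purity_def case_prod_unfold)
  finally have e: "purity N S (mean_ten \<psi> (Suc n)) = (\<Sum>(c,t)\<in>offdiag_pairs N. purity N S (gate_avg c t (mean_ten \<psi> n))) / ?r" .
  have "Re (x / complex_of_real r) = Re x / r" for x r by (simp add: complex_is_Real_iff Re_divide_of_real)
  then show ?thesis unfolding e pair_mean_def by (simp add: case_prod_unfold)
qed

lemma mean_ten_0: "mean_ten \<psi> 0 = quad (set_amp \<psi>)"
proof -
  interpret c: prob_space "circuit_measure N \<mu> 0"
    by (rule prob_space_circuit)
  show ?thesis by (intro ext) (simp add: mean_ten_def c.prob_space)
qed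

lemma mean_purity_circuit:
  assumes pure: "is_pure_state N \<psi>" and A: "A \<subseteq> {..<N}" "card A \<le> N - card A" and e: "0 < e" "e < 1"
    and n: "real n \<ge> 9 * real N * (real N - 1) / 4 * ((3 * ln 2) * real N + ln (1 / e))"
  shows "(\<integral>g. 2 ^ card A * Re (purity N A (quad (set_amp (run_circuit n g \<psi>)))) \<partial>circuit_measure N \<mu> n)
    \<le> 1 + 2 powr (- (real (N - card A) - real (card A))) + e"
    and "integrable (circuit_measure N \<mu> n) (\<lambda>g. 2 ^ card A * Re (purity N A (quad (set_amp (run_circuit n g \<psi>)))))"
proof -
  have sub: "mix A X Y \<subseteq> {..<N}" if "X \<subseteq> {..<N}" "Y \<subseteq> {..<N}" for X Y using that by (auto simp: mix_def)
  have int: "integrable (circuit_measure N \<mu> n) (\<lambda>g. quad (set_amp (run_circuit n g \<psi>)) X Y (mix A X Y) (mix A Y X))"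
    if "X \<in> Pow {..<N}" "Y \<in> Pow {..<N}" for X Y
    using that by (intro integrable_ten_circuit[OF pure] sub) auto
  have int': "integrable (circuit_measure N \<mu> n) (\<lambda>g. purity N A (quad (set_amp (run_circuit n g \<psi>))))"
    unfolding purity_def by (intro Bochner_Integration.integrable_sum int)
  then show "integrable (circuit_measure N \<mu> n) (\<lambda>g. 2 ^ card A * Re (purity N A (quad (set_amp (run_circuit n g \<psi>)))))"
    by simp
  have "(\<integral>g. purity N A (quad (set_amp (run_circuit n g \<psi>))) \<partial>circuit_measure N \<mu> n) = purity N A (mean_ten \<psi> n)"
    unfolding purity_def mean_ten_def
    by (subst Bochner_Integration.integral_sum, intro Bochner_Integration.integrable_sum int, assumption+)
       (intro sum.cong refl Bochner_Integration.integral_sum int)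
  then have "(\<integral>g. 2 ^ card A * Re (purity N A (quad (set_amp (run_circuit n g \<psi>)))) \<partial>circuit_measure N \<mu> n)
    = 2 ^ card A * Re (purity N A (mean_ten \<psi> n))"
    using int' by simp
  also have "\<dots> \<le> 1 + 2 powr (- (real (N - card A) - real (card A))) + e"
  proof (rule mean_purity_bound[where q = "\<lambda>k S. 2 ^ card S * Re (purity N S (mean_ten \<psi> k))", OF N A e _ _ _ _ n])
    have p: "pure_set N (set_amp \<psi>)" using pure by (simp add: is_pure_state_sts)
    show "\<bar>2 ^ card S * Re (purity N S (mean_ten \<psi> 0))\<bar> \<le> 2 ^ card S" for S
      using norm_pur_le[OF p, of S] abs_Re_le_cmod[of "purity N S (quad (set_amp \<psi>))"]
      by (simp add: mean_ten_0 abs_mult)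
    have sq: "z * cnj z = complex_of_real ((cmod z)\<^sup>2)" for z by (rule complex_norm_square[symmetric])
    \<comment> \<open>For S empty or full, \<open>mix\<close> keeps or exchanges the two copies as a
      whole, so the purity factors into two squared norms.\<close>
    have "purity N {} (quad (set_amp \<psi>)) = complex_of_real (\<Sum>X\<in>Pow {..<N}. \<Sum>Y\<in>Pow {..<N}. (cmod (set_amp \<psi> X))\<^sup>2 * (cmod (set_amp \<psi> Y))\<^sup>2)"
      unfolding purity_def of_real_sum of_real_mult sq[symmetric]
      by (intro sum.cong refl) (simp add: quad_def mix_def)
    then show "2 ^ card {} * Re (purity N {} (mean_ten \<psi> 0)) = 1"
      by (simp add: mean_ten_0 sum_pure_square[OF p])
    have "purity N {..<N} (quad (set_amp \<psi>)) = complex_of_real (\<Sum>X\<in>Pow {..<N}. \<Sum>Y\<in>Pow {..<N}. (cmod (set_amp \<psi> X))\<^sup>2 * (cmod (set_amp \<psi> Y))\<^sup>2)"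
      unfolding purity_def of_real_sum of_real_mult sq[symmetric]
    proof (intro sum.cong refl)
      fix X Y assume "X \<in> Pow {..<N}" "Y \<in> Pow {..<N}"
      then have "mix {..<N} X Y = Y" "mix {..<N} Y X = X" by (auto simp: mix_def)
      then show "quad (set_amp \<psi>) X Y (mix {..<N} X Y) (mix {..<N} Y X) = set_amp \<psi> X * cnj (set_amp \<psi> X) * (set_amp \<psi> Y * cnj (set_amp \<psi> Y))"
        by (simp add: quad_def)
    qed
    then show "2 ^ card {..<N} * Re (purity N {..<N} (mean_ten \<psi> 0)) = 2 ^ N"
      by (simp add: mean_ten_0 sum_pure_square[OF p])
    show "2 ^ card S * Re (purity N S (mean_ten \<psi> (Suc k)))
       = pair_mean N (\<lambda>(c,t). pair_q c t (\<lambda>S. 2 ^ card S * Re (purity N S (mean_ten \<psi> k))) S)"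
      if "S \<subseteq> {..<N}" for k S
      unfolding Re_pur_mean_ten_Suc[OF pure] pair_mean_cmult[symmetric]
      by (rule pair_mean_cong) (use pur_gate_avg_pair_q that in simp)
  qed
  finally show "(\<integral>g. 2 ^ card A * Re (purity N A (quad (set_amp (run_circuit n g \<psi>)))) \<partial>circuit_measure N \<mu> n)
    \<le> 1 + 2 powr (- (real (N - card A) - real (card A))) + e" .
qed

end

section \<open>The bipartition\<close>

text \<open>One half of \<open>join_idx\<close> read as a set: the qubits of S that carry the 1 bits
  of a.\<close>

definition scatter :: "nat set \<Rightarrow> nat \<Rightarrow> nat set" where
  "scatter S a = (!) (sorted_list_of_set S) ` {i. i < card S \<and> bit a i}"

lemma bij_betw_scatter:
  assumes "finite S"
  shows "bij_betw (scatter S) {..<2 ^ card S} (Pow S)"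
proof -
  let ?l = "sorted_list_of_set S"
  have nth: "bij_betw ((!) ?l) {..<card S} S"
    by (rule bij_betw_nth) (use assms in auto)
  then have im: "bij_betw ((`) ((!) ?l)) (Pow {..<card S}) (Pow S)"
    by (rule bij_betw_Pow)
  have dec: "bij_betw set_decode {..<2 ^ card S} (Pow {..<card S})"
  proof (rule bij_betw_byWitness[where f' = set_encode])
    have enc: "set_encode ` Pow {..<card S} = {..<2 ^ card S}"
      by (rule bij_betw_imp_surj_on[OF bij_betw_set_encode])
    then show "set_encode ` Pow {..<card S} \<subseteq> {..<2 ^ card S}" by simp
    show d: "\<forall>X\<in>Pow {..<card S}. set_decode (set_encode X) = X"
      by (auto intro!: set_encode_inverse finite_subset[OF _ finite_lessThan])
    show "set_decode ` {..<2 ^ card S} \<subseteq> Pow {..<card S}"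
      unfolding enc[symmetric] using d by (auto simp: image_image)
  qed simp
  have "bij_betw ((`) ((!) ?l) \<circ> set_decode) {..<2 ^ card S} (Pow S)"
    by (rule bij_betw_trans[OF dec im])
  moreover have "((`) ((!) ?l) \<circ> set_decode) a = scatter S a" if "a \<in> {..<2 ^ card S}" for a
  proof -
    have "set_decode a \<subseteq> {..<card S}" using dec that by (auto simp: bij_betw_def)
    then have "set_decode a = {i. i < card S \<and> bit a i}" by (auto simp: set_decode_def bit_iff_odd)
    then show ?thesis by (simp add: scatter_def)
  qed
  ultimately show ?thesis using bij_betw_cong[of "{..<2 ^ card S}" "(`) ((!) ?l) \<circ> set_decode" "scatter S" "Pow S"] by blast
qed

lemma scatter_subset: "finite S \<Longrightarrow> scatter S a \<subseteq> S"
  unfolding scatter_def using nth_mem[of _ "sorted_list_of_set S"] by auto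

lemma sum_scatter:
  assumes "finite S"
  shows "(\<Sum>i<length (sorted_list_of_set S). if bit a i then 2 ^ (sorted_list_of_set S ! i) else 0) = set_encode (scatter S a)"
proof -
  let ?l = "sorted_list_of_set S"
  have "inj_on ((!) ?l) {i. i < card S \<and> bit a i}"
    using assms by (auto simp: inj_on_def nth_eq_iff_index_eq)
  then have "set_encode (scatter S a) = (\<Sum>i | i < card S \<and> bit a i. 2 ^ (?l ! i))"
    unfolding set_encode_def scatter_def by (simp add: sum.reindex)
  also have "\<dots> = (\<Sum>i<card S. if bit a i then 2 ^ (?l ! i) else 0)"
    by (rule sum.mono_neutral_cong_left) auto
  finally show ?thesis using assms by simp
qed

context
  fixes N :: nat and A :: "nat set"
  assumes A: "A \<subseteq> {..<N}"
begin

lemma finA: "finite A" using A finite_subset by blast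

lemma card_compl: "card ({..<N} - A) = N - card A"
  using card_Diff_subset[OF finA A] by simp

lemma join_idx_eq: "join_idx N A a b = set_encode (scatter A a \<union> scatter ({..<N} - A) b)"
proof -
  have fin: "finite (scatter A a)" "finite (scatter ({..<N} - A) b)"
    using scatter_subset[of A a] scatter_subset[of "{..<N} - A" b] finA by (auto intro: finite_subset)
  have disj: "scatter A a \<inter> scatter ({..<N} - A) b = {}"
    using scatter_subset[of A a] scatter_subset[of "{..<N} - A" b] finA by auto
  have "join_idx N A a b = set_encode (scatter A a) + set_encode (scatter ({..<N} - A) b)"
    unfolding join_idx_def Let_def using sum_scatter[OF finA, of a] sum_scatter[of "{..<N} - A" b] by simp
  also have "\<dots> = set_encode (scatter A a \<union> scatter ({..<N} - A) b)"
    unfolding set_encode_def using fin disj by (simp add: sum.union_disjoint)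
  finally show ?thesis .
qed

lemma bij_betw_join_idx:
  "bij_betw (\<lambda>(a, b). join_idx N A a b) ({..<2 ^ card A} \<times> {..<2 ^ (N - card A)}) {..<2 ^ N}"
proof -
  have 1: "bij_betw (map_prod (scatter A) (scatter ({..<N} - A))) ({..<2 ^ card A} \<times> {..<2 ^ (N - card A)})
     (Pow A \<times> Pow ({..<N} - A))"
    using bij_betw_scatter[OF finA] bij_betw_scatter[of "{..<N} - A"]
    by (intro bij_betw_map_prod) (simp_all add: card_compl)
  have 2: "bij_betw (\<lambda>(P, Q). P \<union> Q) (Pow A \<times> Pow ({..<N} - A)) (Pow {..<N})"
    by (rule bij_betw_byWitness[where f' = "\<lambda>X. (X \<inter> A, X - A)"]) (use A in auto)
  have "bij_betw (set_encode \<circ> ((\<lambda>(P, Q). P \<union> Q) \<circ> map_prod (scatter A) (scatter ({..<N} - A))))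
     ({..<2 ^ card A} \<times> {..<2 ^ (N - card A)}) {..<2 ^ N}"
    by (rule bij_betw_trans[OF bij_betw_trans[OF 1 2] bij_betw_set_encode])
  then show ?thesis by (simp add: o_def case_prod_unfold join_idx_eq)
qed

lemma sum_join_idx:
  "(\<Sum>a<2 ^ card A. \<Sum>b<2 ^ (N - card A). f (join_idx N A a b)) = (\<Sum>x<2 ^ N. f x)"
  using sum.reindex_bij_betw[OF bij_betw_join_idx, of f]
  by (simp add: sum.cartesian_product case_prod_unfold)

definition amp :: "(nat \<Rightarrow> complex) \<Rightarrow> nat \<Rightarrow> nat \<Rightarrow> complex" where
  "amp \<psi> a b = \<psi> (join_idx N A a b)"

definition rdm :: "(nat \<Rightarrow> complex) \<Rightarrow> nat \<Rightarrow> nat \<Rightarrow> complex" where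
  "rdm \<psi> a a' = (\<Sum>b<2 ^ (N - card A). amp \<psi> a b * cnj (amp \<psi> a' b))"

lemma reduced_dm_eq:
  "reduced_dm N A \<psi> = Matrix.mat (2 ^ card A) (2 ^ card A) (\<lambda>(a, a'). rdm \<psi> a a')"
  by (simp add: reduced_dm_def rdm_def amp_def)

lemma pure_amp: "is_pure_state N \<psi> \<longleftrightarrow> (\<Sum>a<2 ^ card A. \<Sum>b<2 ^ (N - card A). (cmod (amp \<psi> a b))\<^sup>2) = 1"
  unfolding is_pure_state_def amp_def using sum_join_idx[of "\<lambda>x. (cmod (\<psi> x))\<^sup>2"] by simp

lemma inner_amp: "inner_st N \<phi> \<psi> = (\<Sum>a<2 ^ card A. \<Sum>b<2 ^ (N - card A). cnj (amp \<phi> a b) * amp \<psi> a b)"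
  unfolding inner_st_def amp_def using sum_join_idx[of "\<lambda>x. cnj (\<phi> x) * \<psi> x"] by simp

text \<open>Every amplitude matrix belongs to a state because \<open>join_idx\<close> is injective;
  maximally entangled states are later produced this way.\<close>

lemma amp_surj:
  obtains \<psi> where "\<And>a b. a < 2 ^ card A \<Longrightarrow> b < 2 ^ (N - card A) \<Longrightarrow> amp \<psi> a b = W a b"
proof -
  let ?f = "\<lambda>(a, b). join_idx N A a b" and ?D = "{..<2 ^ card A} \<times> {..<2 ^ (N - card A)}"
  have "the_inv_into ?D ?f (join_idx N A a b) = (a, b)" if "a < 2 ^ card A" "b < 2 ^ (N - card A)" for a b
    using the_inv_into_f_f[of ?f ?D "(a, b)"] bij_betw_join_idx that by (simp add: bij_betw_def)
  then show ?thesis using that[of "\<lambda>x. case the_inv_into ?D ?f x of (a, b) \<Rightarrow> W a b"] by (simp add: amp_def)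
qed

text \<open>On product indices \<open>mix\<close> exchanges the A parts of two basis states, so the
  swap sum regroups into Tr \<rho>^2.\<close>

lemma pur_amp: "purity N A (quad (set_amp \<psi>)) = (\<Sum>a<2 ^ card A. \<Sum>a'<2 ^ card A. rdm \<psi> a a' * rdm \<psi> a' a)"
proof -
  let ?d = "2 ^ card A :: nat" and ?D = "2 ^ (N - card A) :: nat"
  let ?S = "\<lambda>a b. scatter A a \<union> scatter ({..<N} - A) b"
  have s: "(\<Sum>X\<in>Pow {..<N}. f X) = (\<Sum>a<?d. \<Sum>b<?D. f (?S a b))" for f :: "nat set \<Rightarrow> complex"
  proof -
    have fin: "finite (?S a b)" for a b
      using scatter_subset[of A a] scatter_subset[of "{..<N} - A" b] finA by (auto intro: finite_subset)
    have "(\<Sum>X\<in>Pow {..<N}. f X) = (\<Sum>x<2 ^ N. f (set_decode x))"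
      using sum.reindex_bij_betw[OF bij_betw_set_encode, of "\<lambda>x. f (set_decode x)" N]
      by (simp add: finite_subset[OF _ finite_lessThan])
    also have "\<dots> = (\<Sum>a<?d. \<Sum>b<?D. f (?S a b))"
      using sum_join_idx[of "\<lambda>x. f (set_decode x)"] fin by (simp add: join_idx_eq)
    finally show ?thesis .
  qed
  have m: "mix A (?S a b) (?S a' b') = ?S a' b" for a b a' b'
    using scatter_subset[OF finA] scatter_subset[of "{..<N} - A"] by (auto simp: mix_def)
  have t: "set_amp \<psi> (?S a b) = amp \<psi> a b" for a b by (simp add: set_amp_def amp_def join_idx_eq)
  have "purity N A (quad (set_amp \<psi>)) = (\<Sum>a<?d. \<Sum>b<?D. \<Sum>a'<?d. \<Sum>b'<?D.
      amp \<psi> a b * amp \<psi> a' b' * cnj (amp \<psi> a' b) * cnj (amp \<psi> a b'))"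
    unfolding purity_def s m quad_def t ..
  also have "\<dots> = (\<Sum>a<?d. \<Sum>a'<?d. \<Sum>b<?D. \<Sum>b'<?D.
      (amp \<psi> a b * cnj (amp \<psi> a' b)) * (amp \<psi> a' b' * cnj (amp \<psi> a b')))"
    by (rule sum.cong[OF refl], subst sum.swap) (simp add: mult_ac)
  also have "\<dots> = (\<Sum>a<?d. \<Sum>a'<?d. rdm \<psi> a a' * rdm \<psi> a' a)"
    unfolding rdm_def sum_product ..
  finally show ?thesis .
qed

end

section \<open>Entropy\<close>

definition mtrace :: "complex mat \<Rightarrow> complex" where
  "mtrace M = (\<Sum>i<dim_row M. M $$ (i, i))"

lemma mtrace_mult_commute:
  assumes "X \<in> carrier_mat n m" "Y \<in> carrier_mat m n"
  shows "mtrace (X * Y) = mtrace (Y * X)"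
proof -
  have "mtrace (X * Y) = (\<Sum>i<n. \<Sum>j<m. X $$ (i, j) * Y $$ (j, i))"
    using assms by (auto simp: mtrace_def scalar_prod_def atLeast0LessThan)
  also have "\<dots> = (\<Sum>j<m. \<Sum>i<n. Y $$ (j, i) * X $$ (i, j))"
    by (subst sum.swap) (simp add: mult.commute)
  also have "\<dots> = mtrace (Y * X)"
    using assms by (auto simp: mtrace_def scalar_prod_def atLeast0LessThan)
  finally show ?thesis .
qed

lemma mtrace_similar:
  assumes "similar_mat_wit X Y P Q"
  shows "mtrace X = mtrace Y"
proof -
  define n where "n = dim_row X"
  note w = similar_mat_witD[OF n_def assms]
  have "mtrace X = mtrace (P * Y * Q)" using w(3) by simp
  also have "\<dots> = mtrace (Q * (P * Y))"
    by (rule mtrace_mult_commute[of _ n n]) (use w in auto)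
  also have "Q * (P * Y) = Q * P * Y"
    by (rule assoc_mult_mat[symmetric, of _ n n _ n _ n]) (use w in auto)
  also have "\<dots> = Y" unfolding w(2) by (rule left_mult_one_mat[OF w(5)])
  finally show ?thesis .
qed

lemma upper_triangular_pow_diag:
  assumes B: "B \<in> carrier_mat n n" and ut: "upper_triangular (B :: complex mat)"
  shows "upper_triangular (B ^\<^sub>m k) \<and> (\<forall>i<n. (B ^\<^sub>m k) $$ (i, i) = (B $$ (i, i)) ^ k)"
proof (induction k)
  case 0
  then show ?case using B by auto
next
  case (Suc k)
  let ?C = "B ^\<^sub>m k"
  have C: "?C \<in> carrier_mat n n" using B by simp
  have entry: "(?C * B) $$ (i, j) = (\<Sum>l<n. ?C $$ (i, l) * B $$ (l, j))" if "i < n" "j < n" for i j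
    using B C that by (auto simp: scalar_prod_def atLeast0LessThan)
  have z: "?C $$ (i, l) * B $$ (l, j) = 0" if "i < n" "l < n" "l < i \<or> j < l" for i j l
    using that upper_triangularD[of ?C l i] upper_triangularD[OF ut, of j l] Suc B C by auto
  have "upper_triangular (?C * B)"
  proof
    fix i j assume ji: "j < i" and "i < dim_row (?C * B)"
    then have i: "i < n" using B C by simp
    have "(\<Sum>l<n. ?C $$ (i, l) * B $$ (l, j)) = 0"
      by (intro sum.neutral ballI z) (use i ji in auto)
    then show "(?C * B) $$ (i, j) = 0" using entry i ji by simp
  qed
  moreover have "(?C * B) $$ (i, i) = (B $$ (i, i)) ^ Suc k" if i: "i < n" for i
  proof -
    have "(\<Sum>l<n. ?C $$ (i, l) * B $$ (l, i)) = (\<Sum>l\<in>{i}. ?C $$ (i, l) * B $$ (l, i))"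
    proof (rule sum.mono_neutral_right)
      show "\<forall>l\<in>{..<n} - {i}. ?C $$ (i, l) * B $$ (l, i) = 0"
        by (intro ballI z) (use i in auto)
    qed (use i in auto)
    then show ?thesis using entry[OF i i] Suc i by simp
  qed
  ultimately show ?case by simp
qed

section \<open>Eigenvalue lists, traces of powers and scalar entropy estimates\<close>

lemma eigvals_spec:
  assumes "M \<in> carrier_mat n n"
  shows "char_poly M = (\<Prod>a\<leftarrow>eigvals M. [:- a, 1:])" "length (eigvals M) = n"
proof -
  have "\<exists>as. char_poly M = (\<Prod>a\<leftarrow>as. [:- a, 1:]) \<and> length as = dim_row M"
    using char_poly_factorized[OF assms] assms by auto
  from someI_ex[OF this] show "char_poly M = (\<Prod>a\<leftarrow>eigvals M. [:- a, 1:])" "length (eigvals M) = n"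
    using assms unfolding eigvals_def by auto
qed

text \<open>Schur triangularization can put the list \<open>eigvals M\<close> itself on the
  diagonal. The power sums thus depend only on M, whichever list the choice operator
  returns.\<close>

lemma mtrace_pow_eigvals:
  assumes M: "M \<in> carrier_mat n n"
  shows "mtrace (M ^\<^sub>m k) = (\<Sum>e\<leftarrow>eigvals M. e ^ k)"
proof -
  obtain B P Q where s: "schur_decomposition M (eigvals M) = (B, P, Q)"
    by (cases "schur_decomposition M (eigvals M)") auto
  from schur_decomposition[OF M eigvals_spec(1)[OF M] s]
  have B: "similar_mat_wit M B P Q" "upper_triangular B" "diag_mat B = eigvals M" by auto
  have Bc: "B \<in> carrier_mat n n" using B(1) M unfolding similar_mat_wit_def Let_def by auto
  have "mtrace (M ^\<^sub>m k) = mtrace (B ^\<^sub>m k)"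
    by (rule mtrace_similar) (rule similar_mat_wit_pow[OF B(1)])
  also have "\<dots> = (\<Sum>i<n. (B $$ (i, i)) ^ k)"
    using upper_triangular_pow_diag[OF Bc B(2), of k] Bc by (auto simp: mtrace_def)
  also have "\<dots> = (\<Sum>e\<leftarrow>diag_mat B. e ^ k)"
    using Bc by (simp add: diag_mat_def o_def sum_list_distinct_conv_sum_set atLeast0LessThan)
  finally show ?thesis by (simp add: B(3))
qed

text \<open>Rayleigh quotient: pairing the eigenvalue equation with its eigenvector u gives e *
  |u|^2 on one side and the sum of the |s b|^2 on the other.\<close>

lemma eigvals_gram_nonneg:
  fixes m :: "nat \<Rightarrow> nat \<Rightarrow> complex"
  assumes M: "M = Matrix.mat n n (\<lambda>(a, a'). \<Sum>b<D. m a b * cnj (m a' b))" and e: "e \<in> set (eigvals M)"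
  shows "Im e = 0" "Re e \<ge> 0"
proof -
  have Mc: "M \<in> carrier_mat n n" by (simp add: M)
  have "poly (char_poly M) e = 0"
    unfolding eigvals_spec(1)[OF Mc] poly_prod_list using e by (auto simp: prod_list_zero_iff)
  then have "eigenvalue M e" using eigenvalue_root_char_poly[OF Mc] by simp
  then obtain v where v: "v \<in> carrier_vec n" "v \<noteq> 0\<^sub>v n" "M *\<^sub>v v = e \<cdot>\<^sub>v v"
    using Mc unfolding eigenvalue_def eigenvector_def by auto
  define u where "u = (\<lambda>i. vec_index v i)"
  have comp: "(\<Sum>j<n. (\<Sum>b<D. m i b * cnj (m j b)) * u j) = e * u i" if "i < n" for i
  proof -
    have "vec_index (M *\<^sub>v v) i = vec_index (e \<cdot>\<^sub>v v) i" using v by simp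
    then show ?thesis using that v(1) by (simp add: M u_def scalar_prod_def atLeast0LessThan)
  qed
  define s where "s = (\<lambda>b. \<Sum>i<n. cnj (u i) * m i b)"
  have "e * complex_of_real (\<Sum>i<n. (cmod (u i))\<^sup>2) = (\<Sum>i<n. cnj (u i) * (e * u i))"
    unfolding of_real_sum complex_norm_square sum_distrib_left by (intro sum.cong refl) simp
  also have "\<dots> = (\<Sum>i<n. cnj (u i) * (\<Sum>j<n. (\<Sum>b<D. m i b * cnj (m j b)) * u j))"
    by (intro sum.cong refl) (simp add: comp)
  also have "\<dots> = (\<Sum>i<n. \<Sum>j<n. \<Sum>b<D. (cnj (u i) * m i b) * cnj (cnj (u j) * m j b))"
    by (simp add: sum_distrib_left sum_distrib_right mult_ac)
  also have "\<dots> = (\<Sum>i<n. \<Sum>b<D. \<Sum>j<n. (cnj (u i) * m i b) * cnj (cnj (u j) * m j b))"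
    by (rule sum.cong[OF refl], rule sum.swap)
  also have "\<dots> = (\<Sum>b<D. \<Sum>i<n. \<Sum>j<n. (cnj (u i) * m i b) * cnj (cnj (u j) * m j b))"
    by (rule sum.swap)
  also have "\<dots> = (\<Sum>b<D. s b * cnj (s b))"
    unfolding s_def cnj_sum sum_product ..
  also have "\<dots> = complex_of_real (\<Sum>b<D. (cmod (s b))\<^sup>2)"
    by (simp only: of_real_sum complex_norm_square)
  finally have eq: "e * complex_of_real (\<Sum>i<n. (cmod (u i))\<^sup>2) = complex_of_real (\<Sum>b<D. (cmod (s b))\<^sup>2)" .
  have gen: "e = complex_of_real (r / t)" if "e * complex_of_real t = complex_of_real r" "t > 0" for r t
    using that by (simp add: field_simps)
  obtain i where i: "i < n" "u i \<noteq> 0"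
    using v by (metis (no_types, lifting) carrier_vecD eq_vecI index_zero_vec(1) index_zero_vec(2) u_def)
  have "0 < (cmod (u i))\<^sup>2" using i by simp
  also have "\<dots> \<le> (\<Sum>i<n. (cmod (u i))\<^sup>2)" by (rule member_le_sum) (use i in auto)
  finally have pos: "(\<Sum>i<n. (cmod (u i))\<^sup>2) > 0" .
  then have "e = complex_of_real ((\<Sum>b<D. (cmod (s b))\<^sup>2) / (\<Sum>i<n. (cmod (u i))\<^sup>2))"
    using gen[OF eq] by blast
  then show "Im e = 0" "Re e \<ge> 0" using pos by (auto intro!: divide_nonneg_pos sum_nonneg simp del: of_real_divide of_real_sum)
qed

text \<open>The tangent of ln at 1 applied to d x, hence exact at the flat value x = 1/d. Summed
  over a spectrum with total 1, the linear terms give ln d + 1 and the quadratic term gives the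
  purity.\<close>

lemma eta_lower:
  assumes "x \<ge> 0" "d > 0"
  shows "eta x \<ge> (x * ln d + x - d * x\<^sup>2) / ln 2"
proof (cases "x = 0")
  case False
  then have x: "x > 0" using assms by simp
  have "ln (d * x) \<le> d * x - 1" using x assms by (intro ln_le_minus_one) simp
  then have "x * ln (d * x) \<le> x * (d * x - 1)" using x by simp
  then have "x * ln d + x - d * x\<^sup>2 \<le> - x * ln x"
    using x assms by (simp add: ln_mult algebra_simps power2_eq_square)
  from divide_right_mono[OF this, of "ln 2"] show ?thesis using x by (simp add: eta_def log_def)
qed (simp add: eta_def)

lemma eta_bounds:
  assumes "0 \<le> x" "x \<le> 1"
  shows "0 \<le> eta x" "eta x \<le> 1 / ln 2"
proof -
  show "0 \<le> eta x" using assms by (auto simp: eta_def log_def mult_nonneg_nonpos divide_nonpos_pos)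
  show "eta x \<le> 1 / ln 2"
  proof (cases "x = 0")
    case False
    then have x: "x > 0" using assms by simp
    have "ln (1 / x) \<le> 1 / x - 1" using x by (intro ln_le_minus_one) simp
    then have "x * ln (1 / x) \<le> x * (1 / x - 1)" using x by (intro mult_left_mono) auto
    then have "- x * ln x \<le> 1" using x by (simp add: ln_div algebra_simps)
    from divide_right_mono[OF this, of "ln 2"] show ?thesis using x by (simp add: eta_def log_def)
  qed (simp add: eta_def)
qed

text \<open>Makes the entropy a pointwise limit of linear combinations of the traces \<open>Tr \<rho>\<^sup>k\<close>, and thereby measurable.\<close>

lemma eta_polynomial_limit:
  obtains a :: "nat \<Rightarrow> nat \<Rightarrow> real" and m :: "nat \<Rightarrow> nat"
  where "\<And>x. x \<ge> 0 \<Longrightarrow> (\<lambda>k. \<Sum>i\<le>m k. a k i * x ^ i) \<longlonglongrightarrow> eta x"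
proof -
  \<comment> \<open>The shift by 1 / Suc k makes the logarithm continuous at 0, where
    \<open>f k\<close> and \<open>eta\<close> both vanish; the growing intervals [0, k] reach every
    x \<ge> 0.\<close>
  define f where "f = (\<lambda>(k::nat) x. - x * log 2 (x + 1 / real (Suc k)))"
  have "\<exists>a m. \<forall>x\<in>{0..real k}. \<bar>f k x - (\<Sum>i\<le>m. a i * x ^ i)\<bar> < 1 / real (Suc k)" for k
  proof -
    have pos: "0 < x + 1 / real (Suc k)" if "x \<ge> 0" for x using that by (simp add: add_nonneg_pos)
    have "continuous_on {0..real k} (f k)"
      unfolding f_def log_def
      by (intro continuous_intros) (use pos in \<open>force simp del: of_nat_Suc\<close>)+
    from Stone_Weierstrass_real_polynomial_function[OF compact_Icc this, of "1 / real (Suc k)"]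
    obtain g where "real_polynomial_function g" "\<And>x. x \<in> {0..real k} \<Longrightarrow> \<bar>f k x - g x\<bar> < 1 / real (Suc k)"
      by (metis of_nat_0_less_iff zero_less_Suc zero_less_divide_1_iff)
    then show ?thesis unfolding real_polynomial_function_iff_sum by blast
  qed
  then obtain a m where am: "\<And>k x. x \<in> {0..real k} \<Longrightarrow> \<bar>f k x - (\<Sum>i\<le>m k. a k i * x ^ i)\<bar> < 1 / real (Suc k)"
    by metis
  have "(\<lambda>k. \<Sum>i\<le>m k. a k i * x ^ i) \<longlonglongrightarrow> eta x" if x: "x \<ge> 0" for x
  proof -
    have z: "(\<lambda>k. 1 / real (Suc k)) \<longlonglongrightarrow> 0" by (rule LIMSEQ_Suc[OF lim_1_over_n])
    have "(\<lambda>k. f k x) \<longlonglongrightarrow> eta x"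
    proof (cases "x = 0")
      case False
      then have "(\<lambda>k. - x * log 2 (x + 1 / real (Suc k))) \<longlonglongrightarrow> - x * log 2 (x + 0)"
        using x by (intro tendsto_intros z) auto
      then show ?thesis using x False by (simp add: f_def eta_def)
    qed (simp add: f_def eta_def)
    moreover have "(\<lambda>k. f k x - (\<Sum>i\<le>m k. a k i * x ^ i)) \<longlonglongrightarrow> 0"
    proof (rule Lim_null_comparison[OF _ z])
      show "\<forall>\<^sub>F k in sequentially. norm (f k x - (\<Sum>i\<le>m k. a k i * x ^ i)) \<le> 1 / real (Suc k)"
        using eventually_ge_at_top[of "nat \<lceil>x\<rceil>"]
      proof eventually_elim
        case (elim k)
        then have "x \<le> real k" by linarith
        then show ?case using am[of x k] x by (auto simp del: of_nat_Suc intro: less_imp_le)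
      qed
    qed
    ultimately have "(\<lambda>k. f k x - (f k x - (\<Sum>i\<le>m k. a k i * x ^ i))) \<longlonglongrightarrow> eta x - 0"
      by (rule tendsto_diff)
    then show ?thesis by simp
  qed
  then show ?thesis using that by blast
qed

section \<open>Overlap with maximally entangled states\<close>

definition ip :: "nat \<Rightarrow> (nat \<Rightarrow> complex) \<Rightarrow> (nat \<Rightarrow> complex) \<Rightarrow> complex" where
  "ip D f g = (\<Sum>b<D. f b * cnj (g b))"

lemma ip_add_left: "ip D (\<lambda>b. f b + g b) h = ip D f h + ip D g h"
  and ip_add_right: "ip D h (\<lambda>b. f b + g b) = ip D h f + ip D h g"
  and ip_diff_left: "ip D (\<lambda>b. f b - g b) h = ip D f h - ip D g h"
  and ip_diff_right: "ip D h (\<lambda>b. f b - g b) = ip D h f - ip D h g"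
  and ip_mult_left: "ip D (\<lambda>b. c * f b) h = c * ip D f h"
  and ip_mult_right: "ip D h (\<lambda>b. c * f b) = cnj c * ip D h f"
  by (simp_all add: ip_def algebra_simps sum.distrib sum_subtractf sum_distrib_left)

lemma ip_sum_left: "ip D (\<lambda>b. \<Sum>a\<in>S. c a * F a b) h = (\<Sum>a\<in>S. c a * ip D (F a) h)"
proof -
  have "ip D (\<lambda>b. \<Sum>a\<in>S. c a * F a b) h = (\<Sum>b<D. \<Sum>a\<in>S. c a * (F a b * cnj (h b)))"
    by (simp add: ip_def sum_distrib_right mult.assoc)
  also have "\<dots> = (\<Sum>a\<in>S. c a * ip D (F a) h)"
    by (subst sum.swap) (simp add: ip_def sum_distrib_left)
  finally show ?thesis .
qed

lemma cnj_ip: "cnj (ip D f g) = ip D g f"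
  by (simp add: ip_def mult.commute)

lemma ip_sum_right: "ip D h (\<lambda>b. \<Sum>a\<in>S. c a * F a b) = (\<Sum>a\<in>S. cnj (c a) * ip D h (F a))"
  by (subst cnj_ip[symmetric], subst ip_sum_left) (simp add: cnj_ip)

lemma ip_self: "ip D f f = complex_of_real (\<Sum>b<D. (cmod (f b))\<^sup>2)"
  by (simp only: ip_def of_real_sum complex_norm_square)

text \<open>The condition W W^* = 1. Divided by sqrt d, such a W is the amplitude matrix of a
  maximally entangled state.\<close>

definition coiso :: "nat \<Rightarrow> nat \<Rightarrow> (nat \<Rightarrow> nat \<Rightarrow> complex) \<Rightarrow> bool" where
  "coiso d D W \<longleftrightarrow> (\<forall>a<d. \<forall>a'<d. ip D (W a) (W a') = (if a = a' then 1 else 0))"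

text \<open>Compactness: the entries lie in the unit disc and orthonormality is a closed condition.
  The assumption d \<le> D supplies a point of the set, the first d unit vectors.\<close>

lemma coiso_maximizer:
  assumes "d \<le> D"
  obtains W where "coiso d D W"
    "\<And>W'. coiso d D W' \<Longrightarrow> Re (\<Sum>a<d. ip D (W' a) (M a)) \<le> Re (\<Sum>a<d. ip D (W a) (M a))"
proof -
  \<comment> \<open>Entries outside d x D are pinned to 0, so that Tychonoff's theorem applies to
    the full function type; \<open>trim\<close> brings any W into this set.\<close>
  define B :: "nat \<times> nat \<Rightarrow> complex set" where "B = (\<lambda>p. if p \<in> {..<d} \<times> {..<D} then cball 0 1 else {0})"
  define C where "C = {F :: nat \<times> nat \<Rightarrow> complex. coiso d D (curry F)}"
  have ev: "continuous_on UNIV (\<lambda>F :: nat \<times> nat \<Rightarrow> complex. F p)" for p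
    by (rule continuous_on_product_coordinates)
  have "compact (PiE UNIV B)"
  proof -
    have "compactin (product_topology (\<lambda>_. euclidean) UNIV) (PiE UNIV B)"
      by (subst compactin_PiE) (auto simp: B_def)
    then show ?thesis by (simp add: euclidean_product_topology)
  qed
  moreover have "closed C"
    unfolding C_def coiso_def ip_def curry_def imp_conv_disj
    by (intro closed_Collect_all closed_Collect_disj closed_Collect_const closed_Collect_eq continuous_intros ev)
  ultimately have comp: "compact (PiE UNIV B \<inter> C)" by (rule compact_Int_closed)
  define trim where "trim = (\<lambda>(W :: nat \<Rightarrow> nat \<Rightarrow> complex) (p :: nat \<times> nat). if p \<in> {..<d} \<times> {..<D} then W (fst p) (snd p) else 0)"
  have trim_ip: "ip D (curry (trim W) a) g = ip D (W a) g" "ip D g (curry (trim W) a) = ip D g (W a)" if "a < d" for W a g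
    using that by (simp_all add: ip_def trim_def)
  have trim: "trim W \<in> PiE UNIV B \<inter> C" if W: "coiso d D W" for W
  proof -
    have "cmod (W a b) \<le> 1" if "a < d" "b < D" for a b
    proof -
      have "complex_of_real (\<Sum>b<D. (cmod (W a b))\<^sup>2) = complex_of_real 1"
        using W that(1) by (simp only: ip_self[symmetric] coiso_def) simp
      then have "(\<Sum>b<D. (cmod (W a b))\<^sup>2) = 1" by (simp only: of_real_eq_iff)
      moreover have "(cmod (W a b))\<^sup>2 \<le> (\<Sum>b<D. (cmod (W a b))\<^sup>2)"
        by (rule member_le_sum) (use that in auto)
      ultimately show ?thesis by (simp add: power2_le_imp_le)
    qed
    then have "trim W \<in> PiE UNIV B" by (auto simp: trim_def B_def)
    moreover have "trim W \<in> C" using W by (simp add: C_def coiso_def trim_ip)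
    ultimately show ?thesis by blast
  qed
  have "coiso d D (\<lambda>a b. if a = b then 1 else 0)"
    unfolding coiso_def
  proof (intro allI impI)
    fix a a' assume a: "a < d" "a' < d"
    have "ip D (\<lambda>b. if a = b then 1 else 0) (\<lambda>b. if a' = b then 1 else 0)
       = (\<Sum>b<D. if b = a then (if a = a' then 1 else 0) else 0)"
      unfolding ip_def by (intro sum.cong) auto
    then show "ip D (\<lambda>b. if a = b then 1 else 0) (\<lambda>b. if a' = b then 1 else 0) = (if a = a' then 1 else 0)"
      using a assms by (simp only: sum.delta finite_lessThan) simp
  qed
  then have ne: "PiE UNIV B \<inter> C \<noteq> {}" using trim by blast
  define f where "f = (\<lambda>F. Re (\<Sum>a<d. ip D (curry F a) (M a)))"
  have "continuous_on (PiE UNIV B \<inter> C) f"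
    unfolding f_def ip_def curry_def
    by (rule continuous_on_subset[OF _ subset_UNIV]) (intro continuous_intros ev)
  from continuous_attains_sup[OF comp ne this]
  obtain F where F: "F \<in> PiE UNIV B \<inter> C" "\<And>G. G \<in> PiE UNIV B \<inter> C \<Longrightarrow> f G \<le> f F" by blast
  show ?thesis
  proof (rule that[of "curry F"])
    show "coiso d D (curry F)" using F by (simp add: C_def)
    fix W' assume "coiso d D W'"
    from F(2)[OF trim[OF this]]
    show "Re (\<Sum>a<d. ip D (W' a) (M a)) \<le> Re (\<Sum>a<d. ip D (curry F a) (M a))"
      by (simp add: f_def trim_ip)
  qed
qed

text \<open>Replaces the row \<open>w = u\<^sup>*W\<close> by the unit row \<open>\<alpha> w + \<beta> m\<close>.\<close>

lemma coiso_rank_one_update: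
  assumes W: "coiso d D W" and u: "(\<Sum>a<d. u a * cnj (u a)) = 1"
    and m: "\<And>a. a < d \<Longrightarrow> ip D m (W a) = 0"
    and n: "\<alpha> * cnj \<alpha> + \<beta> * cnj \<beta> * ip D m m = 1"
  defines "w \<equiv> \<lambda>b. \<Sum>a<d. cnj (u a) * W a b"
  shows "coiso d D (\<lambda>a b. W a b + u a * (((\<alpha> - 1) * w b) + \<beta> * m b))"
proof -
  define s where "s = (\<lambda>b. ((\<alpha> - 1) * w b) + \<beta> * m b)"
  have WW: "ip D (W a) (W a') = (if a = a' then 1 else 0)" if "a < d" "a' < d" for a a'
    using W that by (simp add: coiso_def)
  have wW: "ip D w (W a) = cnj (u a)" if "a < d" for a
    unfolding w_def ip_sum_left using that by (simp add: WW if_distrib cong: if_cong)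
  have Ww: "ip D (W a) w = u a" if "a < d" for a
    using wW[OF that] cnj_ip[of D w "W a"] by simp
  have Wm: "ip D (W a) m = 0" if "a < d" for a
    using m[OF that] cnj_ip[of D m "W a"] by simp
  have ww: "ip D w w = 1"
  proof -
    have "ip D w w = (\<Sum>a<d. cnj (u a) * ip D (W a) w)" by (subst w_def, rule ip_sum_left)
    then show ?thesis using u by (simp add: Ww mult.commute)
  qed
  have mw: "ip D m w = 0" unfolding w_def ip_sum_right by (simp add: m)
  then have wm: "ip D w m = 0" using cnj_ip[of D m w] by simp
  have sW: "ip D s (W a) = (\<alpha> - 1) * cnj (u a)" if "a < d" for a
    unfolding s_def ip_add_left ip_mult_left using that by (simp add: wW m)
  have Ws: "ip D (W a) s = cnj (\<alpha> - 1) * u a" if "a < d" for a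
    using sW[OF that] cnj_ip[of D s "W a"] by simp
  have "ip D s s = (\<alpha> - 1) * cnj (\<alpha> - 1) + \<beta> * cnj \<beta> * ip D m m"
    unfolding s_def by (simp add: ip_add_left ip_add_right ip_mult_left ip_mult_right ww wm mw)
  also have "\<dots> = 2 - \<alpha> - cnj \<alpha>" using n by (simp add: algebra_simps)
  finally have ss: "ip D s s = 2 - \<alpha> - cnj \<alpha>" .
  have "ip D (\<lambda>b. W a b + u a * s b) (\<lambda>b. W a' b + u a' * s b) = (if a = a' then 1 else 0)"
    if "a < d" "a' < d" for a a'
    using that by (simp add: ip_add_left ip_add_right ip_mult_left ip_mult_right WW sW Ws ss) (simp add: algebra_simps)
  then show ?thesis by (simp add: coiso_def s_def)
qed

text \<open>Replacing the row w = u^* W by \<alpha> w + \<beta> m changes the objective by (\<alpha>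
  - 1) x + \<beta> y. Maximality thus bounds Re (\<alpha> x + \<beta> y) by Re x on an ellipsoid,
  and taking \<alpha>, \<beta> along conj x, conj y leaves no room for y or for a phase of
  x.\<close>

lemma coiso_maximizer_stationary:
  assumes W: "coiso d D W"
    and max: "\<And>W'. coiso d D W' \<Longrightarrow> Re (\<Sum>a<d. ip D (W' a) (M a)) \<le> Re (\<Sum>a<d. ip D (W a) (M a))"
    and u: "(\<Sum>a<d. u a * cnj (u a)) = 1"
    and m: "\<And>a. a < d \<Longrightarrow> ip D m (W a) = 0" "Re (ip D m m) \<le> 1"
  defines "x \<equiv> \<Sum>a<d. \<Sum>a'<d. u a * cnj (u a') * ip D (W a') (M a)"
    and "y \<equiv> \<Sum>a<d. u a * ip D m (M a)"
  shows "y = 0" "Im x = 0" "Re x \<ge> 0"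
proof -
  define w where "w = (\<lambda>b. \<Sum>a<d. cnj (u a) * W a b)"
  have mm: "ip D m m = complex_of_real (Re (ip D m m))" "Re (ip D m m) \<ge> 0"
    by (simp_all add: ip_self sum_nonneg del: of_real_sum)
  have ineq: "Re (\<alpha> * x + \<beta> * y) \<le> Re x" if n: "(cmod \<alpha>)\<^sup>2 + (cmod \<beta>)\<^sup>2 * Re (ip D m m) = 1" for \<alpha> \<beta>
  proof -
    have "complex_of_real ((cmod \<alpha>)\<^sup>2 + (cmod \<beta>)\<^sup>2 * Re (ip D m m)) = 1" using n by simp
    then have n': "\<alpha> * cnj \<alpha> + \<beta> * cnj \<beta> * ip D m m = 1"
      using mm(1) by (simp only: of_real_add of_real_mult complex_norm_square)
    have x': "x = (\<Sum>a<d. u a * ip D w (M a))"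
      unfolding x_def w_def ip_sum_left by (simp add: sum_distrib_left mult.assoc)
    have E: "(\<Sum>a<d. ip D (\<lambda>b. W a b + u a * (((\<alpha> - 1) * w b) + \<beta> * m b)) (M a))
      = (\<Sum>a<d. ip D (W a) (M a)) + ((\<alpha> - 1) * x + \<beta> * y)"
      unfolding x' y_def ip_add_left ip_mult_left
      by (simp add: sum.distrib sum_distrib_left sum_subtractf algebra_simps)
    have "Re ((\<Sum>a<d. ip D (W a) (M a)) + ((\<alpha> - 1) * x + \<beta> * y)) \<le> Re (\<Sum>a<d. ip D (W a) (M a))"
      using max[OF coiso_rank_one_update[OF W u m(1) n']] unfolding E[unfolded w_def] .
    then have "Re ((\<alpha> - 1) * x + \<beta> * y) \<le> 0" by simp
    then show ?thesis by (simp add: algebra_simps)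
  qed
  \<comment> \<open>Dividing by sqrt r puts conj x, conj y on the ellipsoid |\<alpha>|^2 +
    |\<beta>|^2 |m|^2 = 1; since |m| \<le> 1, r is at most |x|^2 + |y|^2.\<close>
  define r where "r = (cmod x)\<^sup>2 + (cmod y)\<^sup>2 * Re (ip D m m)"
  show "y = 0" "Im x = 0" "Re x \<ge> 0"
  proof -
    have key: "(cmod x)\<^sup>2 + (cmod y)\<^sup>2 \<le> sqrt r * Re x"
    proof (cases "r = 0")
      case True
      then have "cmod x = 0" and y0: "(cmod y)\<^sup>2 * Re (ip D m m) = 0"
        using mm(2) unfolding r_def by (auto simp: add_nonneg_eq_0_iff)
      moreover have "y = 0"
      proof (cases "Re (ip D m m) = 0")
        case True
        then have "(\<Sum>b<D. (cmod (m b))\<^sup>2) = 0" by (simp add: ip_self del: of_real_sum)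
        then have "m b = 0" if "b < D" for b using that by (subst (asm) sum_nonneg_eq_0_iff) auto
        then show ?thesis by (simp add: y_def ip_def)
      qed (use y0 in simp)
      ultimately show ?thesis using True by simp
    next
      case False
      then have r: "r > 0" using mm(2) by (simp add: r_def less_le)
      have i: "Re (cnj x / complex_of_real (sqrt r) * x + cnj y / complex_of_real (sqrt r) * y) \<le> Re x"
      proof (rule ineq)
        have "(cmod x)\<^sup>2 / r + (cmod y)\<^sup>2 / r * Re (ip D m m) = 1"
        proof -
          have "(cmod x)\<^sup>2 / r + (cmod y)\<^sup>2 / r * Re (ip D m m) = r / r"
            by (subst (3) r_def) (simp add: add_divide_distrib)
          then show ?thesis using r by simp
        qed
        then show "(cmod (cnj x / complex_of_real (sqrt r)))\<^sup>2 + (cmod (cnj y / complex_of_real (sqrt r)))\<^sup>2 * Re (ip D m m) = 1"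
          using r by (simp add: norm_divide power_divide)
      qed
      have e: "cnj x / complex_of_real (sqrt r) * x + cnj y / complex_of_real (sqrt r) * y
         = complex_of_real (((cmod x)\<^sup>2 + (cmod y)\<^sup>2) / sqrt r)"
        by (simp add: add_divide_distrib complex_norm_square[symmetric] mult.commute[of "cnj _"])
      have "((cmod x)\<^sup>2 + (cmod y)\<^sup>2) / sqrt r \<le> Re x" using i unfolding e by (simp only: Re_complex_of_real)
      then show ?thesis using r by (simp add: divide_le_eq mult.commute)
    qed
    have rle: "r \<le> (cmod x)\<^sup>2 + (cmod y)\<^sup>2"
      unfolding r_def using m(2) mult_left_mono[of "Re (ip D m m)" 1 "(cmod y)\<^sup>2"] by simp
    have r0: "r \<ge> 0" using mm(2) by (simp add: r_def)
    have xr: "cmod x \<le> sqrt r" using mm(2) by (intro real_le_rsqrt) (simp add: r_def)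
    have sr: "sqrt r * sqrt r = r" using r0 by simp
    have "sqrt r * sqrt r \<le> sqrt r * Re x" using key rle sr by linarith
    moreover have "sqrt r * Re x \<le> sqrt r * cmod x"
      using complex_Re_le_cmod[of x] r0 by (intro mult_left_mono) auto
    ultimately have a: "sqrt r \<le> Re x \<or> sqrt r = 0"
      using r0 by (metis less_eq_real_def mult_le_cancel_left_pos real_sqrt_ge_zero)
    have Rx: "Re x = cmod x \<and> cmod x = sqrt r"
      using a xr complex_Re_le_cmod[of x] abs_Re_le_cmod[of x] norm_ge_zero[of x] by linarith
    then have "(cmod x)\<^sup>2 + (cmod y)\<^sup>2 \<le> (cmod x)\<^sup>2" using key by (simp add: power2_eq_square)
    then show "y = 0" by simp
    show "Re x \<ge> 0" using Rx norm_ge_zero[of x] by linarith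
    show "Im x = 0" using Rx cmod_power2[of x] by simp
  qed
qed


text \<open>The trace of \<open>X (X - 1)\<^sup>2 (X + 2)\<close> is nonnegative.\<close>

lemma psd_trace_inequality:
  fixes X :: "nat \<Rightarrow> nat \<Rightarrow> complex"
  assumes herm: "\<And>a b. a < d \<Longrightarrow> b < d \<Longrightarrow> X a b = cnj (X b a)"
    and psd: "\<And>u. Re (\<Sum>a<d. \<Sum>b<d. cnj (u a) * X a b * u b) \<ge> 0"
  defines "S \<equiv> \<lambda>a b. \<Sum>c<d. X a c * X c b"
  shows "2 * Re (\<Sum>a<d. X a a) \<ge> 3 * Re (\<Sum>a<d. S a a) - Re (\<Sum>a<d. \<Sum>b<d. S a b * S b a)"
proof -
  have hermS: "S a b = cnj (S b a)" if "a < d" "b < d" for a b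
    unfolding S_def cnj_sum
  proof (rule sum.cong[OF refl])
    fix c assume "c \<in> {..<d}"
    then have "X a c = cnj (X c a)" "X c b = cnj (X b c)" using herm that by blast+
    then show "X a c * X c b = cnj (X b c * X c a)" by (simp only: complex_cnj_mult mult.commute)
  qed
  define T3 where "T3 = (\<Sum>a<d. \<Sum>b<d. S a b * X b a)"
  have T3': "(\<Sum>a<d. \<Sum>b<d. X a b * S b a) = T3"
    unfolding T3_def by (subst sum.swap) (simp add: mult.commute)
  have "(\<Sum>a<d. \<Sum>b<d. (S a b - X a b) * (S b a - X b a))
     = (\<Sum>a<d. \<Sum>b<d. complex_of_real ((cmod (S a b - X a b))\<^sup>2))"
  proof (intro sum.cong refl)
    fix a b assume "a \<in> {..<d}" "b \<in> {..<d}"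
    then have "S b a = cnj (S a b)" "X b a = cnj (X a b)" using herm[of b a] hermS[of b a] by blast+
    then have "S b a - X b a = cnj (S a b - X a b)" by (simp only: complex_cnj_diff)
    then show "(S a b - X a b) * (S b a - X b a) = complex_of_real ((cmod (S a b - X a b))\<^sup>2)"
      by (simp only: complex_norm_square)
  qed
  then have "Re (\<Sum>a<d. \<Sum>b<d. (S a b - X a b) * (S b a - X b a)) \<ge> 0"
    by (simp add: sum_nonneg)
  moreover have "(\<Sum>a<d. \<Sum>b<d. (S a b - X a b) * (S b a - X b a))
    = (\<Sum>a<d. \<Sum>b<d. S a b * S b a) - (\<Sum>a<d. \<Sum>b<d. S a b * X b a) - (\<Sum>a<d. \<Sum>b<d. X a b * S b a)
      + (\<Sum>a<d. \<Sum>b<d. X a b * X b a)"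
    by (simp add: algebra_simps sum.distrib sum_subtractf)
  moreover have "(\<Sum>a<d. \<Sum>b<d. X a b * X b a) = (\<Sum>a<d. S a a)" by (simp add: S_def)
  \<comment> \<open>The squared Frobenius norm of X^2 - X, that is the trace of X^2 (X -
    1)^2.\<close>
  ultimately have A: "Re (\<Sum>a<d. \<Sum>b<d. S a b * S b a) - 2 * Re T3 + Re (\<Sum>a<d. S a a) \<ge> 0"
    unfolding T3' T3_def[symmetric] by simp
  define Y where "Y = (\<lambda>a b. X a b - (if a = b then 1 else 0))"
  have "(\<Sum>a<d. \<Sum>b<d. cnj (Y a c) * X a b * Y b c) = (\<Sum>a<d. X c a * S a c) - 2 * S c c + X c c" if c: "c < d" for c
  proof -
    have XY: "(\<Sum>b<d. X a b * Y b c) = S a c - X a c" for a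
    proof -
      have "(\<Sum>b<d. X a b * Y b c) = (\<Sum>b<d. X a b * X b c - (if b = c then X a c else 0))"
        by (intro sum.cong refl) (auto simp: Y_def algebra_simps)
      then show ?thesis using c by (simp add: sum_subtractf S_def)
    qed
    have YX: "(\<Sum>a<d. cnj (Y a c) * Z a) = (\<Sum>a<d. X c a * Z a) - Z c" for Z
    proof -
      have "(\<Sum>a<d. cnj (Y a c) * Z a) = (\<Sum>a<d. X c a * Z a - (if a = c then Z c else 0))"
      proof (rule sum.cong[OF refl])
        fix a assume "a \<in> {..<d}"
        then have "cnj (X a c) = X c a" using herm[of c a] c by simp
        then show "cnj (Y a c) * Z a = X c a * Z a - (if a = c then Z c else 0)"
          by (simp add: Y_def left_diff_distrib)
      qed
      then show ?thesis using c by (simp add: sum_subtractf)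
    qed
    have "(\<Sum>a<d. \<Sum>b<d. cnj (Y a c) * X a b * Y b c) = (\<Sum>a<d. cnj (Y a c) * (\<Sum>b<d. X a b * Y b c))"
      by (simp add: sum_distrib_left mult.assoc)
    also have "\<dots> = (\<Sum>a<d. X c a * (S a c - X a c)) - (S c c - X c c)"
      unfolding XY YX ..
    also have "(\<Sum>a<d. X c a * (S a c - X a c)) = (\<Sum>a<d. X c a * S a c) - S c c"
      by (simp add: algebra_simps sum_subtractf S_def)
    finally show ?thesis by simp
  qed
  then have "(\<Sum>c<d. \<Sum>a<d. \<Sum>b<d. cnj (Y a c) * X a b * Y b c) = T3 - 2 * (\<Sum>a<d. S a a) + (\<Sum>a<d. X a a)"
    unfolding T3'[symmetric] by (simp add: sum.distrib sum_subtractf sum_distrib_left)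
  moreover have "Re (\<Sum>c<d. \<Sum>a<d. \<Sum>b<d. cnj (Y a c) * X a b * Y b c) \<ge> 0"
    by (subst Re_sum) (intro sum_nonneg psd)
  \<comment> \<open>The trace of (X - 1) X (X - 1), with the columns of X - 1 as test vectors.
    Adding twice this to A produces the factor X^2 + 2 X = X (X + 2).\<close>
  ultimately have B: "Re T3 - 2 * Re (\<Sum>a<d. S a a) + Re (\<Sum>a<d. X a a) \<ge> 0" by simp
  show ?thesis using A B by linarith
qed

text \<open>At a maximizer \<open>W\<close> the matrix \<open>X = W M\<^sup>*\<close> is positive semidefinite and \<open>M = X W\<close>: the polar decomposition
  of \<open>M\<close>.\<close>

lemma polar_overlap:
  fixes M :: "nat \<Rightarrow> nat \<Rightarrow> complex"
  assumes "d \<le> D"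
  defines "R \<equiv> \<lambda>a a'. ip D (M a) (M a')"
  obtains W where "coiso d D W"
    "2 * Re (\<Sum>a<d. ip D (W a) (M a)) \<ge> 3 * Re (\<Sum>a<d. R a a) - Re (\<Sum>a<d. \<Sum>b<d. R a b * R b a)"
proof -
  obtain W where W: "coiso d D W"
    and max: "\<And>W'. coiso d D W' \<Longrightarrow> Re (\<Sum>a<d. ip D (W' a) (M a)) \<le> Re (\<Sum>a<d. ip D (W a) (M a))"
    using coiso_maximizer[OF assms(1), of M] by blast
  define X where "X = (\<lambda>a b. ip D (W a) (M b))"
  define Q where "Q = (\<lambda>u. \<Sum>a<d. \<Sum>b<d. cnj (u a) * X a b * u b)"
  \<comment> \<open>With m = 0 only phase rotations of the row u^* W remain; maximality under them
    makes the quadratic form of X real and nonnegative.\<close>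
  have Q: "Im (Q u) = 0 \<and> Re (Q u) \<ge> 0" for u
  proof -
    define s where "s = (\<Sum>a<d. (cmod (u a))\<^sup>2)"
    have s0: "s \<ge> 0" by (simp add: s_def sum_nonneg)
    show ?thesis
    proof (cases "s = 0")
      case True
      then have "u a = 0" if "a < d" for a using that by (subst (asm) s_def, subst (asm) sum_nonneg_eq_0_iff) auto
      then show ?thesis by (simp add: Q_def)
    next
      case False
      define v where "v = (\<lambda>a. u a / complex_of_real (sqrt s))"
      have vs: "u a = complex_of_real (sqrt s) * v a" for a using False s0 by (simp add: v_def)
      have "(\<Sum>a<d. v a * cnj (v a)) = complex_of_real (\<Sum>a<d. (cmod (v a))\<^sup>2)"
        by (simp only: of_real_sum complex_norm_square)
      also have "(\<Sum>a<d. (cmod (v a))\<^sup>2) = (\<Sum>a<d. (cmod (u a))\<^sup>2) / s"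
        using s0 by (simp add: v_def norm_divide power_divide sum_divide_distrib)
      also have "\<dots> = 1" using False by (simp add: s_def)
      finally have v1: "(\<Sum>a<d. v a * cnj (v a)) = 1" by simp
      note st = coiso_maximizer_stationary[OF W max v1, of "\<lambda>_. 0"]
      have x: "(\<Sum>a<d. \<Sum>a'<d. v a * cnj (v a') * ip D (W a') (M a)) = Q v"
        unfolding Q_def X_def by (subst sum.swap) (simp add: mult_ac)
      have "Im (Q v) = 0" "Re (Q v) \<ge> 0" using st(2,3) unfolding x by (auto simp: ip_def)
      moreover have "Q u = complex_of_real s * Q v"
      proof -
        have "complex_of_real (sqrt s) * complex_of_real (sqrt s) = complex_of_real s"
          using s0 by (simp flip: of_real_mult)
        then have uv: "cnj (u a) * X a b * u b = complex_of_real s * (cnj (v a) * X a b * v b)" for a b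
          unfolding vs[of a] vs[of b] by (simp add: mult_ac)
        show ?thesis unfolding Q_def sum_distrib_left by (simp only: uv)
      qed
      ultimately show ?thesis using s0 by simp
    qed
  qed
  have delta: "(\<Sum>i<d. (if i = a then 1 else 0) * F i) = F a" "(\<Sum>i<d. F i * (if i = a then 1 else 0)) = F a"
    if "a < d" for a and F :: "nat \<Rightarrow> complex"
  proof -
    have "(\<Sum>i<d. (if i = a then 1 else 0) * F i) = (\<Sum>i\<in>{a}. (if i = a then 1 else 0) * F i)"
      by (rule sum.mono_neutral_right) (use that in auto)
    then show "(\<Sum>i<d. (if i = a then 1 else 0) * F i) = F a" by simp
    then show "(\<Sum>i<d. F i * (if i = a then 1 else 0)) = F a" by (simp only: mult.commute)
  qed
  have Qd: "Q (\<lambda>i. if i = a then 1 else 0) = X a a" if "a < d" for a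
  proof -
    have "Q (\<lambda>i. if i = a then 1 else 0) = (\<Sum>i<d. (if i = a then 1 else 0) * (\<Sum>j<d. X i j * (if j = a then 1 else 0)))"
      unfolding Q_def by (simp only: sum_distrib_left mult.assoc if_distrib[of cnj] complex_cnj_one complex_cnj_zero)
    then show ?thesis unfolding delta[OF that] .
  qed
  have herm: "X a b = cnj (X b a)" if ab: "a < d" "b < d" for a b
  proof (cases "a = b")
    case True
    show ?thesis using Q[of "\<lambda>i. if i = a then 1 else 0"] True unfolding Qd[OF ab(1)] by (simp add: complex_eq_iff)
  next
    case False
    \<comment> \<open>Polarization: reality of the form at z = 1 and z = \<i> fixes the imaginary
      and the real part of the off-diagonal entries.\<close>
    have pol: "Q (\<lambda>i. if i = a then 1 else if i = b then z else 0) = X a a + X a b * z + cnj z * X b a + cnj z * X b b * z" for z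
    proof -
      let ?u = "\<lambda>i. if i = a then 1 else if i = b then z else 0"
      have s: "(\<Sum>i<d. F i * ?u i) = F a + F b * z" for F :: "nat \<Rightarrow> complex"
      proof -
        have "(\<Sum>i<d. F i * ?u i) = (\<Sum>i\<in>{a,b}. F i * ?u i)"
          by (rule sum.mono_neutral_right) (use ab in auto)
        then show ?thesis using False by simp
      qed
      have s': "(\<Sum>i<d. cnj (?u i) * F i) = F a + cnj z * F b" for F :: "nat \<Rightarrow> complex"
      proof -
        have "(\<Sum>i<d. cnj (?u i) * F i) = (\<Sum>i\<in>{a,b}. cnj (?u i) * F i)"
          by (rule sum.mono_neutral_right) (use ab in auto)
        then show ?thesis using False by simp
      qed
      have "Q ?u = (\<Sum>i<d. cnj (?u i) * (\<Sum>j<d. X i j * ?u j))"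
        unfolding Q_def by (simp only: sum_distrib_left mult.assoc)
      then show ?thesis unfolding s s' by (simp add: algebra_simps)
    qed
    have d: "Im (X a a) = 0" "Im (X b b) = 0"
      using Q[of "\<lambda>i. if i = a then 1 else 0"] Q[of "\<lambda>i. if i = b then 1 else 0"]
      unfolding Qd[OF ab(1)] Qd[OF ab(2)] by simp_all
    have "Im (X a b) + Im (X b a) = 0"
      using Q[of "\<lambda>i. if i = a then 1 else if i = b then 1 else 0"] unfolding pol by (simp add: d)
    moreover have "Re (X a b) - Re (X b a) = 0"
      using Q[of "\<lambda>i. if i = a then 1 else if i = b then \<i> else 0"] unfolding pol by (simp add: d)
    ultimately show ?thesis by (simp add: complex_eq_iff)
  qed
  have Mrow: "M a b = (\<Sum>a'<d. cnj (X a' a) * W a' b)" if a: "a < d" and b: "b < D" for a b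
  proof -
    \<comment> \<open>The part of row a of M orthogonal to all rows of W. Rotating a row of W
      towards it would raise the objective, so it vanishes and M = X^* W.\<close>
    define m where "m = (\<lambda>b. M a b - (\<Sum>a'<d. cnj (X a' a) * W a' b))"
    have mW: "ip D m (W c) = 0" if c: "c < d" for c
    proof -
      have "ip D m (W c) = ip D (M a) (W c) - (\<Sum>a'<d. cnj (X a' a) * ip D (W a') (W c))"
        unfolding m_def ip_diff_left ip_sum_left ..
      also have "(\<Sum>a'<d. cnj (X a' a) * ip D (W a') (W c)) = (\<Sum>a'<d. if a' = c then cnj (X c a) else 0)"
        by (intro sum.cong refl) (use W c in \<open>auto simp: coiso_def\<close>)
      also have "\<dots> = ip D (M a) (W c)" using c by (simp add: X_def cnj_ip)
      finally show ?thesis by simp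
    qed
    have mM: "ip D m (M a) = ip D m m"
    proof -
      have "ip D m m = ip D m (M a) - (\<Sum>a'<d. cnj (cnj (X a' a)) * ip D m (W a'))"
        by (subst (2) m_def) (simp only: ip_diff_right ip_sum_right)
      then show ?thesis by (simp add: mW)
    qed
    define q where "q = (\<Sum>b<D. (cmod (m b))\<^sup>2)"
    have q0: "q \<ge> 0" by (simp add: q_def sum_nonneg)
    have mq: "ip D m m = complex_of_real q" by (simp add: ip_self q_def)
    \<comment> \<open>Scales the residual to norm at most 1, since q / (1 + q)^2 \<le> 1.\<close>
    define k where "k = complex_of_real (1 / (1 + q))"
    have "ip D (\<lambda>b. k * m b) (\<lambda>b. k * m b) = k * (cnj k * ip D m m)"
      by (simp only: ip_mult_left ip_mult_right)
    also have "\<dots> = complex_of_real (q / (1 + q)\<^sup>2)" by (simp add: mq k_def power2_eq_square)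
    finally have "ip D (\<lambda>b. k * m b) (\<lambda>b. k * m b) = complex_of_real (q / (1 + q)\<^sup>2)" .
    moreover have "q / (1 + q)\<^sup>2 \<le> 1"
      using q0 by (simp add: divide_le_eq power2_eq_square algebra_simps)
    ultimately have le1: "Re (ip D (\<lambda>b. k * m b) (\<lambda>b. k * m b)) \<le> 1" by simp
    have e1: "(\<Sum>i<d. (if i = a then 1 else 0) * cnj (if i = a then 1 else 0)) = (1::complex)"
      unfolding delta(1)[OF a] by simp
    have "(\<Sum>i<d. (if i = a then 1 else 0) * ip D (\<lambda>b. k * m b) (M i)) = 0"
      by (rule coiso_maximizer_stationary(1)[OF W max e1 _ le1]) (auto simp: ip_mult_left mW)
    then have "k * ip D m m = 0"
      unfolding delta(1)[OF a] ip_mult_left mM .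
    then have "q = 0" using q0 by (auto simp: mq k_def complex_eq_iff)
    then have "m b = 0" using b by (subst (asm) q_def, subst (asm) sum_nonneg_eq_0_iff) auto
    then show ?thesis by (simp add: m_def)
  qed
  \<comment> \<open>The Gram matrix of M is X^* X with X Hermitian, so X is its positive square
    root.\<close>
  have Req: "R a c = (\<Sum>a'<d. X a a' * X a' c)" if "a < d" "c < d" for a c
  proof -
    have "R a c = ip D (\<lambda>b. \<Sum>a'<d. cnj (X a' a) * W a' b) (M c)"
      unfolding R_def ip_def by (intro sum.cong refl) (simp add: Mrow that)
    also have "\<dots> = (\<Sum>a'<d. cnj (X a' a) * X a' c)" unfolding ip_sum_left X_def ..
    also have "\<dots> = (\<Sum>a'<d. X a a' * X a' c)"
      by (intro sum.cong refl) (use herm[OF that(1)] in simp)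
    finally show ?thesis .
  qed
  have "2 * Re (\<Sum>a<d. X a a) \<ge> 3 * Re (\<Sum>a<d. \<Sum>c<d. X a c * X c a)
     - Re (\<Sum>a<d. \<Sum>b<d. (\<Sum>c<d. X a c * X c b) * (\<Sum>c<d. X b c * X c a))"
    by (rule psd_trace_inequality[of d X, OF herm]) (use Q in \<open>auto simp: Q_def\<close>)
  then have "2 * Re (\<Sum>a<d. ip D (W a) (M a)) \<ge> 3 * Re (\<Sum>a<d. R a a) - Re (\<Sum>a<d. \<Sum>b<d. R a b * R b a)"
    by (simp add: Req X_def)
  with W show ?thesis by (rule that)
qed

section \<open>Entropy and overlap of a pure state in terms of its purity\<close>

lemma Re_power_real: "Im e = 0 \<Longrightarrow> Re (e ^ k) = Re e ^ k"
proof -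
  assume "Im e = 0"
  then have "e = complex_of_real (Re e)" by (simp add: complex_eq_iff)
  then show ?thesis by (metis Re_complex_of_real of_real_power)
qed

lemma sum_list_nth_lessThan:
  "(\<Sum>e\<leftarrow>es. f e) = (\<Sum>i<length es. f (es ! i) :: 'b::comm_monoid_add)"
  by (simp add: sum_list_sum_nth atLeast0LessThan)

lemma norm_inner_le:
  assumes "is_pure_state N \<Psi>"
  shows "cmod (inner_st N \<phi> \<Psi>) \<le> (\<Sum>x<2 ^ N. cmod (\<phi> x))"
proof -
  have "cmod (\<Psi> x) \<le> 1" if "x < 2 ^ N" for x
  proof -
    have "(cmod (\<Psi> x))\<^sup>2 \<le> (\<Sum>x<2 ^ N. (cmod (\<Psi> x))\<^sup>2)" by (rule member_le_sum) (use that in auto)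
    then show ?thesis using assms by (simp add: is_pure_state_def power2_le_imp_le)
  qed
  then show ?thesis unfolding inner_st_def
    by (intro order.trans[OF norm_sum] sum_mono) (auto simp: norm_mult mult_left_le)
qed

context
  fixes N :: nat and A :: "nat set"
  assumes A: "A \<subseteq> {..<N}"
begin

lemma reduced_dm_carrier: "reduced_dm N A \<psi> \<in> carrier_mat (2 ^ card A) (2 ^ card A)"
  by (simp add: reduced_dm_def)

lemma eigvals_reduced_dm:
  assumes "e \<in> set (eigvals (reduced_dm N A \<psi>))"
  shows "Im e = 0" "Re e \<ge> 0"
  using eigvals_gram_nonneg[where n = "2 ^ card A" and D = "2 ^ (N - card A)" and m = "amp N A \<psi>", OF _ assms]
  by (simp_all add: reduced_dm_eq[OF A] rdm_def[OF A])

lemma power_sum_reduced_dm: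
  "(\<Sum>e\<leftarrow>eigvals (reduced_dm N A \<psi>). Re e ^ k) = Re (mtrace (reduced_dm N A \<psi> ^\<^sub>m k))"
  unfolding mtrace_pow_eigvals[OF reduced_dm_carrier] sum_list_nth_lessThan Re_sum
  by (intro sum.cong refl Re_power_real[symmetric] eigvals_reduced_dm(1)[where \<psi> = \<psi>]) auto

lemma mtrace_reduced_dm: "mtrace (reduced_dm N A \<psi> ^\<^sub>m 1)
    = complex_of_real (\<Sum>a<2 ^ card A. \<Sum>b<2 ^ (N - card A). (cmod (amp N A \<psi> a b))\<^sup>2)"
proof -
  have "mtrace (reduced_dm N A \<psi> ^\<^sub>m 1) = mtrace (reduced_dm N A \<psi>)"
    using left_mult_one_mat[OF reduced_dm_carrier, of \<psi>] reduced_dm_carrier[of \<psi>] by simp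
  also have "\<dots> = (\<Sum>a<2 ^ card A. rdm N A \<psi> a a)"
    by (simp add: mtrace_def reduced_dm_eq[OF A])
  also have "\<dots> = complex_of_real (\<Sum>a<2 ^ card A. \<Sum>b<2 ^ (N - card A). (cmod (amp N A \<psi> a b))\<^sup>2)"
    by (simp only: rdm_def[OF A] of_real_sum complex_norm_square)
  finally show ?thesis .
qed

lemma mtrace_reduced_dm_square: "mtrace (reduced_dm N A \<psi> ^\<^sub>m 2) = purity N A (quad (set_amp \<psi>))"
proof -
  have "reduced_dm N A \<psi> ^\<^sub>m 2 = reduced_dm N A \<psi> * reduced_dm N A \<psi>"
    using left_mult_one_mat[OF reduced_dm_carrier, of \<psi>] reduced_dm_carrier[of \<psi>] by (simp add: numeral_2_eq_2)
  then show ?thesis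
    by (simp add: mtrace_def pur_amp[OF A] reduced_dm_eq[OF A] scalar_prod_def atLeast0LessThan)
qed

text \<open>The main bound sums \<open>eta_lower\<close> over the spectrum; the two crude ones serve
  to make the entropy integrable.\<close>

lemma entanglement_bounds:
  assumes pure: "is_pure_state N \<psi>"
  shows "entanglement N A \<psi> \<ge> real (card A) - (2 ^ card A * Re (purity N A (quad (set_amp \<psi>))) - 1) / ln 2"
    and "0 \<le> entanglement N A \<psi>" "entanglement N A \<psi> \<le> 2 ^ card A / ln 2"
proof -
  define es where "es = eigvals (reduced_dm N A \<psi>)"
  define l where "l = (\<lambda>i. Re (es ! i))"
  define p where "p = Re (purity N A (quad (set_amp \<psi>)))"
  define d where "d = (2::real) ^ card A"
  have len: "length es = 2 ^ card A"
    unfolding es_def by (rule eigvals_spec(2)[OF reduced_dm_carrier])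
  have l0: "l i \<ge> 0" if "i < length es" for i
    using eigvals_reduced_dm(2)[of "es ! i" \<psi>] that by (simp add: l_def es_def)
  have s1: "(\<Sum>i<length es. l i) = 1"
    using power_sum_reduced_dm[where \<psi> = \<psi> and k = 1] mtrace_reduced_dm[of \<psi>] pure pure_amp[OF A, of \<psi>]
    by (simp add: sum_list_nth_lessThan l_def es_def del: of_real_sum pow_mat.simps)
  have s2: "(\<Sum>i<length es. (l i)\<^sup>2) = p"
    using power_sum_reduced_dm[where \<psi> = \<psi> and k = 2] mtrace_reduced_dm_square[of \<psi>]
    by (simp add: sum_list_nth_lessThan l_def es_def p_def)
  have l1: "l i \<le> 1" if "i < length es" for i
    using member_le_sum[of i "{..<length es}" l] that l0 s1 by simp
  have entry: "entanglement N A \<psi> = (\<Sum>i<length es. eta (l i))"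
    by (simp add: entanglement_def vn_entropy_def sum_list_nth_lessThan l_def es_def)
  have d: "d > 0" by (simp add: d_def)
  have "(\<Sum>i<length es. (l i * ln d + l i - d * (l i)\<^sup>2) / ln 2) \<le> entanglement N A \<psi>"
    unfolding entry by (intro sum_mono eta_lower l0 d) auto
  moreover have "(\<Sum>i<length es. (l i * ln d + l i - d * (l i)\<^sup>2) / ln 2) = (ln d + 1 - d * p) / ln 2"
    by (simp add: sum.distrib sum_subtractf s1 s2 flip: sum_divide_distrib sum_distrib_left sum_distrib_right)
  ultimately have "(ln d + 1 - d * p) / ln 2 \<le> entanglement N A \<psi>" by simp
  moreover have "ln d = real (card A) * ln 2" by (simp add: d_def ln_realpow)
  ultimately show "entanglement N A \<psi> \<ge> real (card A) - (2 ^ card A * Re (purity N A (quad (set_amp \<psi>))) - 1) / ln 2"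
    by (simp add: d_def p_def add_divide_distrib diff_divide_distrib)
  show "0 \<le> entanglement N A \<psi>" unfolding entry by (intro sum_nonneg eta_bounds l0 l1) auto
  have "entanglement N A \<psi> \<le> (\<Sum>i<length es. 1 / ln 2)"
    unfolding entry by (intro sum_mono eta_bounds l0 l1) auto
  then show "entanglement N A \<psi> \<le> 2 ^ card A / ln 2" by (simp add: len)
qed

lemma measurable_entanglement:
  assumes "\<And>x. (\<lambda>g. \<psi> g x) \<in> borel_measurable M"
  shows "(\<lambda>g. entanglement N A (\<psi> g)) \<in> borel_measurable M"
proof -
  let ?d = "2 ^ card A :: nat"
  obtain a m where am: "\<And>x. x \<ge> 0 \<Longrightarrow> (\<lambda>k. \<Sum>i\<le>m k. a k i * x ^ i) \<longlonglongrightarrow> eta x"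
    using eta_polynomial_limit by blast
  have r: "(\<lambda>g. reduced_dm N A (\<psi> g) $$ (i, j)) \<in> borel_measurable M" if "i < ?d" "j < ?d" for i j
    using assms that by (simp add: reduced_dm_def)
  have pw: "(\<lambda>g. (reduced_dm N A (\<psi> g) ^\<^sub>m k) $$ (i, j)) \<in> borel_measurable M" if "i < ?d" "j < ?d" for i j k
    using that
  proof (induction k arbitrary: i j)
    case 0
    then show ?case by (simp add: reduced_dm_def)
  next
    case (Suc k)
    have "(reduced_dm N A (\<psi> g) ^\<^sub>m Suc k) $$ (i, j)
      = (\<Sum>l<?d. (reduced_dm N A (\<psi> g) ^\<^sub>m k) $$ (i, l) * reduced_dm N A (\<psi> g) $$ (l, j))" for g
      using Suc.prems reduced_dm_carrier[of "\<psi> g"] pow_carrier_mat[OF reduced_dm_carrier[of "\<psi> g"], of k]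
      by (auto simp: scalar_prod_def atLeast0LessThan)
    then show ?case using Suc r by (simp add: borel_measurable_sum borel_measurable_times)
  qed
  have tr: "(\<lambda>g. Re (mtrace (reduced_dm N A (\<psi> g) ^\<^sub>m k))) \<in> borel_measurable M" for k
  proof -
    have "mtrace (reduced_dm N A (\<psi> g) ^\<^sub>m k) = (\<Sum>i<?d. (reduced_dm N A (\<psi> g) ^\<^sub>m k) $$ (i, i))" for g
      using pow_carrier_mat[OF reduced_dm_carrier[of "\<psi> g"], of k] by (auto simp: mtrace_def)
    then show ?thesis using pw by simp
  qed
  show ?thesis
  proof (rule borel_measurable_LIMSEQ_real)
    show "(\<lambda>g. \<Sum>i\<le>m k. a k i * Re (mtrace (reduced_dm N A (\<psi> g) ^\<^sub>m i))) \<in> borel_measurable M" for k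
      using tr by simp
    fix g
    let ?es = "eigvals (reduced_dm N A (\<psi> g))"
    have "(\<lambda>k. \<Sum>n<length ?es. \<Sum>i\<le>m k. a k i * Re (?es ! n) ^ i) \<longlonglongrightarrow> (\<Sum>n<length ?es. eta (Re (?es ! n)))"
      by (intro tendsto_sum am eigvals_reduced_dm(2)[where \<psi> = "\<psi> g"]) auto
    moreover have "(\<Sum>n<length ?es. \<Sum>i\<le>m k. a k i * Re (?es ! n) ^ i)
      = (\<Sum>i\<le>m k. a k i * Re (mtrace (reduced_dm N A (\<psi> g) ^\<^sub>m i)))" for k
      unfolding power_sum_reduced_dm[symmetric] sum_list_nth_lessThan
      by (subst sum.swap) (simp add: sum_distrib_left)
    ultimately show "(\<lambda>k. \<Sum>i\<le>m k. a k i * Re (mtrace (reduced_dm N A (\<psi> g) ^\<^sub>m i))) \<longlonglongrightarrow> entanglement N A (\<psi> g)"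
      by (simp add: entanglement_def vn_entropy_def sum_list_nth_lessThan)
  qed
qed

lemma max_entangled_of_coiso:
  assumes W: "coiso (2 ^ card A) (2 ^ (N - card A)) W"
    and amp: "\<And>a b. a < 2 ^ card A \<Longrightarrow> b < 2 ^ (N - card A) \<Longrightarrow> amp N A \<Psi> a b = W a b / complex_of_real (sqrt (2 ^ card A))"
  shows "max_entangled N A \<Psi>"
proof -
  let ?d = "2 ^ card A :: nat" and ?D = "2 ^ (N - card A) :: nat"
  have r: "rdm N A \<Psi> a a' = (if a = a' then 1 / 2 ^ card A else 0)" if "a < ?d" "a' < ?d" for a a'
  proof -
    have sq: "complex_of_real (sqrt (2 ^ card A)) * complex_of_real (sqrt (2 ^ card A)) = 2 ^ card A"
      by (simp flip: of_real_mult)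
    have "rdm N A \<Psi> a a' = (\<Sum>b<?D. W a b * cnj (W a' b) / 2 ^ card A)"
      unfolding rdm_def[OF A] using that by (intro sum.cong refl) (simp add: amp flip: sq)
    also have "\<dots> = ip ?D (W a) (W a') / 2 ^ card A" by (simp add: ip_def sum_divide_distrib)
    finally show ?thesis using W that by (simp add: coiso_def)
  qed
  have "complex_of_real (\<Sum>a<?d. \<Sum>b<?D. (cmod (amp N A \<Psi> a b))\<^sup>2) = (\<Sum>a<?d. rdm N A \<Psi> a a)"
    by (simp only: rdm_def[OF A] of_real_sum complex_norm_square)
  also have "\<dots> = complex_of_real 1" by (simp add: r)
  finally have "is_pure_state N \<Psi>" unfolding pure_amp[OF A] by (simp only: of_real_eq_iff)
  moreover have "reduced_dm N A \<Psi> = (1 / 2 ^ card A) \<cdot>\<^sub>m 1\<^sub>m (2 ^ card A)"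
    by (rule eq_matI) (auto simp: reduced_dm_eq[OF A] r)
  ultimately show ?thesis by (simp add: max_entangled_def)
qed

lemma bdd_overlap: "bdd_above ((\<lambda>\<Psi>. cmod (inner_st N \<phi> \<Psi>)) ` {\<Psi>. max_entangled N A \<Psi>})"
  by (rule bdd_aboveI2[of _ _ "\<Sum>x<2 ^ N. cmod (\<phi> x)"]) (auto simp: max_entangled_def intro!: norm_inner_le)

context
  assumes AB: "card A \<le> N - card A"
begin

text \<open>The amplitude matrix is scaled by sqrt d, so that its Gram matrix d \<rho> is the
  identity for a maximally entangled state, where 2 x \<ge> 3 x^2 - x^4 is tight.\<close>

lemma max_overlap_ge:
  assumes pure: "is_pure_state N \<psi>"
  shows "max_overlap N A \<psi> \<ge> (3 - 2 ^ card A * Re (purity N A (quad (set_amp \<psi>)))) / 2"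
proof -
  let ?d = "2 ^ card A :: nat" and ?D = "2 ^ (N - card A) :: nat"
  define s where "s = sqrt (2 ^ card A)"
  have s: "s > 0" "s * s = 2 ^ card A" by (simp_all add: s_def)
  have sc: "complex_of_real s * complex_of_real s = 2 ^ card A" using s(2) by (metis of_real_mult of_real_numeral of_real_power)
  define M where "M = (\<lambda>a b. complex_of_real s * amp N A \<psi> a b)"
  have R: "ip ?D (M a) (M a') = 2 ^ card A * rdm N A \<psi> a a'" for a a'
    unfolding M_def ip_mult_left ip_mult_right using sc by (simp add: ip_def rdm_def[OF A] flip: mult.assoc)
  have dD: "?d \<le> ?D" using AB by simp
  obtain W where W: "coiso ?d ?D W" and
    ov: "2 * Re (\<Sum>a<?d. ip ?D (W a) (M a)) \<ge> 3 * Re (\<Sum>a<?d. ip ?D (M a) (M a)) - Re (\<Sum>a<?d. \<Sum>b<?d. ip ?D (M a) (M b) * ip ?D (M b) (M a))"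
    using polar_overlap[OF dD, of M] by blast
  obtain \<Psi> where \<Psi>: "\<And>a b. a < ?d \<Longrightarrow> b < ?D \<Longrightarrow> amp N A \<Psi> a b = W a b / complex_of_real s"
    using amp_surj[OF A, of "\<lambda>a b. W a b / complex_of_real s"] by blast
  have me: "max_entangled N A \<Psi>" by (rule max_entangled_of_coiso[OF W]) (simp add: \<Psi> s_def)
  have "(\<Sum>a<?d. rdm N A \<psi> a a) = complex_of_real (\<Sum>a<?d. \<Sum>b<?D. (cmod (amp N A \<psi> a b))\<^sup>2)"
    by (simp only: rdm_def[OF A] of_real_sum complex_norm_square)
  also have "\<dots> = 1" using pure by (simp only: pure_amp[OF A] of_real_1)
  finally have t1: "Re (\<Sum>a<?d. ip ?D (M a) (M a)) = 2 ^ card A"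
    unfolding R sum_distrib_left[symmetric] by simp
  have t2: "Re (\<Sum>a<?d. \<Sum>b<?d. ip ?D (M a) (M b) * ip ?D (M b) (M a)) = 2 ^ card A * (2 ^ card A * Re (purity N A (quad (set_amp \<psi>))))"
  proof -
    have "(\<Sum>a<?d. \<Sum>b<?d. ip ?D (M a) (M b) * ip ?D (M b) (M a)) = complex_of_real (2 ^ card A * 2 ^ card A) * purity N A (quad (set_amp \<psi>))"
      unfolding R pur_amp[OF A] sum_distrib_left by (intro sum.cong refl) simp
    then show ?thesis by (simp only: Re_complex_of_real times_complex.sel Im_complex_of_real)
  qed
  have inner: "inner_st N \<psi> \<Psi> = (\<Sum>a<?d. ip ?D (W a) (M a)) / 2 ^ card A"
  proof -
    have "cnj (amp N A \<psi> a b) * amp N A \<Psi> a b = W a b * cnj (M a b) / 2 ^ card A" if "a < ?d" "b < ?D" for a b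
      using that s(1) by (simp add: \<Psi> M_def flip: sc)
    then show ?thesis unfolding inner_amp[OF A] ip_def sum_divide_distrib by simp
  qed
  have "(3 - 2 ^ card A * Re (purity N A (quad (set_amp \<psi>)))) / 2 = (3 * 2 ^ card A - 2 ^ card A * (2 ^ card A * Re (purity N A (quad (set_amp \<psi>))))) / (2 * 2 ^ card A)"
    by (simp add: field_simps)
  also have "\<dots> \<le> 2 * Re (\<Sum>a<?d. ip ?D (W a) (M a)) / (2 * 2 ^ card A)"
    using ov unfolding t1 t2 by (intro divide_right_mono) auto
  also have "\<dots> = Re (inner_st N \<psi> \<Psi>)"
  proof -
    have "Re (z / 2 ^ card A) = Re z / 2 ^ card A" for z
      using Re_divide_of_real[of z "2 ^ card A"] by simp
    then show ?thesis unfolding inner by simp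
  qed
  also have "\<dots> \<le> cmod (inner_st N \<psi> \<Psi>)" by (rule complex_Re_le_cmod)
  also have "\<dots> \<le> max_overlap N A \<psi>"
    unfolding max_overlap_def by (rule cSUP_upper[OF _ bdd_overlap]) (simp add: me)
  finally show ?thesis .
qed

lemma max_entangled_exists: "\<exists>\<Psi>. max_entangled N A \<Psi>"
proof -
  have "(2::nat) ^ card A \<le> 2 ^ (N - card A)" using AB by simp
  from coiso_maximizer[OF this] obtain W where W: "coiso (2 ^ card A) (2 ^ (N - card A)) W" by metis
  obtain \<Psi> where "\<And>a b. a < 2 ^ card A \<Longrightarrow> b < 2 ^ (N - card A) \<Longrightarrow> amp N A \<Psi> a b = W a b / complex_of_real (sqrt (2 ^ card A))"
    using amp_surj[OF A, of "\<lambda>a b. W a b / complex_of_real (sqrt (2 ^ card A))"] by blast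
  then show ?thesis using max_entangled_of_coiso[OF W] by blast
qed

lemma max_overlap_bounds:
  assumes "is_pure_state N \<psi>"
  shows "0 \<le> max_overlap N A \<psi>" "max_overlap N A \<psi> \<le> 2 ^ N"
proof -
  obtain \<Psi> where \<Psi>: "max_entangled N A \<Psi>" using max_entangled_exists by blast
  have "cmod (inner_st N \<psi> \<Psi>) \<le> max_overlap N A \<psi>"
    unfolding max_overlap_def by (rule cSUP_upper[OF _ bdd_overlap]) (simp add: \<Psi>)
  then show "0 \<le> max_overlap N A \<psi>" using norm_ge_zero order.trans by blast
  have "(\<Sum>x<2 ^ N. cmod (\<psi> x)) \<le> (\<Sum>x<(2::nat) ^ N. 1)"
  proof (rule sum_mono)
    fix x :: nat assume "x \<in> {..<2 ^ N}"
    then have "(cmod (\<psi> x))\<^sup>2 \<le> (\<Sum>x<2 ^ N. (cmod (\<psi> x))\<^sup>2)" by (intro member_le_sum) auto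
    then show "cmod (\<psi> x) \<le> 1" using assms by (simp add: is_pure_state_def power2_le_imp_le)
  qed
  then have b: "(\<Sum>x<2 ^ N. cmod (\<psi> x)) \<le> 2 ^ N" by simp
  show "max_overlap N A \<psi> \<le> 2 ^ N"
    unfolding max_overlap_def
  proof (rule cSUP_least)
    show "{\<Psi>. max_entangled N A \<Psi>} \<noteq> {}" using \<Psi> by blast
    fix \<Phi> assume "\<Phi> \<in> {\<Psi>. max_entangled N A \<Psi>}"
    then show "cmod (inner_st N \<psi> \<Phi>) \<le> 2 ^ N"
      using norm_inner_le[of N \<Phi> \<psi>] b by (simp add: max_entangled_def)
  qed
qed

text \<open>A supremum of continuous functions is lower semicontinuous, hence Borel, although the
  index set is uncountable.\<close>

lemma measurable_max_overlap:
  assumes "\<And>x. (\<lambda>g. \<psi> g x) \<in> borel_measurable M"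
  shows "(\<lambda>g. max_overlap N A (\<psi> g)) \<in> borel_measurable M"
proof -
  have "\<psi> \<in> borel_measurable M"
    using measurable_coordinatewise_then_product[of \<psi> M] assms by simp
  moreover have "max_overlap N A \<in> borel_measurable borel"
  proof (rule borel_measurableI_greater)
    fix y
    have "{\<phi> \<in> space borel. y < max_overlap N A \<phi>} = (\<Union>\<Psi>\<in>{\<Psi>. max_entangled N A \<Psi>}. {\<phi>. y < cmod (inner_st N \<phi> \<Psi>)})"
    proof -
      have "y < max_overlap N A \<phi> \<longleftrightarrow> (\<exists>\<Psi>\<in>{\<Psi>. max_entangled N A \<Psi>}. y < cmod (inner_st N \<phi> \<Psi>))" for \<phi>
        unfolding max_overlap_def using max_entangled_exists by (intro less_cSUP_iff bdd_overlap) auto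
      then show ?thesis by auto
    qed
    moreover have "open (\<Union>\<Psi>\<in>{\<Psi>. max_entangled N A \<Psi>}. {\<phi>. y < cmod (inner_st N \<phi> \<Psi>)})"
      unfolding inner_st_def
      by (intro open_UN ballI open_Collect_less continuous_intros continuous_on_product_coordinates)
    ultimately show "{\<phi> \<in> space borel. y < max_overlap N A \<phi>} \<in> sets borel" by simp
  qed
  ultimately show ?thesis by (rule measurable_compose)
qed

end
end

theorem theorem1:
  fixes N :: nat and A :: "nat set" and \<epsilon> :: real and \<psi>0 :: "nat \<Rightarrow> complex"
    and \<mu> :: "mat2 measure" and n :: nat
  assumes "N \<ge> 2"
    and "A \<subseteq> {..<N}"
    and "card A \<le> N - card A"
    and "0 < \<epsilon>" and "\<epsilon> < 1"
    and "is_pure_state N \<psi>0"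
    and "haar_U2 \<mu>"
    and "real n \<ge> 9 * real N * (real N - 1) / 4 * ((3 * ln 2) * real N + ln (1 / \<epsilon>))"
  shows "((\<integral>g. entanglement N A (run_circuit n g \<psi>0) \<partial>circuit_measure N \<mu> n)
           \<ge> real (card A) - (2 powr (- (real (N - card A) - real (card A))) + \<epsilon>) / ln 2)
         \<and> ((\<integral>g. max_overlap N A (run_circuit n g \<psi>0) \<partial>circuit_measure N \<mu> n)
           \<ge> 1 - sqrt ((2 powr (- (real (N - card A) - real (card A))) + \<epsilon>) / (2 * ln 2)))"
proof -
  let ?M = "circuit_measure N \<mu> n"
  let ?\<psi> = "\<lambda>g. run_circuit n g \<psi>0"
  define \<delta> where "\<delta> = 2 powr (- (real (N - card A) - real (card A))) + \<epsilon>"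
  define P where "P = (\<lambda>g. 2 ^ card A * Re (purity N A (quad (set_amp (?\<psi> g)))))"
  interpret c: prob_space ?M by (rule prob_space_circuit[OF assms(7) assms(1)])
  have pure: "AE g in ?M. is_pure_state N (?\<psi> g)"
    by (rule AE_pure_circuit[OF assms(7) assms(1) assms(6)])
  have meas: "(\<lambda>g. ?\<psi> g x) \<in> borel_measurable ?M" for x
    by (rule measurable_run_circuit[OF assms(7) assms(1) order.refl])
  have P: "integrable ?M P" "(\<integral>g. P g \<partial>?M) \<le> 1 + \<delta>"
    using mean_purity_circuit[OF assms(7,1,6,2,3,4,5,8)] by (simp_all add: P_def \<delta>_def)
  have \<delta>: "0 < \<delta>" "\<delta> \<le> 2"
  proof -
    have "2 powr (- (real (N - card A) - real (card A))) \<le> 2 powr (0::real)"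
      using assms(3) by (intro powr_mono) auto
    then show "\<delta> \<le> 2" using assms(5) by (simp add: \<delta>_def)
    show "0 < \<delta>" using assms(4) by (simp add: \<delta>_def add_pos_pos)
  qed
  have "real (card A) - \<delta> / ln 2 \<le> real (card A) - ((\<integral>g. P g \<partial>?M) - 1) / ln 2"
    using P(2) by (simp add: divide_right_mono)
  also have "\<dots> = (\<integral>g. real (card A) - (P g - 1) / ln 2 \<partial>?M)"
    using P(1) by (simp add: c.prob_space)
  also have "\<dots> \<le> (\<integral>g. entanglement N A (?\<psi> g) \<partial>?M)"
  proof (rule integral_mono_AE)
    show "integrable ?M (\<lambda>g. real (card A) - (P g - 1) / ln 2)" using P(1) by simp
    show "integrable ?M (\<lambda>g. entanglement N A (?\<psi> g))"
    proof (rule c.integrable_const_bound)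
      show "AE g in ?M. norm (entanglement N A (?\<psi> g)) \<le> 2 ^ card A / ln 2"
        using pure by eventually_elim (use entanglement_bounds(2,3)[OF assms(2)] in simp)
      show "(\<lambda>g. entanglement N A (?\<psi> g)) \<in> borel_measurable ?M"
        by (rule measurable_entanglement[OF assms(2) meas])
    qed
    show "AE g in ?M. real (card A) - (P g - 1) / ln 2 \<le> entanglement N A (?\<psi> g)"
      using pure unfolding P_def by eventually_elim (rule entanglement_bounds(1)[OF assms(2)])
  qed
  finally have entry: "real (card A) - \<delta> / ln 2 \<le> (\<integral>g. entanglement N A (?\<psi> g) \<partial>?M)" .
  \<comment> \<open>The purity gives the linear overlap bound 1 - \<delta> / 2; it implies the
    square root form because \<delta> \<le> 2 and ln 2 < 1.\<close>
  have "\<delta> / 2 \<le> sqrt (\<delta> / (2 * ln 2))"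
  proof (rule real_le_rsqrt)
    have "\<delta> * \<delta> \<le> 2 * \<delta>" using \<delta> by (intro mult_right_mono) auto
    also have "2 * \<delta> \<le> 2 * \<delta> / ln 2" using \<delta> ln_2_less_1 by (simp add: le_divide_eq)
    finally show "(\<delta> / 2)\<^sup>2 \<le> \<delta> / (2 * ln 2)" by (simp add: power2_eq_square field_simps)
  qed
  then have "1 - sqrt (\<delta> / (2 * ln 2)) \<le> (3 - (\<integral>g. P g \<partial>?M)) / 2" using P(2) by (simp add: field_simps)
  also have "\<dots> = (\<integral>g. (3 - P g) / 2 \<partial>?M)"
    using P(1) by (simp add: c.prob_space)
  also have "\<dots> \<le> (\<integral>g. max_overlap N A (?\<psi> g) \<partial>?M)"
  proof (rule integral_mono_AE)
    show "integrable ?M (\<lambda>g. (3 - P g) / 2)" using P(1) by simp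
    show "integrable ?M (\<lambda>g. max_overlap N A (?\<psi> g))"
    proof (rule c.integrable_const_bound)
      show "AE g in ?M. norm (max_overlap N A (?\<psi> g)) \<le> 2 ^ N"
        using pure by eventually_elim (use max_overlap_bounds[OF assms(2,3)] in simp)
      show "(\<lambda>g. max_overlap N A (?\<psi> g)) \<in> borel_measurable ?M"
        by (rule measurable_max_overlap[OF assms(2,3) meas])
    qed
    show "AE g in ?M. (3 - P g) / 2 \<le> max_overlap N A (?\<psi> g)"
      using pure unfolding P_def by eventually_elim (rule max_overlap_ge[OF assms(2,3)])
  qed
  finally have "1 - sqrt (\<delta> / (2 * ln 2)) \<le> (\<integral>g. max_overlap N A (?\<psi> g) \<partial>?M)" .
  with entry show ?thesis by (simp add: \<delta>_def)
qed

end
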